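(* Let $n\ge3$, $\mathbf a$ a real magnetic potential on $\mathbb R^n$ with $\mathbf a\in L^2_{\mathrm{loc}}$ and magnetic field $b_{jk}=\partial_ka_j-\partial_ja_k\in L^1_{\mathrm{loc}}$, with $|\mathbf B|\in RH_{n/2}$ and $|\mathbf B|\ge1$, and take $V\equiv0$. Assume $\mathbb R^n=\Omega_1\cup T\cup\Omega_2$ with $\Omega_1,\Omega_2,T$ open, $\partial\Omega_i\subset T$ and $d_i:=\operatorname{dist}(\Omega_i\setminus T,\partial\Omega_i)>0$ for $i=1,2$, and that, in one fixed coordinate system, each $b_{jk}$ does not change sign on $\Omega_1$ and each $b_{jk}$ does not change sign on $\Omega_2$. Let $K\ge1$. Then there is $\mu=\mu(K)>0$ (depending only on $K,n,d_1,d_2$ and the $RH_{n/2}$ characteristic of $|\mathbf B|$) such that if $M\ge\max\{1,\sqrt\mu\}$ and $|\nabla\mathbf B(x)|\le Km^2(x,|\mathbf B|+1)$ for each $x\in T+M:=\{x:\operatorname{dist}(x,T)<M\}$, then there is $C$ with $$\int_{\mathbb R^n}\frac1u|f|^2\le C\int_{\mathbb R^n}|D_{\mathbf a}f|^2\quad\text{for any }f\in C_c^\infty(\mathbb R^n),$$ where $u$ is the landscape function of $-\Delta+|\mathbf B|$ on $\mathbb R^n$.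
   Context: $|\mathbf B|=\sum_{j<k}|b_{jk}|$; $RH_{n/2}$: non-negative $w$ with $(\frac1{|B|}\int_Bw^{n/2})^{2/n}\le K'\frac1{|B|}\int_Bw$ for all balls, best $K'$ the characteristic. $D_{\mathbf a}=(\partial_j-ia_j)_j$. $\frac1{m(x,w)}=\sup\{r>0:r^{2-n}\int_{B(x,r)}w\le C_1\}$ for a fixed constant $C_1$. Landscape function of $-\Delta+W$ ($W\ge0$): non-decreasing limit as $R\to\infty$ of zero-Dirichlet Lax–Milgram solutions of $(-\Delta+W)u_R=1$ on $B(x_0,R)$, extended by zero. *)

theory Defs
  imports "HOL-Analysis.Analysis"
begin

definition pd :: "'n::finite \<Rightarrow> (real^'n \<Rightarrow> 'b::real_normed_vector) \<Rightarrow> real^'n \<Rightarrow> 'b" where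
  "pd l f x = frechet_derivative f (at x) (axis l 1)"

fun iter_pd :: "'n::finite list \<Rightarrow> (real^'n \<Rightarrow> 'b::real_normed_vector) \<Rightarrow> real^'n \<Rightarrow> 'b" where
  "iter_pd [] f = f"
| "iter_pd (l # ls) f = pd l (iter_pd ls f)"

definition smooth_fun :: "(real^'n::finite \<Rightarrow> 'b::real_normed_vector) \<Rightarrow> bool" where
  "smooth_fun f \<longleftrightarrow> (\<forall>ls x. iter_pd ls f differentiable (at x))"

definition test_fun :: "(real^'n::finite \<Rightarrow> 'b::real_normed_vector) \<Rightarrow> bool" where
  "test_fun f \<longleftrightarrow> smooth_fun f \<and> (\<exists>R. \<forall>x. norm x \<ge> R \<longrightarrow> f x = 0)"

definition test_fun_ball :: "real^'n::finite \<Rightarrow> real \<Rightarrow> (real^'n \<Rightarrow> real) \<Rightarrow> bool" where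
  "test_fun_ball x0 R f \<longleftrightarrow> smooth_fun f \<and> (\<exists>r<R. \<forall>x. dist x0 x \<ge> r \<longrightarrow> f x = 0)"

definition grad :: "(real^'n::finite \<Rightarrow> real) \<Rightarrow> real^'n \<Rightarrow> real^'n" where
  "grad f x = (\<chi> l. pd l f x)"

definition Lloc :: "real \<Rightarrow> (real^'n::finite \<Rightarrow> real) \<Rightarrow> bool" where
  "Lloc p f \<longleftrightarrow> f \<in> borel_measurable lborel \<and>
     (\<forall>x r. set_nn_integral lborel (ball x r) (\<lambda>y. ennreal (\<bar>f y\<bar> powr p)) < \<infinity>)"

text \<open>Magnetic potential a in L^2_loc with distributional field b_jk = d_k a_j - d_j a_k in L^1_loc.\<close>
definition magnetic_field :: "(real^'n::finite \<Rightarrow> real^'n) \<Rightarrow> ('n \<Rightarrow> 'n \<Rightarrow> real^'n \<Rightarrow> real) \<Rightarrow> bool" where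
  "magnetic_field a b \<longleftrightarrow>
     (\<forall>j. Lloc 2 (\<lambda>x. a x $ j)) \<and> (\<forall>j k. Lloc 1 (b j k)) \<and>
     (\<forall>j k \<phi>. test_fun (\<phi> :: real^'n \<Rightarrow> real) \<longrightarrow>
        (LINT x|lborel. b j k x * \<phi> x) =
        (LINT x|lborel. - (a x $ j) * pd k \<phi> x + (a x $ k) * pd j \<phi> x))"

definition Bnorm :: "('n::{finite,linorder} \<Rightarrow> 'n \<Rightarrow> (real,'n) vec \<Rightarrow> real) \<Rightarrow> (real,'n) vec \<Rightarrow> real" where
  "Bnorm b x = (\<Sum>(j,k)\<in>{(j,k). j < k}. \<bar>b j k x\<bar>)"

definition gradBnorm :: "('n::{finite,linorder} \<Rightarrow> 'n \<Rightarrow> (real,'n) vec \<Rightarrow> real) \<Rightarrow> (real,'n) vec \<Rightarrow> real" where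
  "gradBnorm b x = (\<Sum>(j,k)\<in>{(j,k). j < k}. norm (grad (b j k) x))"

definition Da_sq :: "(real^'n::finite \<Rightarrow> real^'n) \<Rightarrow> (real^'n \<Rightarrow> complex) \<Rightarrow> real^'n \<Rightarrow> real" where
  "Da_sq a f x = (\<Sum>l\<in>UNIV. (cmod (pd l f x - \<i> * complex_of_real (a x $ l) * f x))\<^sup>2)"

definition RH_ineq :: "real \<Rightarrow> (real^'n::finite \<Rightarrow> real) \<Rightarrow> real \<Rightarrow> bool" where
  "RH_ineq q w K' \<longleftrightarrow> (\<forall>x r. r > 0 \<longrightarrow>
     ((LINT y:ball x r|lborel. w y powr q) / measure lborel (ball x r)) powr (1 / q)
       \<le> K' * ((LINT y:ball x r|lborel. w y) / measure lborel (ball x r)))"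

definition in_RH :: "real \<Rightarrow> (real^'n::finite \<Rightarrow> real) \<Rightarrow> bool" where
  "in_RH q w \<longleftrightarrow> w \<in> borel_measurable lborel \<and> (\<forall>x. w x \<ge> 0) \<and>
     (\<forall>x r. set_integrable lborel (ball x r) w \<and> set_integrable lborel (ball x r) (\<lambda>y. w y powr q)) \<and>
     (\<exists>K'. RH_ineq q w K')"

definition RH_char :: "real \<Rightarrow> (real^'n::finite \<Rightarrow> real) \<Rightarrow> real" where
  "RH_char q w = Inf {K'. RH_ineq q w K'}"

definition mfun :: "real \<Rightarrow> (real^'n::finite \<Rightarrow> real) \<Rightarrow> real^'n \<Rightarrow> real" where
  "mfun C1 w x = 1 / Sup {r. r > 0 \<and> r powr (2 - real CARD('n)) * (LINT y:ball x r|lborel. w y) \<le> C1}"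

text \<open>Zero-Dirichlet Lax-Milgram solution of (-Delta + W) v = 1 on B(x0,R), extended by zero:
  v lies in the closure of C_c^infinity(B(x0,R)) w.r.t. the form norm
  (int |grad phi|^2 + W phi^2 + phi^2)^(1/2), with weak gradient g, and satisfies the weak equation.\<close>
definition dirichlet_sol :: "(real^'n::finite \<Rightarrow> real) \<Rightarrow> real^'n \<Rightarrow> real \<Rightarrow> (real^'n \<Rightarrow> real) \<Rightarrow> bool" where
  "dirichlet_sol W x0 R v \<longleftrightarrow> v \<in> borel_measurable lborel \<and>
     (\<exists>g :: real^'n \<Rightarrow> real^'n. g \<in> borel_measurable lborel \<and>
       (\<exists>\<phi>s. (\<forall>k::nat. test_fun_ball x0 R (\<phi>s k)) \<and>
          ((\<lambda>k. \<integral>\<^sup>+x. ennreal ((\<phi>s k x - v x)\<^sup>2) \<partial>lborel) \<longlonglongrightarrow> 0) \<and>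
          ((\<lambda>k. \<integral>\<^sup>+x. ennreal ((norm (grad (\<phi>s k) x - g x))\<^sup>2) \<partial>lborel) \<longlonglongrightarrow> 0) \<and>
          ((\<lambda>k. \<integral>\<^sup>+x. ennreal (W x * (\<phi>s k x - v x)\<^sup>2) \<partial>lborel) \<longlonglongrightarrow> 0)) \<and>
       (\<forall>\<phi>. test_fun_ball x0 R \<phi> \<longrightarrow>
          (LINT x|lborel. g x \<bullet> grad \<phi> x + W x * v x * \<phi> x) = (LINT x|lborel. \<phi> x)))"

definition is_landscape :: "(real^'n::finite \<Rightarrow> real) \<Rightarrow> (real^'n \<Rightarrow> real) \<Rightarrow> bool" where
  "is_landscape W u \<longleftrightarrow> (\<exists>x0 us. (\<forall>k::nat. dirichlet_sol W x0 (real (Suc k)) (us k)) \<and>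
      (AE x in lborel. (\<lambda>k. us k x) \<longlonglongrightarrow> u x))"

end

theory Submission
  imports Defs
begin

text \<open>
  Testing the equation of a Dirichlet solution \<open>v\<close> of \<open>-\<Delta> + |B|\<close> with \<open>|f|\<^sup>2/(v + \<epsilon>)\<close> and
  letting \<open>v\<close> increase to \<open>u\<close> bounds \<open>\<integral> |f|\<^sup>2/u\<close> by \<open>\<integral> |D f|\<^sup>2 + |B| |f|\<^sup>2\<close>, so it remains to bound
  \<open>\<integral> |B| |f|\<^sup>2\<close> by \<open>\<integral> |D f|\<^sup>2\<close>. Since \<open>[D\<^sub>j, D\<^sub>k] = \<plusminus>\<i> b\<^sub>j\<^sub>k\<close>, for every bounded Lipschitz \<open>\<phi>\<close> the integral
  \<open>\<integral> \<phi> b\<^sub>j\<^sub>k |f|\<^sup>2\<close> is at most \<open>C\<^sub>\<epsilon> \<integral> |D f|\<^sup>2 + \<epsilon> \<integral> |f|\<^sup>2\<close>, and the last term is absorbed by \<open>|B| \<ge> 1\<close>.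
  On the regions \<open>\<Omega>\<^sub>i\<close> the function \<open>\<phi>\<close> is a cutoff times the sign of \<open>b\<^sub>j\<^sub>k\<close>; near \<open>T\<close> it is a cutoff times
  \<open>b\<^sub>j\<^sub>k / (1 + |B|\<^sup>2)\<^sup>1\<^sup>/\<^sup>2\<close>, which is Lipschitz because the gradient hypothesis forces
  \<open>m\<^sup>2 \<le> C (1 + |B|)\<close> there.
\<close>

subsection \<open>Smooth functions\<close>

text \<open>The distributional field equation and the Dirichlet problem can only be tested with
  smooth functions of compact support, whereas the functions to be inserted are merely Lipschitz or
  C^1. Polynomials bridge the gap in both places: they stay smooth under products and composition,
  and they are multiplied by |f|^2 or, with zero constant term, composed with a test function, which
  supplies compact support. For the Lipschitz multipliers plain uniform approximation is not enough,
  because slopes must stay bounded; convolution with the Landau kernel preserves them.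

  The bound for m^2 near T is not a pointwise matter: the gradient hypothesis is measured by m^2
  itself, so it is weak exactly where m is large. At a point where m is nearly maximal, relative to
  the distance from the boundary of a ball, |B| stays controlled over a length comparable to 1/m,
  and then its average is too small for so large an m. As |B| is not differentiable, (1 + sum
  b_jk^2)^(1/2), comparable to 1 + |B|, takes its place in this argument.\<close>

lemma pd_eqI: "(f has_derivative D) (at x) \<Longrightarrow> pd l f x = D (axis l 1)"
  unfolding pd_def using frechet_derivative_at by metis

lemma pd_works:
  fixes f :: "real^'n::finite \<Rightarrow> 'b::real_normed_vector"
  assumes "f differentiable (at x)"
  shows "(f has_derivative (\<lambda>h. \<Sum>l\<in>UNIV. h $ l *\<^sub>R pd l f x)) (at x)"
proof -
  let ?D = "frechet_derivative f (at x)"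
  have d: "(f has_derivative ?D) (at x)"
    using assms frechet_derivative_works by blast
  then have lin: "linear ?D" by (rule has_derivative_linear)
  have "?D h = (\<Sum>l\<in>UNIV. h $ l *\<^sub>R pd l f x)" for h
  proof -
    have "?D h = ?D (\<Sum>l\<in>UNIV. h $ l *\<^sub>R axis l 1)"
      using basis_expansion[of h] by (simp add: scalar_mult_eq_scaleR)
    also have "\<dots> = (\<Sum>l\<in>UNIV. h $ l *\<^sub>R ?D (axis l 1))"
      using lin by (simp add: linear_sum linear_scale)
    finally show ?thesis by (simp add: pd_def)
  qed
  then have "?D = (\<lambda>h. \<Sum>l\<in>UNIV. h $ l *\<^sub>R pd l f x)" by (rule ext)
  with d show ?thesis by metis
qed

lemma pd_add: "f differentiable (at x) \<Longrightarrow> g differentiable (at x) \<Longrightarrow>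
   pd l (\<lambda>x. f x + g x) x = pd l f x + pd l g x"
  unfolding frechet_derivative_works by (subst pd_eqI[OF has_derivative_add]) (auto simp: pd_def)

lemma pd_mult:
  fixes f g :: "real^'n::finite \<Rightarrow> real"
  shows "f differentiable (at x) \<Longrightarrow> g differentiable (at x) \<Longrightarrow>
   pd l (\<lambda>x. f x * g x) x = f x * pd l g x + pd l f x * g x"
  unfolding frechet_derivative_works by (subst pd_eqI[OF has_derivative_mult]) (auto simp: pd_def)

lemma pd_compose_linear:
  assumes "bounded_linear h" "f differentiable (at x)"
  shows "pd l (\<lambda>x. h (f x)) x = h (pd l f x)"
  using assms unfolding frechet_derivative_works
  by (subst pd_eqI[OF bounded_linear.has_derivative]) (auto simp: pd_def)

lemma pd_const: "pd l (\<lambda>x. c) = (\<lambda>x. 0)"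
  by (simp add: pd_def fun_eq_iff)

text \<open>\<open>iter_pd\<close> puts each further derivative on the outside, so a class of
  differentiable functions that is stable under \<open>pd\<close> contains all iterated derivatives
  of its members. Smoothness proofs thus reduce to the choice of an invariant class.\<close>

lemma smooth_fun_coinduct:
  assumes "S f" and diff: "\<And>g x. S g \<Longrightarrow> g differentiable (at x)" and cl: "\<And>g l. S g \<Longrightarrow> S (pd l g)"
  shows "smooth_fun f"
proof -
  have "S (iter_pd ls f)" for ls by (induction ls) (use assms in auto)
  with diff show ?thesis by (auto simp: smooth_fun_def)
qed

lemma smooth_fun_differentiable: "smooth_fun f \<Longrightarrow> f differentiable (at x)"
  unfolding smooth_fun_def by (drule spec[of _ "[]"]) simp

lemma smooth_fun_pd: "smooth_fun f \<Longrightarrow> smooth_fun (pd l f)"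
proof -
  assume *: "smooth_fun f"
  have "iter_pd ls (pd l f) = iter_pd (ls @ [l]) f" for ls by (induction ls) auto
  with * show ?thesis unfolding smooth_fun_def by simp
qed

lemma smooth_fun_continuous: "smooth_fun f \<Longrightarrow> continuous_on A f"
  by (meson continuous_at_imp_continuous_on differentiable_imp_continuous_within smooth_fun_differentiable)

lemma smooth_fun_const: "smooth_fun (\<lambda>x. c)"
  by (rule smooth_fun_coinduct[where S = "\<lambda>f. \<exists>c. f = (\<lambda>x. c)"]) (auto simp: pd_const)

lemma smooth_fun_bounded_linear: "bounded_linear f \<Longrightarrow> smooth_fun f"
proof (rule smooth_fun_coinduct[where S = "\<lambda>f. bounded_linear f \<or> (\<exists>c. f = (\<lambda>x. c))"])
  fix g :: "real^'a \<Rightarrow> 'b" and l assume "bounded_linear g \<or> (\<exists>c. g = (\<lambda>x. c))"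
  then show "bounded_linear (pd l g) \<or> (\<exists>c. pd l g = (\<lambda>x. c))"
  proof
    assume "bounded_linear g"
    then have "pd l g = (\<lambda>x. g (axis l 1))"
      by (intro ext pd_eqI bounded_linear_imp_has_derivative)
    then show ?thesis by blast
  qed (auto simp: pd_const)
qed (auto simp: bounded_linear_imp_differentiable)

lemma smooth_fun_compose_linear:
  assumes h: "bounded_linear h" and "smooth_fun f"
  shows "smooth_fun (\<lambda>x. h (f x))"
proof (rule smooth_fun_coinduct[where S = "\<lambda>g. \<exists>f. smooth_fun f \<and> g = (\<lambda>x. h (f x))"])
  show "\<exists>fa. smooth_fun fa \<and> (\<lambda>x. h (f x)) = (\<lambda>x. h (fa x))" using assms by blast
next
  fix g l assume "\<exists>f. smooth_fun f \<and> g = (\<lambda>x. h (f x))"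
  then obtain f where f: "smooth_fun f" "g = (\<lambda>x. h (f x))" by blast
  then have "pd l g = (\<lambda>x. h (pd l f x))"
    using pd_compose_linear[OF h smooth_fun_differentiable[OF f(1)]] by blast
  then show "\<exists>f. smooth_fun f \<and> pd l g = (\<lambda>x. h (f x))" using smooth_fun_pd f by blast
next
  fix g x assume "\<exists>f. smooth_fun f \<and> g = (\<lambda>x. h (f x))"
  then obtain f where f: "smooth_fun f" "g = (\<lambda>x. h (f x))" by blast
  show "g differentiable at x"
    using bounded_linear.has_derivative[OF h] smooth_fun_differentiable[OF f(1), of x]
    unfolding differentiable_def f(2) by blast
qed

text \<open>Products of smooth functions do not form an invariant class, because the product rule
  produces sums of products. The algebra generated by the smooth functions does, and it gives
  closure under products and sums at once.\<close>

inductive smooth_alg :: "(real^'n::finite \<Rightarrow> real) \<Rightarrow> bool" where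
  base: "smooth_fun f \<Longrightarrow> smooth_alg f"
| mult: "smooth_alg f \<Longrightarrow> smooth_alg g \<Longrightarrow> smooth_alg (\<lambda>x. f x * g x)"
| add: "smooth_alg f \<Longrightarrow> smooth_alg g \<Longrightarrow> smooth_alg (\<lambda>x. f x + g x)"

lemma smooth_alg_imp_smooth: "smooth_alg f \<Longrightarrow> smooth_fun f"
proof -
  assume f: "smooth_alg f"
  have *: "(\<forall>x. g differentiable (at x)) \<and> (\<forall>l. smooth_alg (pd l g))" if "smooth_alg g" for g :: "real^'n \<Rightarrow> real"
    using that
  proof induction
    case (base f)
    then show ?case by (auto simp: smooth_fun_differentiable smooth_fun_pd smooth_alg.base)
  next
    case (mult f g)
    have "pd l (\<lambda>x. f x * g x) = (\<lambda>x. f x * pd l g x + pd l f x * g x)" for l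
      using mult by (auto intro!: ext pd_mult)
    with mult show ?case by (simp add: smooth_alg.mult smooth_alg.add)
  next
    case (add f g)
    have "pd l (\<lambda>x. f x + g x) = (\<lambda>x. pd l f x + pd l g x)" for l
      using add by (auto intro!: ext pd_add)
    with add show ?case by (simp add: smooth_alg.add)
  qed
  show ?thesis by (rule smooth_fun_coinduct[where S = smooth_alg]) (use f * in auto)
qed

lemma smooth_fun_mult:
  fixes f g :: "real^'n::finite \<Rightarrow> real"
  shows "smooth_fun f \<Longrightarrow> smooth_fun g \<Longrightarrow> smooth_fun (\<lambda>x. f x * g x)"
  by (rule smooth_alg_imp_smooth, rule smooth_alg.mult) (rule smooth_alg.base, assumption)+

lemma smooth_fun_add:
  fixes f g :: "real^'n::finite \<Rightarrow> real"
  shows "smooth_fun f \<Longrightarrow> smooth_fun g \<Longrightarrow> smooth_fun (\<lambda>x. f x + g x)"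
  by (rule smooth_alg_imp_smooth, rule smooth_alg.add) (rule smooth_alg.base, assumption)+

lemma smooth_fun_polynomial:
  fixes p :: "real^'n::finite \<Rightarrow> real"
  assumes "real_polynomial_function p"
  shows "smooth_fun p"
  using assms
  by induction (simp_all add: smooth_fun_bounded_linear smooth_fun_const smooth_fun_add smooth_fun_mult)

lemma smooth_fun_polynomial_compose:
  fixes f :: "real^'n::finite \<Rightarrow> real"
  assumes "real_polynomial_function p" "smooth_fun f"
  shows "smooth_fun (\<lambda>x. p (f x))"
  using assms
  by induction (simp_all add: smooth_fun_compose_linear smooth_fun_const smooth_fun_add smooth_fun_mult)

subsection \<open>Continuous functions of compact support\<close>

lemma compact_support_bounded:
  fixes f :: "real^'n::finite \<Rightarrow> 'b::real_normed_vector"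
  assumes "continuous_on UNIV f" "\<And>x. norm x \<ge> R \<Longrightarrow> f x = 0"
  obtains B where "B > 0" "\<And>x. norm (f x) \<le> B"
proof -
  have "bounded (f ` cball 0 R)"
    using assms(1) by (meson compact_cball compact_continuous_image compact_imp_bounded continuous_on_subset subset_UNIV)
  then obtain B where B: "B > 0" "\<And>x. norm x \<le> R \<Longrightarrow> norm (f x) \<le> B"
    by (auto simp: bounded_pos)
  have "norm (f x) \<le> B" for x using B assms(2)[of x] by (cases "norm x \<le> R") auto
  with B(1) that show ?thesis by blast
qed

lemma compact_support_integrable_mult:
  fixes f w :: "real^'n::finite \<Rightarrow> real"
  assumes "continuous_on UNIV f" "\<And>x. norm x \<ge> R \<Longrightarrow> f x = 0"
    and w: "set_integrable lborel (ball 0 R) w" and wm: "w \<in> borel_measurable lborel"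
  shows "integrable lborel (\<lambda>x. w x * f x)"
proof -
  obtain B where B: "B > 0" "\<And>x. norm (f x) \<le> B" using compact_support_bounded[OF assms(1,2)] by blast
  have fm: "f \<in> borel_measurable lborel"
    using assms(1) by (simp add: borel_measurable_continuous_onI)
  show ?thesis
  proof (rule Bochner_Integration.integrable_bound)
    show "integrable lborel (\<lambda>x. B * (indicator (ball 0 R) x *\<^sub>R w x))"
      using w by (simp add: set_integrable_def)
    show "(\<lambda>x. w x * f x) \<in> borel_measurable lborel" using fm wm by simp
    show "AE x in lborel. norm (w x * f x) \<le> norm (B * (indicat_real (ball 0 R) x *\<^sub>R w x))"
    proof (intro AE_I2)
      fix x
      show "norm (w x * f x) \<le> norm (B * (indicat_real (ball 0 R) x *\<^sub>R w x))"
        using B(1) B(2)[of x] assms(2)[of x] mult_right_mono[of "\<bar>f x\<bar>" B "\<bar>w x\<bar>"]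
        by (cases "norm x < R") (auto simp: abs_mult mult.commute)
    qed
  qed
qed

lemma compact_support_integrable:
  fixes f :: "real^'n::finite \<Rightarrow> real"
  assumes "continuous_on UNIV f" "\<And>x. norm x \<ge> R \<Longrightarrow> f x = 0"
  shows "integrable lborel f"
proof -
  have "set_integrable lborel (ball 0 R) (\<lambda>x::real^'n. 1::real)"
    unfolding set_integrable_def using emeasure_lborel_ball_finite[of "0::real^'n" R]
    by (simp add: integrable_real_indicator)
  from compact_support_integrable_mult[OF assms this] show ?thesis by simp
qed

text \<open>The strict inequality provides a whole neighbourhood on which \<open>f\<close> is zero.
  Hence the radius \<open>R + 1\<close> for the support of derivatives further on.\<close>

lemma pd_zero_outside:
  fixes f :: "real^'n::finite \<Rightarrow> 'b::real_normed_vector"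
  assumes "\<And>x. norm x \<ge> R \<Longrightarrow> f x = 0" "norm x > R"
  shows "pd l f x = 0"
proof -
  have "(f has_derivative (\<lambda>h. 0)) (at x)"
    by (rule has_derivative_transform_within_open[of "\<lambda>x. 0" _ _ _ "- cball 0 R"])
      (use assms in \<open>auto simp: dist_norm\<close>)
  then show ?thesis by (rule pd_eqI[of f "\<lambda>h. 0"])
qed

section \<open>Translation invariance and vanishing integrals of partial derivatives\<close>

lemma lborel_integral_shift:
  fixes f :: "'a::euclidean_space \<Rightarrow> real"
  assumes "f \<in> borel_measurable borel"
  shows "(LINT x|lborel. f (c + x)) = (LINT x|lborel. f x)"
  using assms by (subst (2) lborel_distr_plus[of c, symmetric]) (rule integral_distr[symmetric, of "(+) c" lborel borel f], simp_all)

lemma has_real_derivative_along_line: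
  fixes g :: "real^'n::finite \<Rightarrow> real"
  assumes "g differentiable (at (x + s *\<^sub>R v))"
  shows "((\<lambda>s. g (x + s *\<^sub>R v)) has_real_derivative (\<Sum>l\<in>UNIV. v $ l * pd l g (x + s *\<^sub>R v))) (at s within A)"
proof -
  have "((\<lambda>s. x + s *\<^sub>R v) has_derivative (\<lambda>t. t *\<^sub>R v)) (at s within A)"
    by (auto intro!: derivative_eq_intros)
  from has_derivative_compose[OF this pd_works[OF assms]]
  have "((\<lambda>s. g (x + s *\<^sub>R v)) has_derivative (\<lambda>t. \<Sum>l\<in>UNIV. (t *\<^sub>R v) $ l *\<^sub>R pd l g (x + s *\<^sub>R v))) (at s within A)" .
  then show ?thesis
    by (rule has_derivative_imp_has_field_derivative) (simp add: sum_distrib_left mult_ac)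
qed

lemma has_real_derivative_along_axis:
  fixes g :: "real^'n::finite \<Rightarrow> real"
  assumes "g differentiable (at (x + s *\<^sub>R axis l 1))"
  shows "((\<lambda>s. g (x + s *\<^sub>R axis l 1)) has_real_derivative pd l g (x + s *\<^sub>R axis l 1)) (at s within A)"
proof -
  have "(\<Sum>m\<in>UNIV. (axis l 1 :: real^'n) $ m * pd m g (x + s *\<^sub>R axis l 1)) =
      (\<Sum>m\<in>UNIV. if m = l then pd m g (x + s *\<^sub>R axis l 1) else 0)"
    by (rule sum.cong) (auto simp: axis_def)
  then show ?thesis
    using has_real_derivative_along_line[OF assms, of A] by simp
qed

text \<open>Difference quotients in direction \<open>axis l 1\<close> have integral zero by
  translation invariance of Lebesgue measure, and they converge to the partial derivative under a
  common bound.\<close>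

lemma integral_pd_eq_0:
  fixes g :: "real^'n::finite \<Rightarrow> real"
  assumes g: "smooth_fun g" and R: "\<And>x. norm x \<ge> R \<Longrightarrow> g x = 0"
  shows "(LINT x|lborel. pd l g x) = 0"
proof -
  define e :: "real^'n" where "e = axis l 1"
  define t where "t k = inverse (real (Suc k))" for k
  have t: "t k > 0" "t k \<le> 1" for k by (auto simp: t_def field_simps)
  have t0: "t \<longlonglongrightarrow> 0" unfolding t_def by (rule LIMSEQ_inverse_real_of_nat)
  have cg: "continuous_on UNIV g" and cp: "continuous_on UNIV (pd l g)"
    using g by (auto intro: smooth_fun_continuous smooth_fun_pd)
  have gm[measurable]: "g \<in> borel_measurable borel" and pm[measurable]: "pd l g \<in> borel_measurable borel"
    using cg cp by (auto intro: borel_measurable_continuous_onI)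
  have pz: "pd l g x = 0" if "norm x \<ge> R + 1" for x
    using pd_zero_outside[of R g x l] R that by auto
  obtain B where B: "B > 0" "\<And>x. norm (pd l g x) \<le> B"
    using compact_support_bounded[OF cp pz] by blast
  have line: "((\<lambda>s. g (x + s *\<^sub>R e)) has_real_derivative pd l g (x + s *\<^sub>R e)) (at s within A)" for x s A
    unfolding e_def by (rule has_real_derivative_along_axis[OF smooth_fun_differentiable[OF g]])
  have ge: "norm e = 1" by (simp add: e_def norm_axis_1)
  define S where "S k x = (g (t k *\<^sub>R e + x) - g x) / t k" for k x
  have gi: "integrable lborel g" by (rule compact_support_integrable[OF cg R])
  have gi2: "integrable lborel (\<lambda>x. g (c + x))" for c
  proof (rule compact_support_integrable[where R = "R + norm c"])
    show "continuous_on UNIV (\<lambda>x. g (c + x))"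
      by (rule continuous_on_compose2[OF cg]) (auto intro!: continuous_intros)
    show "g (c + x) = 0" if "R + norm c \<le> norm x" for x
      using R[of "c + x"] that norm_triangle_ineq2[of x "- c"] by (simp add: add.commute)
  qed
  \<comment> \<open>The steps \<open>t k\<close> are at most 1, so every quotient vanishes beyond
    radius \<open>R + 1\<close>; the ball of radius \<open>R + 2\<close> contains all
    supports.\<close>
  have "(\<lambda>k. LINT x|lborel. S k x) \<longlonglongrightarrow> (LINT x|lborel. pd l g x)"
  proof (rule integral_dominated_convergence[where w = "\<lambda>x. B * indicat_real (ball 0 (R + 2)) x"])
    show "integrable lborel (\<lambda>x::real^'n. B * indicat_real (ball 0 (R + 2)) x)"
      using emeasure_lborel_ball_finite[of "0::real^'n" "R+2"] by (simp add: integrable_real_indicator)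
    show "AE x in lborel. (\<lambda>k. S k x) \<longlonglongrightarrow> pd l g x"
    proof (intro AE_I2)
      fix x
      have "((\<lambda>s. (g (x + s *\<^sub>R e) - g (x + 0 *\<^sub>R e)) / (s - 0)) \<longlongrightarrow> pd l g (x + 0 *\<^sub>R e)) (at 0)"
        using line[of x 0 UNIV] unfolding has_field_derivative_iff by simp
      moreover have "filterlim t (at 0) sequentially"
        using t0 t by (auto simp: filterlim_at intro!: always_eventually) (metis less_irrefl)
      ultimately have "((\<lambda>k. (g (x + t k *\<^sub>R e) - g (x + 0 *\<^sub>R e)) / (t k - 0)) \<longlongrightarrow> pd l g (x + 0 *\<^sub>R e)) sequentially"
        by (rule filterlim_compose)
      then show "(\<lambda>k. S k x) \<longlonglongrightarrow> pd l g x" by (simp add: S_def add.commute)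
    qed
    show "AE x in lborel. norm (S k x) \<le> B * indicat_real (ball 0 (R + 2)) x" for k
    proof (intro AE_I2)
      fix x
      show "norm (S k x) \<le> B * indicat_real (ball 0 (R + 2)) x"
      proof (cases "norm x < R + 2")
        case True
        have "norm (g (x + t k *\<^sub>R e) - g (x + 0 *\<^sub>R e)) \<le> B * norm (t k - 0)"
          by (rule field_differentiable_bound[where S = UNIV, OF _ line]) (use B in auto)
        then show ?thesis using True t[of k] by (simp add: S_def add.commute field_simps)
      next
        case False
        have "norm (t k *\<^sub>R e + x) \<ge> norm x - norm (t k *\<^sub>R e)"
          using norm_triangle_ineq2[of x "- (t k *\<^sub>R e)"] by (simp add: add.commute)
        then have "norm (t k *\<^sub>R e + x) \<ge> R" using False t[of k] ge by simp
        then show ?thesis using False R by (simp add: S_def)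
      qed
    qed
  qed (auto simp: S_def)
  moreover have "(LINT x|lborel. S k x) = 0" for k
    using gi gi2 lborel_integral_shift[OF gm] by (simp add: S_def)
  ultimately show ?thesis by (simp add: LIMSEQ_const_iff)
qed

subsection \<open>Polynomial approximation preserving Lipschitz constants\<close>

text \<open>Finite sums of products \<open>q x * r y\<close> of polynomials. Integrating such a
  kernel against a function of \<open>y\<close> leaves a polynomial in \<open>x\<close>, which is
  how convolution with a polynomial kernel produces polynomials.\<close>

inductive separable :: "('a::real_normed_vector \<Rightarrow> 'a \<Rightarrow> real) \<Rightarrow> bool" where
  base: "real_polynomial_function q \<Longrightarrow> real_polynomial_function r \<Longrightarrow> separable (\<lambda>x y. q x * r y)"
| add: "separable H \<Longrightarrow> separable G \<Longrightarrow> separable (\<lambda>x y. H x y + G x y)"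

lemma separable_mult_base:
  assumes "separable H" "real_polynomial_function q" "real_polynomial_function r"
  shows "separable (\<lambda>x y. (q x * r y) * H x y)"
  using assms
proof induction
  case (base q' r')
  then have "separable (\<lambda>x y. (q x * q' x) * (r y * r' y))"
    by (intro separable.base real_polynomial_function.intros(4))
  then show ?case by (simp add: mult_ac)
next
  case (add H G)
  then have "separable (\<lambda>x y. (q x * r y) * H x y + (q x * r y) * G x y)"
    by (intro separable.add) auto
  then show ?case by (simp add: distrib_left)
qed

lemma separable_mult:
  assumes "separable H" "separable G"
  shows "separable (\<lambda>x y. H x y * G x y)"
  using assms
proof induction
  case (base q r)
  then show ?case by (intro separable_mult_base)
next
  case (add H H')
  then have "separable (\<lambda>x y. H x y * G x y + H' x y * G x y)"
    by (intro separable.add) auto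
  then show ?case by (simp add: distrib_right)
qed

lemma separable_polynomial_diff:
  assumes "real_polynomial_function p"
  shows "separable (\<lambda>x y. p (x - y))"
  using assms
proof induction
  case (linear f)
  then have "separable (\<lambda>x y. f x * 1 + 1 * (- f y))"
    by (intro separable.add separable.base real_polynomial_function.intros(2) real_polynomial_function_minus
        real_polynomial_function.intros(1))
  then show ?case using linear by (simp add: linear_simps)
next
  case (const c)
  have "separable (\<lambda>(x::'a) (y::'a). c * 1)"
    by (intro separable.base real_polynomial_function.intros(2))
  then show ?case by simp
qed (auto intro: separable.add separable_mult)

lemma separable_integral:
  fixes \<phi> :: "real^'n::finite \<Rightarrow> real"
  assumes "separable H" "continuous_on UNIV \<phi>" "\<And>x. norm x \<ge> R \<Longrightarrow> \<phi> x = 0"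
  shows "real_polynomial_function (\<lambda>x. LINT y|lborel. \<phi> y * H x y) \<and> (\<forall>x. integrable lborel (\<lambda>y. \<phi> y * H x y))"
  using assms
proof induction
  case (base q r)
  have "integrable lborel (\<lambda>y. \<phi> y * r y)"
    by (rule compact_support_integrable[where R = R])
      (use base in \<open>auto intro!: continuous_on_mult smooth_fun_continuous[OF smooth_fun_polynomial[of r]]\<close>)
  moreover have "(\<lambda>y. \<phi> y * (q x * r y)) = (\<lambda>y. q x * (\<phi> y * r y))" for x by (simp add: mult_ac)
  ultimately show ?case using base by (simp add: real_polynomial_function.intros(2,4))
next
  case (add H G)
  then show ?case by (simp add: distrib_left real_polynomial_function.intros(3))
qed

text \<open>Convolution with the normalised Landau kernel \<open>k N\<close>. Between points of the
  ball of radius \<open>R\<close> only differences of norm below \<open>2 * R\<close> occur, so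
  truncating the kernel there changes nothing: \<open>p N\<close> is at once a polynomial, by
  separability, and an average of translates of \<open>\<phi>\<close> against a probability density.
  Such averages inherit the bound 1 and the Lipschitz constant exactly.\<close>

lemma lipschitz_polynomial_approx_compact_support:
  fixes \<phi> :: "real^'n::finite \<Rightarrow> real"
  assumes lip: "L-lipschitz_on UNIV \<phi>" and b1: "\<And>x. \<bar>\<phi> x\<bar> \<le> 1"
    and R: "R > 0" and supp: "\<And>x. norm x \<ge> R \<Longrightarrow> \<phi> x = 0"
  obtains p where "\<And>N::nat. real_polynomial_function (p N)"
    "\<And>N x. norm x < R \<Longrightarrow> \<bar>p N x\<bar> \<le> 1"
    "\<And>N x y. norm x < R \<Longrightarrow> norm y < R \<Longrightarrow> \<bar>p N x - p N y\<bar> \<le> L * norm (x - y)"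
    "\<And>x. norm x < R \<Longrightarrow> (\<lambda>N. p N x) \<longlonglongrightarrow> \<phi> x"
proof -
  define \<rho> where "\<rho> = 2 * R"
  have \<rho>: "\<rho> > 0" using R by (simp add: \<rho>_def)
  define k :: "nat \<Rightarrow> real^'n \<Rightarrow> real" where "k N z = (1 - (z \<bullet> z) / \<rho>\<^sup>2) ^ N" for N z
  define \<kappa> where "\<kappa> N z = indicat_real (ball 0 \<rho>) z * k N z" for N z
  define c where "c N = (LINT z|lborel. \<kappa> N z)" for N
  have kpoly: "real_polynomial_function (k N)" for N
  proof -
    have "real_polynomial_function (\<lambda>z::real^'n. \<Sum>b\<in>Basis. (z \<bullet> b) * (z \<bullet> b))"
      by (rule real_polynomial_function_sum)
        (auto intro!: real_polynomial_function.intros(4) real_polynomial_function.intros(1)[OF bounded_linear_inner_left])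
    then have "real_polynomial_function (\<lambda>z::real^'n. z \<bullet> z)"
      by (subst euclidean_inner)
    then show ?thesis unfolding k_def
      by (intro real_polynomial_function_power real_polynomial_function_diff
          real_polynomial_function_divide real_polynomial_function.intros(2))
  qed
  have kr: "0 \<le> 1 - (z \<bullet> z) / \<rho>\<^sup>2 \<and> 1 - (z \<bullet> z) / \<rho>\<^sup>2 \<le> 1" if "norm z < \<rho>" for z :: "real^'n"
    using that \<rho> power_mono[of "norm z" \<rho> 2] by (simp add: power2_norm_eq_inner[symmetric])
  have \<kappa>0: "0 \<le> \<kappa> N z" and \<kappa>1: "\<kappa> N z \<le> indicat_real (ball 0 \<rho>) z" for N z
    using kr[of z] by (auto simp: \<kappa>_def k_def indicator_def intro!: power_le_one)
  have \<phi>c: "continuous_on UNIV \<phi>" using lip lipschitz_on_continuous_on by blast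
  have kc: "continuous_on UNIV (k N)" for N
    using kpoly smooth_fun_continuous smooth_fun_polynomial by blast
  have [measurable]: "\<phi> \<in> borel_measurable borel" "k N \<in> borel_measurable borel" for N
    using \<phi>c kc by (auto intro: borel_measurable_continuous_onI)
  have [measurable]: "\<kappa> N \<in> borel_measurable borel" for N
    unfolding \<kappa>_def by (intro borel_measurable_times borel_measurable_indicator) auto
  have ind: "integrable lborel (\<lambda>z::real^'n. indicat_real (ball 0 r) z)" for r
    using emeasure_lborel_ball_finite[of "0::real^'n" r] by (simp add: integrable_real_indicator)
  have \<kappa>i: "integrable lborel (\<kappa> N)" for N
    by (rule Bochner_Integration.integrable_bound[OF ind[of \<rho>]]) (use \<kappa>0 \<kappa>1 in auto)
  define V where "V r = measure lborel (ball (0::real^'n) r)" for r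
  have V0: "V r > 0" if "r > 0" for r using that content_ball_pos by (simp add: V_def)
  \<comment> \<open>The kernel decreases with the radius, so on a ball it is at least its boundary
    value. Used with half the radius of the tail estimate, this lower bound for the mass beats the
    tail geometrically.\<close>
  have cl: "c N \<ge> V \<delta> * (1 - \<delta>\<^sup>2 / \<rho>\<^sup>2) ^ N" if "0 < \<delta>" "\<delta> < \<rho>" for N \<delta>
  proof -
    have "(LINT z|lborel. (1 - \<delta>\<^sup>2 / \<rho>\<^sup>2) ^ N * indicat_real (ball (0::real^'n) \<delta>) z) \<le> c N"
      unfolding c_def
    proof (rule integral_mono)
      show "integrable lborel (\<lambda>z. (1 - \<delta>\<^sup>2 / \<rho>\<^sup>2) ^ N * indicat_real (ball (0::real^'n) \<delta>) z)"
        using ind by simp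
      show "(1 - \<delta>\<^sup>2 / \<rho>\<^sup>2) ^ N * indicat_real (ball 0 \<delta>) z \<le> \<kappa> N z" for z
      proof (cases "norm z < \<delta>")
        case True
        then have "(z \<bullet> z) / \<rho>\<^sup>2 \<le> \<delta>\<^sup>2 / \<rho>\<^sup>2"
          using power_mono[of "norm z" \<delta> 2] by (simp add: power2_norm_eq_inner[symmetric] divide_right_mono)
        moreover have "\<delta>\<^sup>2 / \<rho>\<^sup>2 \<le> 1" using that \<rho> power_mono[of \<delta> \<rho> 2] by simp
        ultimately show ?thesis using True that by (simp add: \<kappa>_def k_def power_mono)
      next
        case False then show ?thesis using \<kappa>0 by simp
      qed
    qed (rule \<kappa>i)
    then show ?thesis by (simp add: V_def mult.commute)
  qed
  have c0: "c N > 0" for N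
  proof -
    have "0 < V R * (1 - R\<^sup>2 / \<rho>\<^sup>2) ^ N"
      using V0 R by (auto intro!: mult_pos_pos zero_less_power simp: \<rho>_def power_mult_distrib)
    also have "\<dots> \<le> c N" using cl[of R] R by (simp add: \<rho>_def)
    finally show ?thesis .
  qed
  define p where "p N x = (LINT y|lborel. \<phi> y * k N (x - y)) / c N" for N x
  have \<phi>\<kappa>i: "integrable lborel (\<lambda>z. \<phi> (x + z) * \<kappa> N z)" for x N
    by (rule Bochner_Integration.integrable_bound[OF \<kappa>i[of N]])
      (use b1 \<kappa>0 in \<open>auto simp: abs_mult intro!: mult_left_le_one_le\<close>)
  have pe: "p N x = (LINT z|lborel. \<phi> (x + z) * \<kappa> N z) / c N" if "norm x < R" for N x
  proof -
    have "\<phi> y * k N (x - y) = \<phi> y * \<kappa> N (y - x)" for y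
    proof (cases "norm y < R")
      case True
      then have "norm (y - x) < \<rho>" using that norm_triangle_ineq4[of y x] by (simp add: \<rho>_def)
      moreover have "(y - x) \<bullet> (y - x) = (x - y) \<bullet> (x - y)"
        by (metis norm_minus_commute power2_norm_eq_inner)
      ultimately show ?thesis by (simp add: \<kappa>_def k_def)
    qed (simp add: supp)
    moreover have "(LINT y|lborel. \<phi> y * \<kappa> N (y - x)) = (LINT z|lborel. \<phi> (x + z) * \<kappa> N z)"
      using lborel_integral_shift[of "\<lambda>y. \<phi> y * \<kappa> N (y - x)" x] by simp
    ultimately show ?thesis unfolding p_def by presburger
  qed
  \<comment> \<open>Subtracting a constant commutes with averaging. The uniform bound uses
    \<open>\<alpha> = 0\<close>, the convergence uses \<open>\<alpha> = \<phi> x\<close>.\<close>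
  have avg: "\<bar>p N x - \<alpha>\<bar> \<le> e" if "norm x < R" "(LINT z|lborel. \<bar>\<phi> (x + z) - \<alpha>\<bar> * \<kappa> N z) \<le> e * c N" for N x \<alpha> e
  proof -
    have "(LINT z|lborel. (\<phi> (x + z) - \<alpha>) * \<kappa> N z) = (LINT z|lborel. \<phi> (x + z) * \<kappa> N z) - \<alpha> * c N"
      using \<phi>\<kappa>i \<kappa>i by (simp add: left_diff_distrib c_def)
    then have "p N x - \<alpha> = (LINT z|lborel. (\<phi> (x + z) - \<alpha>) * \<kappa> N z) / c N"
      using c0[of N] by (simp add: pe that diff_divide_distrib)
    also have "\<bar>\<dots>\<bar> \<le> (LINT z|lborel. \<bar>(\<phi> (x + z) - \<alpha>) * \<kappa> N z\<bar>) / c N"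
      using c0[of N] by (simp add: divide_right_mono)
    also have "\<dots> \<le> e" using that c0[of N] \<kappa>0 by (simp add: abs_mult pos_divide_le_eq)
    finally show ?thesis .
  qed
  show ?thesis
  proof
    show "real_polynomial_function (p N)" for N
      unfolding p_def
      by (intro real_polynomial_function_divide conjunct1[OF separable_integral]
          separable_polynomial_diff kpoly \<phi>c supp)
  next
    fix N and x :: "real^'n" assume x: "norm x < R"
    have "(LINT z|lborel. \<bar>\<phi> (x + z) - 0\<bar> * \<kappa> N z) \<le> c N"
      unfolding c_def
    proof (rule integral_mono)
      show "integrable lborel (\<lambda>z. \<bar>\<phi> (x + z) - 0\<bar> * \<kappa> N z)"
        using integrable_abs[OF \<phi>\<kappa>i[of x N]] \<kappa>0 by (simp add: abs_mult)
    qed (use b1 \<kappa>0 \<kappa>i in \<open>auto intro!: mult_left_le_one_le\<close>)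
    then show "\<bar>p N x\<bar> \<le> 1" using avg[OF x, of 0 N 1] by simp
  next
    fix N and x y :: "real^'n" assume x: "norm x < R" and y: "norm y < R"
    have "p N x - p N y = (LINT z|lborel. (\<phi> (x + z) - \<phi> (y + z)) * \<kappa> N z) / c N"
      using \<phi>\<kappa>i by (simp add: pe x y left_diff_distrib diff_divide_distrib)
    also have "\<bar>\<dots>\<bar> \<le> (LINT z|lborel. L * norm (x - y) * \<kappa> N z) / c N"
    proof -
      have "\<bar>LINT z|lborel. (\<phi> (x + z) - \<phi> (y + z)) * \<kappa> N z\<bar> \<le> (LINT z|lborel. L * norm (x - y) * \<kappa> N z)"
      proof (rule integral_abs_bound_integral)
        show "integrable lborel (\<lambda>z. (\<phi> (x + z) - \<phi> (y + z)) * \<kappa> N z)"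
          using \<phi>\<kappa>i by (simp add: left_diff_distrib)
        show "integrable lborel (\<lambda>z. L * norm (x - y) * \<kappa> N z)" using \<kappa>i by simp
        show "\<bar>(\<phi> (x + z) - \<phi> (y + z)) * \<kappa> N z\<bar> \<le> L * norm (x - y) * \<kappa> N z" for z
          using lipschitz_onD[OF lip, of "x + z" "y + z"] \<kappa>0[of N z]
          by (auto simp: abs_mult dist_norm intro!: mult_right_mono)
      qed
      then show ?thesis using c0[of N] by (simp add: divide_right_mono)
    qed
    also have "\<dots> = L * norm (x - y)" using c0[of N] by (simp add: c_def[symmetric])
    finally show "\<bar>p N x - p N y\<bar> \<le> L * norm (x - y)" .
  next
    fix x :: "real^'n" assume x: "norm x < R"
    have L0: "L \<ge> 0" using lip lipschitz_on_nonneg by blast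
    show "(\<lambda>N. p N x) \<longlonglongrightarrow> \<phi> x"
    proof (rule LIMSEQ_I)
      fix r :: real assume r: "r > 0"
      define \<delta> where "\<delta> = min (\<rho> / 2) (r / (2 * (L + 1)))"
      have \<delta>: "0 < \<delta>" "\<delta> < \<rho>" using \<rho> r L0 by (auto simp: \<delta>_def)
      have "L * \<delta> \<le> L * (r / (2 * (L + 1)))" using L0 by (intro mult_left_mono) (auto simp: \<delta>_def)
      also have "\<dots> < r" using L0 r by (simp add: field_simps add_nonneg_pos)
      finally have L\<delta>: "L * \<delta> < r" .
      \<comment> \<open>Outside radius \<open>\<delta>\<close> the kernel is at most
        \<open>a ^ N\<close>, while its mass is at least \<open>V (\<delta>/2) * b ^ N\<close>;
        since \<open>a < b\<close>, the quotient tends to zero.\<close>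
      define a where "a = 1 - \<delta>\<^sup>2 / \<rho>\<^sup>2"
      define b where "b = 1 - (\<delta>/2)\<^sup>2 / \<rho>\<^sup>2"
      have q: "0 < \<delta>\<^sup>2 / \<rho>\<^sup>2" "\<delta>\<^sup>2 / \<rho>\<^sup>2 < 1" using \<delta> \<rho> power_strict_mono[of \<delta> \<rho> 2] by auto
      have ab: "0 < a" "a < b" "0 < b" using q by (auto simp: a_def b_def field_simps)
      have V2: "V (\<delta>/2) > 0" using V0 \<delta> by simp
      have est: "\<bar>p N x - \<phi> x\<bar> \<le> L * \<delta> + 2 * V \<rho> / V (\<delta>/2) * (a / b) ^ N" for N
      proof (rule avg[OF x])
        have "(LINT z|lborel. \<bar>\<phi> (x + z) - \<phi> x\<bar> * \<kappa> N z) \<le>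
            (LINT z|lborel. L * \<delta> * \<kappa> N z + 2 * a ^ N * indicat_real (ball 0 \<rho>) z)"
        proof (rule integral_mono)
          show "integrable lborel (\<lambda>z. L * \<delta> * \<kappa> N z + 2 * a ^ N * indicat_real (ball 0 \<rho>) z)"
            using \<kappa>i ind by simp
          show "integrable lborel (\<lambda>z. \<bar>\<phi> (x + z) - \<phi> x\<bar> * \<kappa> N z)"
          proof (rule Bochner_Integration.integrable_bound)
            show "integrable lborel (\<lambda>z. 2 * \<kappa> N z)" using \<kappa>i by simp
            show "AE z in lborel. norm (\<bar>\<phi> (x + z) - \<phi> x\<bar> * \<kappa> N z) \<le> norm (2 * \<kappa> N z)"
            proof (intro AE_I2)
              fix z
              have "\<bar>\<phi> (x + z) - \<phi> x\<bar> \<le> 2" using b1[of "x+z"] b1[of x] by linarith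
              then show "norm (\<bar>\<phi> (x + z) - \<phi> x\<bar> * \<kappa> N z) \<le> norm (2 * \<kappa> N z)"
                using \<kappa>0[of N z] by (auto simp: abs_mult intro!: mult_right_mono)
            qed
          qed simp
          fix z
          show "\<bar>\<phi> (x + z) - \<phi> x\<bar> * \<kappa> N z \<le> L * \<delta> * \<kappa> N z + 2 * a ^ N * indicat_real (ball 0 \<rho>) z"
          proof (cases "norm z < \<delta>")
            case True
            have "\<bar>\<phi> (x + z) - \<phi> x\<bar> \<le> L * norm z"
              using lipschitz_onD[OF lip, of "x + z" x] by (simp add: dist_norm)
            also have "\<dots> \<le> L * \<delta>" using True L0 by (simp add: mult_left_mono)
            finally have "\<bar>\<phi> (x + z) - \<phi> x\<bar> * \<kappa> N z \<le> L * \<delta> * \<kappa> N z"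
              using \<kappa>0 by (simp add: mult_right_mono)
            then show ?thesis using ab by (simp add: add_increasing2)
          next
            case False
            have "\<kappa> N z \<le> a ^ N * indicat_real (ball 0 \<rho>) z"
            proof (cases "norm z < \<rho>")
              case True
              have "(z \<bullet> z) / \<rho>\<^sup>2 \<ge> \<delta>\<^sup>2 / \<rho>\<^sup>2"
                using False \<delta> power_mono[of \<delta> "norm z" 2]
                by (simp add: power2_norm_eq_inner[symmetric] divide_right_mono)
              then show ?thesis using True kr[OF True] by (auto simp: \<kappa>_def k_def a_def intro!: power_mono)
            qed (simp add: \<kappa>_def)
            moreover have "\<bar>\<phi> (x + z) - \<phi> x\<bar> \<le> 2" using b1[of "x+z"] b1[of x] by linarith
            ultimately have "\<bar>\<phi> (x + z) - \<phi> x\<bar> * \<kappa> N z \<le> 2 * (a ^ N * indicat_real (ball 0 \<rho>) z)"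
              using \<kappa>0[of N z] by (intro mult_mono) auto
            then show ?thesis using L0 \<delta> \<kappa>0[of N z] by (simp add: add_increasing)
          qed
        qed
        also have "\<dots> = L * \<delta> * c N + 2 * a ^ N * V \<rho>"
          using \<kappa>i ind by (simp add: c_def V_def)
        also have "2 * a ^ N * V \<rho> = 2 * V \<rho> / V (\<delta>/2) * (a / b) ^ N * (V (\<delta>/2) * b ^ N)"
          using V2 ab by (simp add: power_divide)
        also have "\<dots> \<le> 2 * V \<rho> / V (\<delta>/2) * (a / b) ^ N * c N"
          using cl[of "\<delta>/2" N] \<delta> V2 V0[OF \<rho>] ab by (intro mult_left_mono) (auto simp: b_def)
        finally show "(LINT z|lborel. \<bar>\<phi> (x + z) - \<phi> x\<bar> * \<kappa> N z) \<le>
            (L * \<delta> + 2 * V \<rho> / V (\<delta>/2) * (a / b) ^ N) * c N" by (simp add: distrib_right)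
      qed
      have "(\<lambda>N. L * \<delta> + 2 * V \<rho> / V (\<delta>/2) * (a / b) ^ N) \<longlonglongrightarrow> L * \<delta> + 2 * V \<rho> / V (\<delta>/2) * 0"
        using ab by (intro tendsto_intros LIMSEQ_realpow_zero) auto
      then have "\<forall>\<^sub>F N in sequentially. L * \<delta> + 2 * V \<rho> / V (\<delta>/2) * (a / b) ^ N < r"
        using L\<delta> by (intro order_tendstoD) auto
      then obtain N0 where "\<And>N. N \<ge> N0 \<Longrightarrow> L * \<delta> + 2 * V \<rho> / V (\<delta>/2) * (a / b) ^ N < r"
        by (auto simp: eventually_sequentially)
      then show "\<exists>no. \<forall>n\<ge>no. norm (p n x - \<phi> x) < r"
        using est by (metis order_le_less_trans real_norm_def)
    qed
  qed
qed

text \<open>The cutoff \<open>\<tau>\<close>, equal to 1 on the ball of radius \<open>R\<close> and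
  0 beyond \<open>R + 1\<close>, reduces to compact support. Since \<open>\<phi>\<close> is bounded
  by 1 and \<open>\<tau>\<close> is 1-Lipschitz, the product costs an additional 1 in the Lipschitz
  constant.\<close>

lemma lipschitz_polynomial_approx:
  fixes \<phi> :: "real^'n::finite \<Rightarrow> real"
  assumes lip: "L-lipschitz_on UNIV \<phi>" and b1: "\<And>x. \<bar>\<phi> x\<bar> \<le> 1" and R: "R > 0"
  obtains p where "\<And>N::nat. real_polynomial_function (p N)"
    "\<And>N x. norm x < R \<Longrightarrow> \<bar>p N x\<bar> \<le> 1"
    "\<And>N x y. norm x < R \<Longrightarrow> norm y < R \<Longrightarrow> \<bar>p N x - p N y\<bar> \<le> (L + 1) * norm (x - y)"
    "\<And>x. norm x < R \<Longrightarrow> (\<lambda>N. p N x) \<longlonglongrightarrow> \<phi> x"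
proof -
  define \<tau> :: "real^'n \<Rightarrow> real" where "\<tau> x = max 0 (min 1 (R + 1 - norm x))" for x
  have \<tau>: "0 \<le> \<tau> x" "\<tau> x \<le> 1" for x by (auto simp: \<tau>_def)
  have \<tau>l: "\<bar>\<tau> x - \<tau> y\<bar> \<le> norm (x - y)" for x y
    using norm_triangle_ineq3[of x y] by (auto simp: \<tau>_def max_def min_def)
  have h1: "(L + 1)-lipschitz_on UNIV (\<lambda>x. \<phi> x * \<tau> x)"
  proof (rule lipschitz_onI)
    show "0 \<le> L + 1" using lip lipschitz_on_nonneg by fastforce
    fix x y
    have "\<phi> x * \<tau> x - \<phi> y * \<tau> y = (\<phi> x - \<phi> y) * \<tau> x + \<phi> y * (\<tau> x - \<tau> y)" by (simp add: algebra_simps)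
    also have "\<bar>\<dots>\<bar> \<le> \<bar>\<phi> x - \<phi> y\<bar> * \<bar>\<tau> x\<bar> + \<bar>\<phi> y\<bar> * \<bar>\<tau> x - \<tau> y\<bar>"
      by (metis abs_mult abs_triangle_ineq)
    also have "\<dots> \<le> (L * norm (x - y)) * 1 + 1 * norm (x - y)"
      using lipschitz_onD[OF lip, of x y] b1[of y] \<tau>[of x] \<tau>l[of x y]
      by (intro add_mono mult_mono) (auto simp: dist_norm)
    finally show "dist (\<phi> x * \<tau> x) (\<phi> y * \<tau> y) \<le> (L + 1) * dist x y"
      by (simp add: dist_norm algebra_simps)
  qed
  have h2: "\<bar>\<phi> x * \<tau> x\<bar> \<le> 1" for x
    using b1[of x] \<tau>[of x] by (simp add: abs_mult mult_le_one)
  have h3: "\<phi> x * \<tau> x = 0" if "norm x \<ge> R + 1" for x using that by (simp add: \<tau>_def)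
  have h4: "R + 1 > 0" using R by simp
  obtain p where p: "\<And>N::nat. real_polynomial_function (p N)"
    "\<And>N x. norm x < R + 1 \<Longrightarrow> \<bar>p N x\<bar> \<le> 1"
    "\<And>N x y. norm x < R + 1 \<Longrightarrow> norm y < R + 1 \<Longrightarrow> \<bar>p N x - p N y\<bar> \<le> (L + 1) * norm (x - y)"
    "\<And>x. norm x < R + 1 \<Longrightarrow> (\<lambda>N. p N x) \<longlonglongrightarrow> \<phi> x * \<tau> x"
    by (rule lipschitz_polynomial_approx_compact_support[OF h1 h2 h4 h3]) blast+
  show ?thesis
  proof (rule that[of p])
    show "(\<lambda>N. p N x) \<longlonglongrightarrow> \<phi> x" if "norm x < R" for x
      using p(4)[of x] that by (simp add: \<tau>_def)
  qed (use p in auto)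
qed

section \<open>Symmetry of second derivatives and derivative bounds from Lipschitz bounds\<close>

lemma pd_diff: "f differentiable (at x) \<Longrightarrow> g differentiable (at x) \<Longrightarrow>
   pd l (\<lambda>x. f x - g x) x = pd l f x - pd l g x"
  unfolding frechet_derivative_works by (subst pd_eqI[OF has_derivative_diff]) (auto simp: pd_def)

lemma second_difference_mean_value:
  fixes g :: "real^'n::finite \<Rightarrow> real"
  assumes g: "smooth_fun g" and h: "h > 0"
  shows "\<exists>y. dist x y \<le> 2 * h \<and>
    g (x + h *\<^sub>R axis k 1 + h *\<^sub>R axis j 1) - g (x + h *\<^sub>R axis k 1) - g (x + h *\<^sub>R axis j 1) + g x
      = h\<^sup>2 * pd j (pd k g) y"
proof -
  let ?k = "axis k 1 :: real^'n" and ?j = "axis j 1 :: real^'n"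
  have d: "((\<lambda>s. g (z + s *\<^sub>R ?k)) has_real_derivative pd k g (z + s *\<^sub>R ?k)) (at s)" for s z
    by (rule has_real_derivative_along_axis[OF smooth_fun_differentiable[OF g]])
  have d2: "((\<lambda>s. pd k g (z + s *\<^sub>R ?j)) has_real_derivative pd j (pd k g) (z + s *\<^sub>R ?j)) (at s)" for s z
    by (rule has_real_derivative_along_axis[OF smooth_fun_differentiable[OF smooth_fun_pd[OF g]]])
  define \<phi> where "\<phi> s = g ((x + h *\<^sub>R ?j) + s *\<^sub>R ?k) - g (x + s *\<^sub>R ?k)" for s
  have "\<exists>s>0. s < h \<and> \<phi> h - \<phi> 0 = (h - 0) * (pd k g ((x + h *\<^sub>R ?j) + s *\<^sub>R ?k) - pd k g (x + s *\<^sub>R ?k))"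
    unfolding \<phi>_def by (rule MVT2[OF h]) (intro DERIV_diff d)
  then obtain s where s: "0 < s" "s < h"
    "\<phi> h - \<phi> 0 = h * (pd k g ((x + h *\<^sub>R ?j) + s *\<^sub>R ?k) - pd k g (x + s *\<^sub>R ?k))" by auto
  have "\<exists>t>0. t < h \<and> pd k g ((x + s *\<^sub>R ?k) + h *\<^sub>R ?j) - pd k g ((x + s *\<^sub>R ?k) + 0 *\<^sub>R ?j)
      = (h - 0) * pd j (pd k g) ((x + s *\<^sub>R ?k) + t *\<^sub>R ?j)"
    by (rule MVT2[OF h]) (rule d2)
  then obtain t where t: "0 < t" "t < h" "pd k g ((x + s *\<^sub>R ?k) + h *\<^sub>R ?j) - pd k g (x + s *\<^sub>R ?k)
      = h * pd j (pd k g) ((x + s *\<^sub>R ?k) + t *\<^sub>R ?j)" by auto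
  have "norm (s *\<^sub>R ?k + t *\<^sub>R ?j) \<le> s + t"
    using norm_triangle_ineq[of "s *\<^sub>R ?k" "t *\<^sub>R ?j"] s t by (simp add: norm_axis_1)
  then have "dist x ((x + s *\<^sub>R ?k) + t *\<^sub>R ?j) \<le> 2 * h"
    using s t by (simp add: dist_norm norm_minus_commute algebra_simps)
  moreover have "\<phi> h - \<phi> 0 = h\<^sup>2 * pd j (pd k g) ((x + s *\<^sub>R ?k) + t *\<^sub>R ?j)"
    using s(3) t(3) by (simp add: power2_eq_square algebra_simps)
  ultimately show ?thesis
    by (intro exI[of _ "(x + s *\<^sub>R ?k) + t *\<^sub>R ?j"]) (simp add: \<phi>_def algebra_simps)
qed

text \<open>The second difference is symmetric in \<open>j\<close> and \<open>k\<close>, while two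
  applications of the mean value theorem identify it with either mixed derivative at points tending
  to \<open>x\<close>. Continuity of both derivatives concludes.\<close>

lemma pd_commute:
  fixes g :: "real^'n::finite \<Rightarrow> real"
  assumes g: "smooth_fun g"
  shows "pd j (pd k g) x = pd k (pd j g) x"
proof -
  define h where "h i = inverse (real (Suc i))" for i
  let ?D = "\<lambda>i j k. g (x + h i *\<^sub>R axis k 1 + h i *\<^sub>R axis j 1) - g (x + h i *\<^sub>R axis k 1) - g (x + h i *\<^sub>R axis j 1) + g x"
  have h: "h i > 0" for i by (simp add: h_def)
  have h0: "(\<lambda>i. 2 * h i) \<longlonglongrightarrow> 0"
    using tendsto_mult_right_zero[OF LIMSEQ_inverse_real_of_nat, of 2] by (simp add: h_def)
  have lim: "\<exists>y. (y \<longlonglongrightarrow> x) \<and> (\<forall>i. ?D i j k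
      = (h i)\<^sup>2 * pd j (pd k g) (y i))" for j k
  proof -
    obtain y where y: "\<And>i. dist x (y i) \<le> 2 * h i" 
      "\<And>i. ?D i j k
      = (h i)\<^sup>2 * pd j (pd k g) (y i)"
      using second_difference_mean_value[OF g h, of x _ k j] choice_iff[of "\<lambda>i y. dist x y \<le> 2 * h i \<and>
        ?D i j k
        = (h i)\<^sup>2 * pd j (pd k g) y"] by blast
    have "(\<lambda>i. dist (y i) x) \<longlonglongrightarrow> 0"
      by (rule tendsto_sandwich[OF _ _ tendsto_const h0]) (use y in \<open>auto simp: dist_commute\<close>)
    then show ?thesis using y(2) tendsto_dist_iff by blast
  qed
  obtain y where y: "y \<longlonglongrightarrow> x" "\<And>i. ?D i j k
      = (h i)\<^sup>2 * pd j (pd k g) (y i)" using lim[where j=j and k=k] by blast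
  obtain z where z: "z \<longlonglongrightarrow> x" "\<And>i. ?D i k j
      = (h i)\<^sup>2 * pd k (pd j g) (z i)" using lim[where j=k and k=j] by blast
  have "(h i)\<^sup>2 * pd j (pd k g) (y i) = (h i)\<^sup>2 * pd k (pd j g) (z i)" for i
    unfolding y(2)[of i, symmetric] z(2)[of i, symmetric] by (simp add: algebra_simps)
  then have eq: "pd j (pd k g) (y i) = pd k (pd j g) (z i)" for i using h[of i] by (metis mult_left_cancel less_irrefl zero_less_power)
  have c: "isCont (pd j (pd k g)) x" for j k
    using smooth_fun_pd[OF smooth_fun_pd[OF g]] smooth_fun_differentiable differentiable_imp_continuous_within by blast
  have "(\<lambda>i. pd j (pd k g) (y i)) \<longlonglongrightarrow> pd j (pd k g) x"
    by (rule isCont_tendsto_compose[OF c y(1)])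
  moreover have "(\<lambda>i. pd k (pd j g) (z i)) \<longlonglongrightarrow> pd k (pd j g) x"
    by (rule isCont_tendsto_compose[OF c z(1)])
  ultimately show ?thesis using LIMSEQ_unique by (simp add: eq)
qed

lemma pd_bound_of_lipschitz:
  fixes g :: "real^'n::finite \<Rightarrow> real"
  assumes "g differentiable (at x)" "open U" "x \<in> U" "\<And>y. y \<in> U \<Longrightarrow> \<bar>g y - g x\<bar> \<le> L * norm (y - x)"
  shows "\<bar>pd l g x\<bar> \<le> L"
proof -
  let ?e = "axis l 1 :: real^'n"
  have "((\<lambda>s. g (x + s *\<^sub>R ?e)) has_real_derivative pd l g (x + 0 *\<^sub>R ?e)) (at 0)"
    by (rule has_real_derivative_along_axis) (use assms in simp)
  then have lim: "((\<lambda>s. \<bar>(g (x + s *\<^sub>R ?e) - g x) / s\<bar>) \<longlongrightarrow> \<bar>pd l g x\<bar>) (at 0)"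
    unfolding has_field_derivative_iff by (intro tendsto_rabs) simp
  have "((\<lambda>s. x + s *\<^sub>R ?e) \<longlongrightarrow> x + 0 *\<^sub>R ?e) (at 0)" by (intro tendsto_intros)
  then have "\<forall>\<^sub>F s in at 0. x + s *\<^sub>R ?e \<in> U"
    using assms(2,3) by (auto dest: topological_tendstoD)
  moreover have "\<forall>\<^sub>F s::real in at 0. s \<noteq> 0" by (rule eventually_neq_at_within)
  ultimately have "\<forall>\<^sub>F s in at 0. \<bar>(g (x + s *\<^sub>R ?e) - g x) / s\<bar> \<le> L"
  proof eventually_elim
    case (elim s)
    then show ?case using assms(4)[of "x + s *\<^sub>R ?e"] by (simp add: norm_axis_1 field_simps)
  qed
  then show ?thesis using tendsto_upperbound[OF lim] by simp
qed

subsection \<open>The commutator estimate\<close>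

lemma Lloc_measurable: "Lloc p f \<Longrightarrow> f \<in> borel_measurable lborel"
  by (simp add: Lloc_def)

lemma set_borel_measurable_ball:
  fixes f :: "'a::euclidean_space \<Rightarrow> real"
  shows "f \<in> borel_measurable lborel \<Longrightarrow> set_borel_measurable lborel (ball x r) f"
  unfolding set_borel_measurable_def
  by (intro borel_measurable_scaleR borel_measurable_indicator) auto

lemma Lloc_integrable:
  assumes "Lloc p f"
  shows "set_integrable lborel (ball x r) (\<lambda>y. \<bar>f y\<bar> powr p)"
proof -
  have [measurable]: "f \<in> borel_measurable borel" using Lloc_measurable[OF assms] by simp
  have "(\<integral>\<^sup>+y. ennreal (norm (indicat_real (ball x r) y *\<^sub>R (\<bar>f y\<bar> powr p))) \<partial>lborel)
      = set_nn_integral lborel (ball x r) (\<lambda>y. ennreal (\<bar>f y\<bar> powr p))"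
    by (intro nn_integral_cong) (auto simp: indicator_def)
  also have "\<dots> < \<infinity>" using assms by (auto simp: Lloc_def)
  finally show ?thesis
    unfolding set_integrable_def
    by (intro integrableI_bounded set_borel_measurable_ball[unfolded set_borel_measurable_def]) simp_all
qed

lemma Lloc_1_integrable: "Lloc 1 f \<Longrightarrow> set_integrable lborel (ball x r) f"
  by (rule set_integrable_bound[OF Lloc_integrable[of 1 f]])
    (auto intro: set_borel_measurable_ball dest: Lloc_measurable)

lemma Lloc_2_integrable: "Lloc 2 f \<Longrightarrow> set_integrable lborel (ball x r) (\<lambda>y. (f y)\<^sup>2)"
  using Lloc_integrable[of 2 f x r] by simp

lemma Lloc_2_imp_integrable:
  fixes f :: "real^'n::finite \<Rightarrow> real"
  assumes "Lloc 2 f" shows "set_integrable lborel (ball x r) f"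
proof -
  have "set_integrable lborel (ball x r) (\<lambda>x. 1::real)"
    unfolding set_integrable_def using emeasure_lborel_ball_finite[of x r]
    by (simp add: integrable_real_indicator)
  from set_integral_add(1)[OF this Lloc_2_integrable[OF assms]]
  have "set_integrable lborel (ball x r) (\<lambda>y. 1 + (f y)\<^sup>2)" .
  then show ?thesis
  proof (rule set_integrable_bound)
    show "set_borel_measurable lborel (ball x r) f"
      using Lloc_measurable[OF assms] by (rule set_borel_measurable_ball)
    have "\<bar>t\<bar> \<le> 1 + t\<^sup>2" for t :: real
      using sum_squares_bound[of 1 "\<bar>t\<bar>"] by simp
    then show "AE xa in lborel. xa \<in> ball x r \<longrightarrow> norm (f xa) \<le> norm (1 + (f xa)\<^sup>2)"
      by (simp add: abs_of_nonneg add_nonneg_nonneg)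
  qed
qed


section \<open>Elementary inequalities and the magnetic gradient in real form\<close>

lemma mult_le_half_squares: "(x::real) * y \<le> (x\<^sup>2 + y\<^sup>2) / 2"
  using sum_squares_bound[of x y] by (simp add: mult.assoc)

lemma cross_le_sum_squares:
  fixes f1 f2 x y :: real
  shows "(f1 * y - f2 * x)\<^sup>2 \<le> (f1\<^sup>2 + f2\<^sup>2) * (x\<^sup>2 + y\<^sup>2)"
proof -
  have "(f1\<^sup>2 + f2\<^sup>2) * (x\<^sup>2 + y\<^sup>2) - (f1 * y - f2 * x)\<^sup>2 = (f1 * x + f2 * y)\<^sup>2"
    by (simp add: power2_eq_square algebra_simps)
  then show ?thesis by (metis diff_ge_0_iff_ge zero_le_power2)
qed

text \<open>Cauchy-Schwarz in squared form followed by the weighted arithmetic-geometric mean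
  inequality: the factor of \<open>F\<close> becomes small at the price of
  \<open>1 / \<epsilon>\<close> in front of \<open>E\<close>.\<close>

lemma weighted_young:
  fixes z F E :: real
  assumes "z\<^sup>2 \<le> F * E" "\<epsilon> > 0" "L \<ge> 0" "F \<ge> 0" "E \<ge> 0"
  shows "L * \<bar>z\<bar> \<le> \<epsilon> / 2 * F + L\<^sup>2 / (2 * \<epsilon>) * E"
proof -
  have "\<bar>z\<bar> \<le> sqrt F * sqrt E"
    using assms real_sqrt_le_mono[OF assms(1)] by (simp add: real_sqrt_mult)
  then have "L * \<bar>z\<bar> \<le> L * (sqrt F * sqrt E)" using assms by (simp add: mult_left_mono)
  also have "\<dots> = (sqrt \<epsilon> * sqrt F) * (L / sqrt \<epsilon> * sqrt E)" using assms by simp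
  also have "\<dots> \<le> ((sqrt \<epsilon> * sqrt F)\<^sup>2 + (L / sqrt \<epsilon> * sqrt E)\<^sup>2) / 2"
    by (rule mult_le_half_squares)
  also have "\<dots> = \<epsilon> / 2 * F + L\<^sup>2 / (2 * \<epsilon>) * E"
    using assms by (simp add: power_mult_distrib power_divide field_simps)
  finally show ?thesis .
qed

text \<open>For real and imaginary parts \<open>f1\<close>, \<open>f2\<close> of \<open>f\<close>, the real and imaginary parts of the
  \<open>l\<close>-th component of the magnetic gradient.\<close>

definition DRe :: "(real^'n::finite \<Rightarrow> real^'n) \<Rightarrow> (real^'n \<Rightarrow> real) \<Rightarrow> (real^'n \<Rightarrow> real) \<Rightarrow> 'n \<Rightarrow> real^'n \<Rightarrow> real" where
  "DRe a f1 f2 l x = pd l f1 x + a x $ l * f2 x"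

definition DIm :: "(real^'n::finite \<Rightarrow> real^'n) \<Rightarrow> (real^'n \<Rightarrow> real) \<Rightarrow> (real^'n \<Rightarrow> real) \<Rightarrow> 'n \<Rightarrow> real^'n \<Rightarrow> real" where
  "DIm a f1 f2 l x = pd l f2 x - a x $ l * f1 x"

definition Dsq :: "(real^'n::finite \<Rightarrow> real^'n) \<Rightarrow> (real^'n \<Rightarrow> real) \<Rightarrow> (real^'n \<Rightarrow> real) \<Rightarrow> real^'n \<Rightarrow> real" where
  "Dsq a f1 f2 x = (\<Sum>l\<in>UNIV. (DRe a f1 f2 l x)\<^sup>2 + (DIm a f1 f2 l x)\<^sup>2)"

lemma Dsq_nonneg: "Dsq a f1 f2 x \<ge> 0"
  unfolding Dsq_def by (intro sum_nonneg) simp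

lemma Dsq_ge: "(DRe a f1 f2 l x)\<^sup>2 + (DIm a f1 f2 l x)\<^sup>2 \<le> Dsq a f1 f2 x"
  unfolding Dsq_def by (rule member_le_sum) auto

definition modsq :: "('a \<Rightarrow> real) \<Rightarrow> ('a \<Rightarrow> real) \<Rightarrow> 'a \<Rightarrow> real" where
  "modsq f1 f2 x = (f1 x)\<^sup>2 + (f2 x)\<^sup>2"

text \<open>The complex test function is represented by its real and imaginary parts, so that the
  computation takes place among real smooth functions, for which closure under products and
  \<open>pd_commute\<close> are available.\<close>

locale magnetic_test =
  fixes a :: "real^'n::finite \<Rightarrow> real^'n" and b :: "'n \<Rightarrow> 'n \<Rightarrow> real^'n \<Rightarrow> real"
    and f1 f2 :: "real^'n \<Rightarrow> real" and R :: real
  assumes mag: "magnetic_field a b" and s1: "smooth_fun f1" and s2: "smooth_fun f2"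
    and z1: "\<And>x. norm x \<ge> R \<Longrightarrow> f1 x = 0" and z2: "\<And>x. norm x \<ge> R \<Longrightarrow> f2 x = 0"
begin

abbreviation F where "F \<equiv> modsq f1 f2"

lemma F_nonneg: "F x \<ge> 0" by (simp add: modsq_def)

lemma F_zero: "norm x \<ge> R \<Longrightarrow> F x = 0" by (simp add: modsq_def z1 z2)

lemma smooth_F: "smooth_fun F"
  unfolding modsq_def[abs_def] power2_eq_square using s1 s2 by (intro smooth_fun_add smooth_fun_mult)

lemma a_meas: "(\<lambda>x. a x $ l) \<in> borel_measurable borel"
  using mag Lloc_measurable[of 2 "\<lambda>x. a x $ l"] by (auto simp: magnetic_field_def)

lemma b_meas: "b j k \<in> borel_measurable borel"
  using mag Lloc_measurable[of 1 "b j k"] by (auto simp: magnetic_field_def)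

lemma f_cont: "continuous_on A f1" "continuous_on A f2" "continuous_on A (pd l f1)" "continuous_on A (pd l f2)"
  using s1 s2 by (auto intro: smooth_fun_continuous smooth_fun_pd)

lemma f_meas: "f1 \<in> borel_measurable borel" "f2 \<in> borel_measurable borel"
    "pd l f1 \<in> borel_measurable borel" "pd l f2 \<in> borel_measurable borel"
  using f_cont by (auto intro: borel_measurable_continuous_onI)

lemma pd_zero: "norm x \<ge> R + 1 \<Longrightarrow> pd l f1 x = 0" "norm x \<ge> R + 1 \<Longrightarrow> pd l f2 x = 0"
  using pd_zero_outside[of R f1 x l] pd_zero_outside[of R f2 x l] z1 z2 by auto

lemma integrable_F: "integrable lborel F"
  by (rule compact_support_integrable[OF smooth_fun_continuous[OF smooth_F] F_zero])

lemma integrable_bF: "integrable lborel (\<lambda>x. b j k x * F x)"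
  by (rule compact_support_integrable_mult[OF smooth_fun_continuous[OF smooth_F] F_zero])
    (use mag b_meas in \<open>auto simp: magnetic_field_def intro: Lloc_1_integrable\<close>)

lemma integrable_a_mult:
  assumes "continuous_on UNIV g" "\<And>x. norm x \<ge> R' \<Longrightarrow> g x = 0"
  shows "integrable lborel (\<lambda>x. a x $ l * g x)"
  by (rule compact_support_integrable_mult[OF assms])
    (use mag a_meas in \<open>auto simp: magnetic_field_def intro: Lloc_2_imp_integrable\<close>)

text \<open>Expanding the squares leaves continuous terms, \<open>a\<close> times a continuous
  function, and the square of \<open>a\<close> times \<open>F\<close>. Local square integrability of
  \<open>a\<close> handles the last kind and, on balls, the second.\<close>

lemma integrable_Dsq: "integrable lborel (Dsq a f1 f2)"
proof -
  have 1: "integrable lborel (\<lambda>x. (pd l f1 x)\<^sup>2 + (pd l f2 x)\<^sup>2)" for l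
    by (rule compact_support_integrable[where R = "R + 1"]) (auto intro!: continuous_intros f_cont simp: pd_zero)
  have 2: "integrable lborel (\<lambda>x. a x $ l * (2 * (f2 x * pd l f1 x - f1 x * pd l f2 x)))" for l
    by (rule integrable_a_mult[where R' = "R + 1"]) (auto intro!: continuous_intros f_cont simp: pd_zero)
  have 3: "integrable lborel (\<lambda>x. (a x $ l)\<^sup>2 * F x)" for l
  proof (rule compact_support_integrable_mult[OF smooth_fun_continuous[OF smooth_F] F_zero])
    show "set_integrable lborel (ball 0 R) (\<lambda>x. (a x $ l)\<^sup>2)"
      using mag by (auto simp: magnetic_field_def intro: Lloc_2_integrable)
    show "(\<lambda>x. (a x $ l)\<^sup>2) \<in> borel_measurable lborel" using a_meas by simp
  qed
  have "Dsq a f1 f2 = (\<lambda>x. \<Sum>l\<in>UNIV. ((pd l f1 x)\<^sup>2 + (pd l f2 x)\<^sup>2) +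
      a x $ l * (2 * (f2 x * pd l f1 x - f1 x * pd l f2 x)) + (a x $ l)\<^sup>2 * F x)"
    unfolding Dsq_def DRe_def DIm_def modsq_def by (intro ext sum.cong) (auto simp: power2_eq_square algebra_simps)
  then show ?thesis using 1 2 3 by simp
qed

text \<open>The field equation is tested with \<open>p * F\<close>. In complex notation
  \<open>I\<close> consists of \<open>2 p Im (D_j f cnj (D_k f))\<close> and of derivatives of
  \<open>p\<close> times the current \<open>Im (cnj f D f)\<close>. It differs from the tested
  integrand by the curl of \<open>p Im (cnj f grad f)\<close>, which integrates to zero and in which
  the second derivatives cancel by symmetry.\<close>

lemma commutator_identity:
  fixes j k
  assumes p: "smooth_fun p"
  defines "I \<equiv> \<lambda>x. 2 * p x * (DIm a f1 f2 j x * DRe a f1 f2 k x - DRe a f1 f2 j x * DIm a f1 f2 k x)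
    - pd j p x * (f1 x * DIm a f1 f2 k x - f2 x * DRe a f1 f2 k x)
    + pd k p x * (f1 x * DIm a f1 f2 j x - f2 x * DRe a f1 f2 j x)"
  shows "integrable lborel I" "(LINT x|lborel. b j k x * (p x * F x)) = (LINT x|lborel. I x)"
proof -
  define \<psi> where "\<psi> x = p x * F x" for x
  define G where "G l x = p x * (f1 x * pd l f2 x + (-1) * (f2 x * pd l f1 x))" for l x
  have dp: "p differentiable (at x)" and df: "f1 differentiable (at x)" "f2 differentiable (at x)"
    and dpf: "pd l f1 differentiable (at x)" "pd l f2 differentiable (at x)" for x l
    using p s1 s2 smooth_fun_pd smooth_fun_differentiable by blast+
  have s\<psi>: "smooth_fun \<psi>" unfolding \<psi>_def[abs_def] using p smooth_F by (intro smooth_fun_mult)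
  have sG: "smooth_fun (G l)" for l
    unfolding G_def[abs_def] using p s1 s2
    by (intro smooth_fun_mult smooth_fun_add smooth_fun_pd smooth_fun_const)
  have z\<psi>: "norm x \<ge> R \<Longrightarrow> \<psi> x = 0" and zG: "norm x \<ge> R \<Longrightarrow> G l x = 0" for x l
    by (auto simp: \<psi>_def F_zero G_def z1 z2)
  have pdF: "pd l F x = 2 * (f1 x * pd l f1 x + f2 x * pd l f2 x)" for l x
    unfolding modsq_def[abs_def] power2_eq_square using df by (simp add: pd_add pd_mult algebra_simps)
  have pd\<psi>: "pd l \<psi> x = p x * (2 * (f1 x * pd l f1 x + f2 x * pd l f2 x)) + pd l p x * F x" for l x
    unfolding \<psi>_def[abs_def] using dp smooth_fun_differentiable[OF smooth_F] by (simp add: pd_mult pdF)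
  have pdG: "pd m (G l) x = p x * (f1 x * pd m (pd l f2) x + pd m f1 x * pd l f2 x
      - (f2 x * pd m (pd l f1) x + pd m f2 x * pd l f1 x)) + pd m p x * (f1 x * pd l f2 x - f2 x * pd l f1 x)" for m l x
    unfolding G_def[abs_def] using dp df dpf
    by (simp add: pd_mult pd_diff)
  have I: "I x = (- (a x $ j) * pd k \<psi> x + a x $ k * pd j \<psi> x) - (pd j (G k) x - pd k (G j) x)" for x
    unfolding I_def pd\<psi> pdG DRe_def DIm_def modsq_def pd_commute[OF s1, of k j] pd_commute[OF s2, of k j]
    by (simp add: power2_eq_square algebra_simps)
  have cz: "continuous_on UNIV (pd l \<psi>)" "norm x \<ge> R + 1 \<Longrightarrow> pd l \<psi> x = 0" for l x
    using smooth_fun_continuous[OF smooth_fun_pd[OF s\<psi>]] pd_zero_outside[of R \<psi> x l] z\<psi> by auto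
  have gz: "continuous_on UNIV (pd l (G m))" "norm x \<ge> R + 1 \<Longrightarrow> pd l (G m) x = 0" for l m x
    using smooth_fun_continuous[OF smooth_fun_pd[OF sG]] pd_zero_outside[of R "G m" x l] zG by auto
  have ia: "integrable lborel (\<lambda>x. a x $ m * pd l \<psi> x)" for m l
    by (rule integrable_a_mult[OF cz])
  have iG: "integrable lborel (pd l (G m))" for l m
    by (rule compact_support_integrable[OF gz])
  show "integrable lborel I" unfolding I[abs_def] using ia iG by simp
  have G0: "(LINT x|lborel. pd l (G m) x) = 0" for l m by (rule integral_pd_eq_0[OF sG zG])
  have "test_fun \<psi>" unfolding test_fun_def using s\<psi> z\<psi> by blast
  then have "(LINT x|lborel. b j k x * \<psi> x) = (LINT x|lborel. - (a x $ j) * pd k \<psi> x + (a x $ k) * pd j \<psi> x)"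
    using mag unfolding magnetic_field_def by blast
  also have "\<dots> = (LINT x|lborel. I x)" unfolding I using ia iG G0 by simp
  finally show "(LINT x|lborel. b j k x * (p x * F x)) = (LINT x|lborel. I x)" by (simp add: \<psi>_def)
qed

text \<open>The bounds on \<open>p\<close> refer to the ball of radius \<open>R\<close>, outside
  which the integrand vanishes, since polynomials satisfy such bounds only locally. The commutator
  term costs \<open>2 * Dsq\<close>; each of the two terms with derivatives of \<open>p\<close> is
  split by \<open>weighted_young\<close> and contributes \<open>\<epsilon> / 2\<close> to the factor
  of \<open>F\<close>.\<close>

lemma commutator_bound_smooth:
  assumes p: "smooth_fun p" and p1: "\<And>x. norm x \<le> R \<Longrightarrow> \<bar>p x\<bar> \<le> 1"
    and pl: "\<And>x l. norm x \<le> R \<Longrightarrow> \<bar>pd l p x\<bar> \<le> L" and L: "L \<ge> 0" and \<epsilon>: "\<epsilon> > 0"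
  shows "\<bar>LINT x|lborel. b j k x * (p x * F x)\<bar>
    \<le> (2 + L\<^sup>2 / \<epsilon>) * (LINT x|lborel. Dsq a f1 f2 x) + \<epsilon> * (LINT x|lborel. F x)"
proof -
  let ?X = "DRe a f1 f2" and ?Y = "DIm a f1 f2" and ?E = "Dsq a f1 f2"
  define I where "I x = 2 * p x * (?Y j x * ?X k x - ?X j x * ?Y k x)
    - pd j p x * (f1 x * ?Y k x - f2 x * ?X k x) + pd k p x * (f1 x * ?Y j x - f2 x * ?X j x)" for x
  note id = commutator_identity[OF p, of j k, folded I_def]
  have "\<bar>I x\<bar> \<le> (2 + L\<^sup>2 / \<epsilon>) * ?E x + \<epsilon> * F x" for x
  proof -
    have E0: "?E x \<ge> 0" by (rule Dsq_nonneg)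
    consider "norm x \<le> R" | "norm x > R" by linarith
    then show ?thesis
    proof cases
      case 1
      have "2 * \<bar>?Y j x * ?X k x - ?X j x * ?Y k x\<bar> \<le> ((?X j x)\<^sup>2 + (?Y j x)\<^sup>2) + ((?X k x)\<^sup>2 + (?Y k x)\<^sup>2)"
        using mult_le_half_squares[of "?Y j x" "?X k x"] mult_le_half_squares[of "?X j x" "?Y k x"]
          mult_le_half_squares[of "- ?Y j x" "?X k x"] mult_le_half_squares[of "- ?X j x" "?Y k x"]
        by (simp add: abs_if)
      then have "2 * \<bar>?Y j x * ?X k x - ?X j x * ?Y k x\<bar> \<le> 2 * ?E x"
        using Dsq_ge[of a f1 f2 j x] Dsq_ge[of a f1 f2 k x] by linarith
      then have t1: "\<bar>2 * p x * (?Y j x * ?X k x - ?X j x * ?Y k x)\<bar> \<le> 2 * ?E x"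
        using p1[OF 1] mult_left_le_one_le[of "\<bar>?Y j x * ?X k x - ?X j x * ?Y k x\<bar>" "\<bar>p x\<bar>"] by (simp add: abs_mult)
      have t2: "\<bar>pd m p x * (f1 x * ?Y l x - f2 x * ?X l x)\<bar> \<le> \<epsilon> / 2 * F x + L\<^sup>2 / (2 * \<epsilon>) * ?E x" for l m
      proof -
        have "(f1 x * ?Y l x - f2 x * ?X l x)\<^sup>2 \<le> F x * ((?X l x)\<^sup>2 + (?Y l x)\<^sup>2)"
          unfolding modsq_def by (rule cross_le_sum_squares)
        also have "\<dots> \<le> F x * ?E x" using Dsq_ge F_nonneg by (intro mult_left_mono)
        finally have "L * \<bar>f1 x * ?Y l x - f2 x * ?X l x\<bar> \<le> \<epsilon> / 2 * F x + L\<^sup>2 / (2 * \<epsilon>) * ?E x"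
          using weighted_young \<epsilon> L F_nonneg E0 by blast
        moreover have "\<bar>pd m p x * (f1 x * ?Y l x - f2 x * ?X l x)\<bar> \<le> L * \<bar>f1 x * ?Y l x - f2 x * ?X l x\<bar>"
          using pl[OF 1] by (simp add: abs_mult mult_right_mono)
        ultimately show ?thesis by linarith
      qed
      have abs3: "\<bar>A - B + C\<bar> \<le> e + 2 * d" if "\<bar>A\<bar> \<le> e" "\<bar>B\<bar> \<le> d" "\<bar>C\<bar> \<le> d" for A B C d e :: real
        using that by linarith
      have "\<bar>I x\<bar> \<le> 2 * ?E x + 2 * (\<epsilon> / 2 * F x + L\<^sup>2 / (2 * \<epsilon>) * ?E x)"
        unfolding I_def using abs3[OF t1 t2[of j k] t2[of k j]] .
      also have "\<dots> = (2 + L\<^sup>2 / \<epsilon>) * ?E x + \<epsilon> * F x" by (simp add: field_simps)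
      finally show ?thesis .
    next
      case 2
      then have "I x = 0"
        using z1[of x] z2[of x] pd_zero_outside[of R f1 x] pd_zero_outside[of R f2 x] z1 z2
        by (simp add: I_def DRe_def DIm_def)
      then show ?thesis using E0 F_nonneg \<epsilon> L by simp
    qed
  qed
  then have "\<bar>LINT x|lborel. I x\<bar> \<le> (LINT x|lborel. (2 + L\<^sup>2 / \<epsilon>) * ?E x + \<epsilon> * F x)"
    by (intro integral_abs_bound_integral id) (use integrable_Dsq integrable_F in auto)
  then show ?thesis using integrable_Dsq integrable_F id by simp
qed

text \<open>The polynomials approximating \<open>\<phi>\<close> are bounded by 1 with slopes at most
  \<open>L + 1\<close> on the relevant ball, so the smooth estimate holds for all of them with one
  constant. The left side passes to the limit by dominated convergence.\<close>

lemma commutator_bound: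
  assumes lip: "L-lipschitz_on UNIV \<phi>" and b1: "\<And>x. \<bar>\<phi> x\<bar> \<le> 1" and \<epsilon>: "\<epsilon> > 0"
  shows "\<bar>LINT x|lborel. b j k x * (\<phi> x * F x)\<bar>
    \<le> (2 + (L + 1)\<^sup>2 / \<epsilon>) * (LINT x|lborel. Dsq a f1 f2 x) + \<epsilon> * (LINT x|lborel. F x)"
proof -
  \<comment> \<open>\<open>R\<close> may be nonpositive. The open ball of radius \<open>R'\<close>
    contains the closed ball of radius \<open>R\<close>, so the slope bounds hold up to the boundary
    of the latter.\<close>
  define R' where "R' = \<bar>R\<bar> + 1"
  have R': "R' > 0" "R < R'" by (auto simp: R'_def)
  have L: "L + 1 \<ge> 0" using lipschitz_on_nonneg[OF lip] by simp
  obtain p where p: "\<And>N::nat. real_polynomial_function (p N)"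
    "\<And>N x. norm x < R' \<Longrightarrow> \<bar>p N x\<bar> \<le> 1"
    "\<And>N x y. norm x < R' \<Longrightarrow> norm y < R' \<Longrightarrow> \<bar>p N x - p N y\<bar> \<le> (L + 1) * norm (x - y)"
    "\<And>x. norm x < R' \<Longrightarrow> (\<lambda>N. p N x) \<longlonglongrightarrow> \<phi> x"
    by (rule lipschitz_polynomial_approx[OF lip b1 R'(1)]) blast
  have sp: "smooth_fun (p N)" for N by (rule smooth_fun_polynomial[OF p(1)])
  have [measurable]: "p N \<in> borel_measurable borel" "\<phi> \<in> borel_measurable borel" "F \<in> borel_measurable borel"
     "b j k \<in> borel_measurable borel" for N
    using smooth_fun_continuous[OF sp] smooth_fun_continuous[OF smooth_F] b_meas lipschitz_on_continuous_on[OF lip]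
    by (auto intro: borel_measurable_continuous_onI)
  have "(\<lambda>N. LINT x|lborel. b j k x * (p N x * F x)) \<longlonglongrightarrow> (LINT x|lborel. b j k x * (\<phi> x * F x))"
  proof (rule integral_dominated_convergence[where w = "\<lambda>x. \<bar>b j k x * F x\<bar>"])
    show "integrable lborel (\<lambda>x. \<bar>b j k x * F x\<bar>)" using integrable_bF by (rule integrable_abs)
    show "AE x in lborel. (\<lambda>N. b j k x * (p N x * F x)) \<longlonglongrightarrow> b j k x * (\<phi> x * F x)"
    proof (intro AE_I2)
      fix x show "(\<lambda>N. b j k x * (p N x * F x)) \<longlonglongrightarrow> b j k x * (\<phi> x * F x)"
        using p(4)[of x] F_zero[of x] R' by (cases "norm x < R'") (auto intro!: tendsto_intros)
    qed
    show "AE x in lborel. norm (b j k x * (p N x * F x)) \<le> \<bar>b j k x * F x\<bar>" for N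
    proof (intro AE_I2)
      fix x show "norm (b j k x * (p N x * F x)) \<le> \<bar>b j k x * F x\<bar>"
        using p(2)[of x N] F_zero[of x] R'
        by (cases "norm x < R'") (auto simp: abs_mult intro!: mult_left_mono mult_left_le_one_le)
    qed
  qed auto
  then have lim: "(\<lambda>N. \<bar>LINT x|lborel. b j k x * (p N x * F x)\<bar>) \<longlonglongrightarrow> \<bar>LINT x|lborel. b j k x * (\<phi> x * F x)\<bar>"
    by (rule tendsto_rabs)
  have "\<bar>LINT x|lborel. b j k x * (p N x * F x)\<bar>
    \<le> (2 + (L + 1)\<^sup>2 / \<epsilon>) * (LINT x|lborel. Dsq a f1 f2 x) + \<epsilon> * (LINT x|lborel. F x)" for N
  proof (rule commutator_bound_smooth[OF sp _ _ L \<epsilon>])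
    show "\<bar>p N x\<bar> \<le> 1" if "norm x \<le> R" for x using p(2) that R' by simp
    show "\<bar>pd l (p N) x\<bar> \<le> L + 1" if "norm x \<le> R" for x l
      by (rule pd_bound_of_lipschitz[where U = "ball 0 R'"])
        (use that R' p(3) smooth_fun_differentiable[OF sp] in auto)
  qed
  then show ?thesis by (intro LIMSEQ_le_const2[OF lim]) auto
qed

end

subsection \<open>Square integrable functions\<close>

lemma integrable_mult_squares:
  fixes f h :: "'a \<Rightarrow> real"
  assumes [measurable]: "f \<in> borel_measurable M" "h \<in> borel_measurable M"
    and "integrable M (\<lambda>x. (f x)\<^sup>2)" "integrable M (\<lambda>x. (h x)\<^sup>2)"
  shows "integrable M (\<lambda>x. f x * h x)"
proof (rule Bochner_Integration.integrable_bound)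
  show "integrable M (\<lambda>x. (f x)\<^sup>2 + (h x)\<^sup>2)" using assms by simp
  have "\<bar>s * t\<bar> \<le> s\<^sup>2 + t\<^sup>2" for s t :: real
    using mult_le_half_squares[of "\<bar>s\<bar>" "\<bar>t\<bar>"] by (simp add: abs_mult) (smt (verit) zero_le_power2 field_sum_of_halves)
  then show "AE x in M. norm (f x * h x) \<le> norm ((f x)\<^sup>2 + (h x)\<^sup>2)" by simp
qed simp

lemma integrable_square_of_diff:
  fixes f h :: "'a \<Rightarrow> real"
  assumes [measurable]: "f \<in> borel_measurable M" "h \<in> borel_measurable M"
    and "integrable M (\<lambda>x. (f x)\<^sup>2)" "integrable M (\<lambda>x. (f x - h x)\<^sup>2)"
  shows "integrable M (\<lambda>x. (h x)\<^sup>2)"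
proof (rule Bochner_Integration.integrable_bound)
  show "integrable M (\<lambda>x. 2 * (f x)\<^sup>2 + 2 * (f x - h x)\<^sup>2)" using assms by simp
  have "t\<^sup>2 \<le> 2 * s\<^sup>2 + 2 * (s - t)\<^sup>2" for s t :: real
  proof -
    have "2 * s\<^sup>2 + 2 * (s - t)\<^sup>2 - t\<^sup>2 = (2 * s - t)\<^sup>2" by (simp add: power2_eq_square algebra_simps)
    then show ?thesis by (metis diff_ge_0_iff_ge zero_le_power2)
  qed
  then show "AE x in M. norm ((h x)\<^sup>2) \<le> norm (2 * (f x)\<^sup>2 + 2 * (f x - h x)\<^sup>2)" by simp
qed simp

text \<open>Cauchy-Schwarz in limit form: something tending to zero in L2, paired with a fixed L2
  function. Domination of \<open>r k\<close> is assumed instead of a product formula so that bounded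
  factors can be absorbed into \<open>q\<close>.\<close>

lemma square_pairing_tendsto_0:
  fixes d r :: "nat \<Rightarrow> 'a \<Rightarrow> real" and q :: "'a \<Rightarrow> real"
  assumes [measurable]: "\<And>k. d k \<in> borel_measurable M" "\<And>k. r k \<in> borel_measurable M" "q \<in> borel_measurable M"
    and di: "\<And>k. integrable M (\<lambda>x. (d k x)\<^sup>2)" and d0: "(\<lambda>k. LINT x|M. (d k x)\<^sup>2) \<longlonglongrightarrow> 0"
    and qi: "integrable M (\<lambda>x. (q x)\<^sup>2)"
    and bd: "\<And>k. AE x in M. \<bar>r k x\<bar> \<le> \<bar>d k x\<bar> * \<bar>q x\<bar>"
  shows "\<And>k. integrable M (r k)" "(\<lambda>k. LINT x|M. r k x) \<longlonglongrightarrow> 0"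
proof -
  have dq: "integrable M (\<lambda>x. \<bar>d k x\<bar> * \<bar>q x\<bar>)" for k
    using integrable_abs[OF integrable_mult_squares[OF _ _ di qi]] by (simp add: abs_mult)
  show ri: "integrable M (r k)" for k
    by (rule Bochner_Integration.integrable_bound[OF dq]) (use bd in \<open>auto simp: abs_mult\<close>)
  show "(\<lambda>k. LINT x|M. r k x) \<longlonglongrightarrow> 0"
  proof (rule LIMSEQ_I)
    fix e :: real assume e: "e > 0"
    define A where "A = (LINT x|M. (q x)\<^sup>2) + 1"
    have A: "A > 0" "(LINT x|M. (q x)\<^sup>2) < A" by (auto simp: A_def add_nonneg_pos)
    define t where "t = e / A"
    have t: "t > 0" using e A by (simp add: t_def)
    have est: "\<bar>LINT x|M. r k x\<bar> \<le> (LINT x|M. (d k x)\<^sup>2) / (2 * t) + t / 2 * (LINT x|M. (q x)\<^sup>2)" for k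
    proof -
      have "\<bar>LINT x|M. r k x\<bar> \<le> (LINT x|M. \<bar>r k x\<bar>)" by simp
      also have "\<dots> \<le> (LINT x|M. (d k x)\<^sup>2 / (2 * t) + t / 2 * (q x)\<^sup>2)"
      proof (rule integral_mono_AE)
        show "AE x in M. \<bar>r k x\<bar> \<le> (d k x)\<^sup>2 / (2 * t) + t / 2 * (q x)\<^sup>2"
          using bd[of k]
        proof eventually_elim
          case (elim x)
          have "1 * \<bar>d k x * q x\<bar> \<le> t / 2 * (q x)\<^sup>2 + 1\<^sup>2 / (2 * t) * (d k x)\<^sup>2"
            by (rule weighted_young) (use t in \<open>auto simp: power_mult_distrib\<close>)
          then show ?case using elim by (simp add: abs_mult)
        qed
      qed (use ri di qi in auto)
      finally show ?thesis using di qi by simp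
    qed
    have "(\<lambda>k. (LINT x|M. (d k x)\<^sup>2) / (2 * t)) \<longlonglongrightarrow> 0 / (2 * t)"
      using t by (intro tendsto_divide d0 tendsto_const) auto
    then have "\<forall>\<^sub>F k in sequentially. (LINT x|M. (d k x)\<^sup>2) / (2 * t) < e / 2"
      using e by (intro order_tendstoD) auto
    then obtain N where N: "\<And>k. k \<ge> N \<Longrightarrow> (LINT x|M. (d k x)\<^sup>2) / (2 * t) < e / 2"
      by (auto simp: eventually_sequentially)
    have "t / 2 * (LINT x|M. (q x)\<^sup>2) \<le> t / 2 * A" using A t by (intro mult_left_mono) auto
    also have "\<dots> = e / 2" using A by (simp add: t_def)
    finally have "\<bar>LINT x|M. r k x\<bar> < e" if "k \<ge> N" for k using est[of k] N[OF that] by linarith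
    then show "\<exists>no. \<forall>n\<ge>no. norm ((LINT x|M. r n x) - 0) < e" by auto
  qed
qed

text \<open>Convergence in \<open>ennreal\<close> permits finitely many infinite terms, hence
  integrability on a tail only. The real integrals agree with \<open>enn2real\<close> for every
  index, because both conventions give 0 in the infinite case.\<close>

lemma nn_integral_tendsto_0_tail:
  fixes X :: "nat \<Rightarrow> 'a \<Rightarrow> real"
  assumes [measurable]: "\<And>k. X k \<in> borel_measurable M" and X0: "\<And>k x. X k x \<ge> 0"
    and lim: "(\<lambda>k. \<integral>\<^sup>+x. ennreal (X k x) \<partial>M) \<longlonglongrightarrow> 0"
  shows "\<exists>k0. \<forall>k\<ge>k0. integrable M (X k)" "(\<lambda>k. LINT x|M. X k x) \<longlonglongrightarrow> 0"
proof -
  have "\<forall>\<^sub>F k in sequentially. (\<integral>\<^sup>+x. ennreal (X k x) \<partial>M) < 1"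
    using lim by (intro order_tendstoD) auto
  then obtain k0 where "\<And>k. k \<ge> k0 \<Longrightarrow> (\<integral>\<^sup>+x. ennreal (X k x) \<partial>M) < 1"
    by (auto simp: eventually_sequentially)
  then have "integrable M (X k)" if "k \<ge> k0" for k
    using that X0 by (intro integrableI_nonneg) (auto intro: order_less_trans[OF _ ennreal_one_less_top])
  then show "\<exists>k0. \<forall>k\<ge>k0. integrable M (X k)" by blast
  have "(LINT x|M. X k x) = enn2real (\<integral>\<^sup>+x. ennreal (X k x) \<partial>M)" for k
    using X0 by (intro integral_eq_nn_integral) auto
  moreover have "(\<lambda>k. enn2real (\<integral>\<^sup>+x. ennreal (X k x) \<partial>M)) \<longlonglongrightarrow> 0"
    using tendsto_enn2real[OF lim[folded ennreal_0]] by simp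
  ultimately show "(\<lambda>k. LINT x|M. X k x) \<longlonglongrightarrow> 0" by simp
qed

subsection \<open>Dirichlet solutions\<close>

lemma continuous_grad: "smooth_fun f \<Longrightarrow> continuous_on A (grad f)"
  unfolding grad_def[abs_def] by (intro continuous_on_vec_lambda smooth_fun_continuous smooth_fun_pd)

lemma grad_zero_outside:
  assumes "\<And>x. norm x \<ge> R \<Longrightarrow> f x = 0" "norm x \<ge> R + 1"
  shows "grad f x = 0"
  using pd_zero_outside[of R f x] assms by (simp add: grad_def vec_eq_iff)

lemma test_fun_ball_zero:
  assumes "test_fun_ball x0 R f"
  shows "norm x \<ge> norm x0 + R \<Longrightarrow> f x = 0" "dist x0 x \<ge> R \<Longrightarrow> f x = 0" "smooth_fun f"
proof -
  obtain r where r: "r < R" "\<And>x. dist x0 x \<ge> r \<Longrightarrow> f x = 0" using assms by (auto simp: test_fun_ball_def)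
  show "dist x0 x \<ge> R \<Longrightarrow> f x = 0" using r by simp
  show "norm x \<ge> norm x0 + R \<Longrightarrow> f x = 0"
    using r norm_triangle_ineq2[of x x0] by (simp add: dist_norm norm_minus_commute)
  show "smooth_fun f" using assms by (simp add: test_fun_ball_def)
qed

locale loc_weight =
  fixes W :: "real^'n::finite \<Rightarrow> real"
  assumes W_meas[measurable]: "W \<in> borel_measurable borel" and W_nonneg: "\<And>x. W x \<ge> 0"
    and W_int: "\<And>x r. set_integrable lborel (ball x r) W"
begin

lemma integrable_W_mult:
  assumes "continuous_on UNIV f" "\<And>x. norm x \<ge> R \<Longrightarrow> f x = 0"
  shows "integrable lborel (\<lambda>x. W x * f x)"
  by (rule compact_support_integrable_mult[OF assms]) (use W_int in auto)

text \<open>Dropping \<open>k0\<close> terms makes the three errors integrable, so \<open>v\<close>,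
  \<open>g\<close> and the weighted \<open>v\<close> inherit square integrability from a single test
  function. L1 convergence of the squared errors then yields a subsequence converging almost
  everywhere.\<close>

lemma dirichlet_sol_sequence:
  assumes "dirichlet_sol W x0 R v"
  obtains g \<phi> where
    "v \<in> borel_measurable borel" "g \<in> borel_measurable borel" "\<And>k::nat. test_fun_ball x0 R (\<phi> k)"
    "integrable lborel (\<lambda>x. (v x)\<^sup>2)" "integrable lborel (\<lambda>x. (norm (g x))\<^sup>2)"
    "integrable lborel (\<lambda>x. W x * (v x)\<^sup>2)"
    "\<And>k. integrable lborel (\<lambda>x. (\<phi> k x - v x)\<^sup>2)" "(\<lambda>k. LINT x|lborel. (\<phi> k x - v x)\<^sup>2) \<longlonglongrightarrow> 0"
    "\<And>k. integrable lborel (\<lambda>x. (norm (grad (\<phi> k) x - g x))\<^sup>2)"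
    "(\<lambda>k. LINT x|lborel. (norm (grad (\<phi> k) x - g x))\<^sup>2) \<longlonglongrightarrow> 0"
    "\<And>k. integrable lborel (\<lambda>x. W x * (\<phi> k x - v x)\<^sup>2)"
    "(\<lambda>k. LINT x|lborel. W x * (\<phi> k x - v x)\<^sup>2) \<longlonglongrightarrow> 0"
    "AE x in lborel. (\<lambda>k. \<phi> k x) \<longlonglongrightarrow> v x"
    "\<And>\<psi>. test_fun_ball x0 R \<psi> \<Longrightarrow>
       (LINT x|lborel. g x \<bullet> grad \<psi> x + W x * v x * \<psi> x) = (LINT x|lborel. \<psi> x)"
proof -
  obtain g \<phi> where vm: "v \<in> borel_measurable borel" and gm: "g \<in> borel_measurable borel"
    and \<phi>: "\<And>k::nat. test_fun_ball x0 R (\<phi> k)"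
    and l1: "(\<lambda>k. \<integral>\<^sup>+x. ennreal ((\<phi> k x - v x)\<^sup>2) \<partial>lborel) \<longlonglongrightarrow> 0"
    and l2: "(\<lambda>k. \<integral>\<^sup>+x. ennreal ((norm (grad (\<phi> k) x - g x))\<^sup>2) \<partial>lborel) \<longlonglongrightarrow> 0"
    and l3: "(\<lambda>k. \<integral>\<^sup>+x. ennreal (W x * (\<phi> k x - v x)\<^sup>2) \<partial>lborel) \<longlonglongrightarrow> 0"
    and weak: "\<And>\<psi>. test_fun_ball x0 R \<psi> \<Longrightarrow>
       (LINT x|lborel. g x \<bullet> grad \<psi> x + W x * v x * \<psi> x) = (LINT x|lborel. \<psi> x)"
    using assms unfolding dirichlet_sol_def by auto
  note [measurable] = vm gm
  note sm = test_fun_ball_zero(3)[OF \<phi>]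
  have [measurable]: "\<phi> k \<in> borel_measurable borel" "grad (\<phi> k) \<in> borel_measurable borel" for k
    using smooth_fun_continuous[OF sm] continuous_grad[OF sm] by (auto intro: borel_measurable_continuous_onI)
  have t1: "\<exists>k0. \<forall>k\<ge>k0. integrable lborel (\<lambda>x. (\<phi> k x - v x)\<^sup>2)" "(\<lambda>k. LINT x|lborel. (\<phi> k x - v x)\<^sup>2) \<longlonglongrightarrow> 0"
    using nn_integral_tendsto_0_tail[OF _ _ l1] by auto
  have t2: "\<exists>k0. \<forall>k\<ge>k0. integrable lborel (\<lambda>x. (norm (grad (\<phi> k) x - g x))\<^sup>2)"
    "(\<lambda>k. LINT x|lborel. (norm (grad (\<phi> k) x - g x))\<^sup>2) \<longlonglongrightarrow> 0"
    using nn_integral_tendsto_0_tail[OF _ _ l2] by auto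
  have t3: "\<exists>k0. \<forall>k\<ge>k0. integrable lborel (\<lambda>x. W x * (\<phi> k x - v x)\<^sup>2)"
    "(\<lambda>k. LINT x|lborel. W x * (\<phi> k x - v x)\<^sup>2) \<longlonglongrightarrow> 0"
    using nn_integral_tendsto_0_tail[OF _ _ l3] W_nonneg by auto
  obtain k0 where k0: "\<And>k. k \<ge> k0 \<Longrightarrow> integrable lborel (\<lambda>x. (\<phi> k x - v x)\<^sup>2)"
    "\<And>k. k \<ge> k0 \<Longrightarrow> integrable lborel (\<lambda>x. (norm (grad (\<phi> k) x - g x))\<^sup>2)"
    "\<And>k. k \<ge> k0 \<Longrightarrow> integrable lborel (\<lambda>x. W x * (\<phi> k x - v x)\<^sup>2)"
  proof -
    obtain i1 i2 i3 where "\<forall>k\<ge>i1. integrable lborel (\<lambda>x. (\<phi> k x - v x)\<^sup>2)"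
      "\<forall>k\<ge>i2. integrable lborel (\<lambda>x. (norm (grad (\<phi> k) x - g x))\<^sup>2)"
      "\<forall>k\<ge>i3. integrable lborel (\<lambda>x. W x * (\<phi> k x - v x)\<^sup>2)"
      using t1(1) t2(1) t3(1) by blast
    then show ?thesis using that[of "max i1 (max i2 i3)"] by simp
  qed
  have "\<exists>r. strict_mono r \<and> (AE x in lborel. (\<lambda>k. (\<phi> (r k + k0) x - v x)\<^sup>2) \<longlonglongrightarrow> 0)"
    using LIMSEQ_ignore_initial_segment[OF t1(2), of k0] k0(1)
    by (intro tendsto_L1_AE_subseq[of lborel "\<lambda>k x. (\<phi> (k + k0) x - v x)\<^sup>2"]) auto
  then obtain r where r: "strict_mono r" "AE x in lborel. (\<lambda>k. (\<phi> (r k + k0) x - v x)\<^sup>2) \<longlonglongrightarrow> 0" by blast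
  define s where "s k = r k + k0" for k
  have s: "strict_mono s" "s k \<ge> k0" for k using r(1) by (auto simp: s_def strict_mono_def)
  have ae: "AE x in lborel. (\<lambda>k. \<phi> (s k) x) \<longlonglongrightarrow> v x"
    using r(2)
  proof eventually_elim
    case (elim x)
    have "(\<lambda>k. sqrt ((\<phi> (s k) x - v x)\<^sup>2)) \<longlonglongrightarrow> sqrt 0"
      using elim by (intro tendsto_real_sqrt) (simp add: s_def)
    then have "(\<lambda>k. \<phi> (s k) x - v x) \<longlonglongrightarrow> 0" by (simp add: tendsto_rabs_zero_iff)
    then show ?case using Lim_null by blast
  qed
  have cz: "continuous_on UNIV (\<phi> k)" "norm x \<ge> norm x0 + R \<Longrightarrow> \<phi> k x = 0"
    "continuous_on UNIV (grad (\<phi> k))" "norm x \<ge> norm x0 + R + 1 \<Longrightarrow> grad (\<phi> k) x = 0" for k x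
    using smooth_fun_continuous[OF sm] test_fun_ball_zero(1)[OF \<phi>] continuous_grad[OF sm]
      grad_zero_outside[of "norm x0 + R" "\<phi> k" x] by auto
  have vi: "integrable lborel (\<lambda>x. (v x)\<^sup>2)"
    by (rule integrable_square_of_diff[of "\<phi> k0"])
      (auto intro!: k0 compact_support_integrable[where R = "norm x0 + R"] continuous_intros cz simp: cz(2))
  let ?n = "\<lambda>x. 2 * (norm (grad (\<phi> k0) x))\<^sup>2 + 2 * (norm (grad (\<phi> k0) x - g x))\<^sup>2"
  have gi: "integrable lborel (\<lambda>x. (norm (g x))\<^sup>2)"
  proof (rule Bochner_Integration.integrable_bound)
    show "integrable lborel (\<lambda>x. ?n x)"
    proof (intro Bochner_Integration.integrable_add integrable_mult_right)
      show "integrable lborel (\<lambda>x. (norm (grad (\<phi> k0) x))\<^sup>2)"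
        by (rule compact_support_integrable[where R = "norm x0 + R + 1"])
          (auto intro!: continuous_intros cz simp: cz(4))
    qed (rule k0, simp)
    show "AE x in lborel. norm ((norm (g x))\<^sup>2)
        \<le> norm (?n x)"
    proof (intro AE_I2)
      fix x
      have "norm (g x) \<le> norm (grad (\<phi> k0) x) + norm (grad (\<phi> k0) x - g x)"
        using norm_triangle_ineq4[of "grad (\<phi> k0) x" "grad (\<phi> k0) x - g x"] by simp
      then have "(norm (g x))\<^sup>2 \<le> (norm (grad (\<phi> k0) x) + norm (grad (\<phi> k0) x - g x))\<^sup>2"
        by (rule power_mono) simp
      also have "\<dots> \<le> ?n x"
        using sum_squares_bound[of "norm (grad (\<phi> k0) x)" "norm (grad (\<phi> k0) x - g x)"]
        unfolding power2_sum by linarith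
      finally show "norm ((norm (g x))\<^sup>2)
        \<le> norm (?n x)" by simp
    qed
  qed simp
  have Wi: "integrable lborel (\<lambda>x. W x * (v x)\<^sup>2)"
  proof -
    have sq: "(sqrt (W x) * t)\<^sup>2 = W x * t\<^sup>2" for x t using W_nonneg by (simp add: power_mult_distrib)
    have 1: "integrable lborel (\<lambda>x. (sqrt (W x) * \<phi> k0 x)\<^sup>2)"
      unfolding sq by (rule integrable_W_mult[where R = "norm x0 + R"]) (auto intro!: continuous_intros cz simp: cz(2))
    have 2: "integrable lborel (\<lambda>x. (sqrt (W x) * \<phi> k0 x - sqrt (W x) * v x)\<^sup>2)"
      unfolding right_diff_distrib[symmetric] sq by (rule k0) simp
    have "integrable lborel (\<lambda>x. (sqrt (W x) * v x)\<^sup>2)"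
      by (rule integrable_square_of_diff[OF _ _ 1 2]) simp_all
    then show ?thesis by (simp add: sq)
  qed
  show ?thesis
    by (rule that[of g "\<lambda>k. \<phi> (s k)"])
      (use vm gm \<phi> vi gi Wi k0 s ae weak LIMSEQ_subseq_LIMSEQ[OF t1(2) s(1)] LIMSEQ_subseq_LIMSEQ[OF t2(2) s(1)]
        LIMSEQ_subseq_LIMSEQ[OF t3(2) s(1)] in \<open>auto simp: o_def\<close>)
qed

end

subsection \<open>Nonlinear test functions\<close>

text \<open>Weierstrass approximation is applied to \<open>G'\<close> and the polynomial is
  integrated from 0, since function and derivative must be approximated together. This gives
  \<open>P 0 = 0\<close>, so composing with a test function preserves the support, and an error in
  \<open>P\<close> that vanishes where the test function does.\<close>

lemma antiderivative_polynomial_approx: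
  fixes G G' :: "real \<Rightarrow> real"
  assumes der: "\<And>t. (G has_real_derivative G' t) (at t)" and cont: "continuous_on UNIV G'" and G0: "G 0 = 0"
    and A: "A > 0" and e: "e > 0"
  obtains P P' where "real_polynomial_function P" "\<And>t. (P has_real_derivative P' t) (at t)" "P 0 = 0" "continuous_on UNIV P'"
    "\<And>t. \<bar>t\<bar> \<le> A \<Longrightarrow> \<bar>P' t - G' t\<bar> \<le> e" "\<And>t. \<bar>t\<bar> \<le> A \<Longrightarrow> \<bar>P t - G t\<bar> \<le> e * \<bar>t\<bar>"
proof -
  obtain P' where P': "real_polynomial_function P'" "\<And>t. t \<in> {-A..A} \<Longrightarrow> \<bar>G' t - P' t\<bar> < e"
    by (rule Stone_Weierstrass_real_polynomial_function[OF compact_Icc continuous_on_subset[OF cont subset_UNIV] e, of "-A" A]) blast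
  obtain c n where c: "P' = (\<lambda>x. \<Sum>i\<le>n. c i * x ^ i)"
    using real_polynomial_function_imp_sum[OF P'(1)] by blast
  define P where "P x = (\<Sum>i\<le>n. (c i / real (Suc i)) * x ^ Suc i)" for x
  have Pp: "real_polynomial_function P"
    unfolding P_def[abs_def]
    by (rule real_polynomial_function_sum, simp, rule real_polynomial_function.intros(4),
        rule real_polynomial_function.intros(2), rule real_polynomial_function_power,
        rule real_polynomial_function.intros(1), rule bounded_linear_ident)
  have Pd: "(P has_real_derivative P' t) (at t)" for t
    unfolding P_def[abs_def] c
  proof (rule DERIV_sum)
    fix i
    show "((\<lambda>x. c i / real (Suc i) * x ^ Suc i) has_real_derivative c i * t ^ i) (at t)"
      using DERIV_cmult[OF DERIV_pow[of "Suc i" t UNIV], of "c i / real (Suc i)"] by (simp del: power_Suc of_nat_Suc)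
  qed
  have P0: "P 0 = 0" by (simp add: P_def)
  have b: "\<bar>P' t - G' t\<bar> \<le> e" if "\<bar>t\<bar> \<le> A" for t using P'(2)[of t] that by (auto simp: abs_le_iff)
  have "\<bar>P t - G t\<bar> \<le> e * \<bar>t\<bar>" if "\<bar>t\<bar> \<le> A" for t
  proof -
    have "norm ((P t - G t) - (P 0 - G 0)) \<le> e * norm (t - 0)"
    proof (rule field_differentiable_bound[where S = "{-A..A}" and f' = "\<lambda>t. P' t - G' t"])
      show "((\<lambda>t. P t - G t) has_field_derivative P' z - G' z) (at z within {-A..A})" for z
        by (rule has_field_derivative_at_within, rule DERIV_diff[OF Pd der])
      show "norm (P' z - G' z) \<le> e" if "z \<in> {-A..A}" for z using b[of z] that by (simp add: abs_le_iff)
    qed (use that A in auto)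
    then show ?thesis by (simp add: P0 G0)
  qed
  moreover have "continuous_on UNIV P'" unfolding c by (intro continuous_intros)
  ultimately show ?thesis by (intro that[of P P'] Pp Pd P0 b)
qed

lemma grad_mult_compose:
  fixes \<zeta> \<phi> :: "real^'n::finite \<Rightarrow> real"
  assumes "\<zeta> differentiable (at x)" "\<phi> differentiable (at x)" "(P has_real_derivative P' (\<phi> x)) (at (\<phi> x))"
  shows "grad (\<lambda>x. \<zeta> x * P (\<phi> x)) x = P (\<phi> x) *\<^sub>R grad \<zeta> x + (\<zeta> x * P' (\<phi> x)) *\<^sub>R grad \<phi> x"
proof -
  have \<phi>: "(\<phi> has_derivative frechet_derivative \<phi> (at x)) (at x)"
    using assms(2) frechet_derivative_works by blast
  have d: "((\<lambda>x. P (\<phi> x)) has_derivative (\<lambda>h. P' (\<phi> x) * frechet_derivative \<phi> (at x) h)) (at x)"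
    by (rule has_derivative_compose[OF \<phi>]) (use assms(3) in \<open>simp add: has_field_derivative_def\<close>)
  then have "(\<lambda>x. P (\<phi> x)) differentiable (at x)" by (auto simp: differentiable_def)
  then have "pd l (\<lambda>x. \<zeta> x * P (\<phi> x)) x = \<zeta> x * (P' (\<phi> x) * pd l \<phi> x) + pd l \<zeta> x * P (\<phi> x)" for l
    using assms(1) pd_eqI[OF d, of l, folded pd_def] by (simp add: pd_mult)
  then show ?thesis by (simp add: grad_def vec_eq_iff algebra_simps)
qed

context loc_weight
begin

lemma sqrt_W_square: "(sqrt (W x) * t)\<^sup>2 = W x * t\<^sup>2"
  using W_nonneg by (simp add: power_mult_distrib)

lemma integrable_W_mult_mult:
  assumes [measurable]: "f \<in> borel_measurable borel" "h \<in> borel_measurable borel"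
    and "integrable lborel (\<lambda>x. W x * (f x)\<^sup>2)" "integrable lborel (\<lambda>x. W x * (h x)\<^sup>2)"
  shows "integrable lborel (\<lambda>x. W x * (f x * h x))"
proof -
  have "integrable lborel (\<lambda>x. (sqrt (W x) * f x) * (sqrt (W x) * h x))"
    by (rule integrable_mult_squares) (use assms in \<open>auto simp: sqrt_W_square\<close>)
  moreover have "(sqrt (W x) * f x) * (sqrt (W x) * h x) = W x * (f x * h x)" for x
    using real_sqrt_mult_self[of "W x"] W_nonneg[of x] by (simp add: algebra_simps)
  ultimately show ?thesis by simp
qed

text \<open>For \<open>G\<close> merely C^1 the function \<open>\<zeta> * G (\<phi>)\<close> need
  not be smooth, so the equation is used with polynomials \<open>P m\<close> in place of
  \<open>G\<close>. Their slopes are bounded by \<open>\<Lambda> + 1\<close> uniformly in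
  \<open>m\<close>, and the majorant for the limit consists of products of square integrable
  functions.\<close>

lemma weak_equation_compose_test:
  fixes G G' :: "real \<Rightarrow> real"
  assumes [measurable]: "v \<in> borel_measurable borel" "g \<in> borel_measurable borel"
    and gi: "integrable lborel (\<lambda>x. (norm (g x))\<^sup>2)" and Wi: "integrable lborel (\<lambda>x. W x * (v x)\<^sup>2)"
    and weak: "\<And>\<psi>. test_fun_ball x0 R \<psi> \<Longrightarrow>
       (LINT x|lborel. g x \<bullet> grad \<psi> x + W x * v x * \<psi> x) = (LINT x|lborel. \<psi> x)"
    and \<zeta>: "smooth_fun \<zeta>" "\<And>x. \<bar>\<zeta> x\<bar> \<le> Z" "\<And>x. norm (grad \<zeta> x) \<le> Z"
    and der: "\<And>t. (G has_real_derivative G' t) (at t)" and cont: "continuous_on UNIV G'" and G0: "G 0 = 0"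
    and Gb: "\<And>t. \<bar>G' t\<bar> \<le> \<Lambda>"
    and \<phi>: "test_fun_ball x0 R \<phi>"
  shows "(LINT x|lborel. g x \<bullet> (G (\<phi> x) *\<^sub>R grad \<zeta> x + (\<zeta> x * G' (\<phi> x)) *\<^sub>R grad \<phi> x) + W x * v x * (\<zeta> x * G (\<phi> x)))
       = (LINT x|lborel. \<zeta> x * G (\<phi> x))"
proof -
  let ?T = "\<lambda>P P' x. g x \<bullet> (P (\<phi> x) *\<^sub>R grad \<zeta> x + (\<zeta> x * P' (\<phi> x)) *\<^sub>R grad \<phi> x)"
  note s\<phi> = test_fun_ball_zero(3)[OF \<phi>]
  note z\<phi> = test_fun_ball_zero(1)[OF \<phi>]
  have c: "continuous_on UNIV \<phi>" "continuous_on UNIV (grad \<phi>)" "continuous_on UNIV \<zeta>" "continuous_on UNIV (grad \<zeta>)"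
    using s\<phi> \<zeta> by (auto intro: smooth_fun_continuous continuous_grad)
  have Gc: "continuous_on UNIV G"
    using der by (meson DERIV_continuous_on has_field_derivative_at_within)
  have [measurable]: "\<phi> \<in> borel_measurable borel" "grad \<phi> \<in> borel_measurable borel" "\<zeta> \<in> borel_measurable borel"
    "grad \<zeta> \<in> borel_measurable borel" "G \<in> borel_measurable borel" "G' \<in> borel_measurable borel"
    using c Gc cont by (auto intro: borel_measurable_continuous_onI)
  have Z0: "Z \<ge> 0" using \<zeta>(2)[of 0] by linarith
  have \<Lambda>0: "\<Lambda> \<ge> 0" using Gb[of 0] by linarith
  obtain A where A: "A > 0" "\<And>x. norm (\<phi> x) \<le> A" using compact_support_bounded[OF c(1) z\<phi>] by blast
  have "\<exists>P P'. real_polynomial_function P \<and> (\<forall>t. (P has_real_derivative P' t) (at t)) \<and> P 0 = 0 \<and> continuous_on UNIV P' \<and>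
    (\<forall>t. \<bar>t\<bar> \<le> A \<longrightarrow> \<bar>P' t - G' t\<bar> \<le> inverse (real (Suc m)) \<and> \<bar>P t - G t\<bar> \<le> inverse (real (Suc m)) * \<bar>t\<bar>)" for m
    by (rule antiderivative_polynomial_approx[OF der cont G0 A(1), of "inverse (real (Suc m))"]) (simp, blast)
  then obtain P P' where P: "\<And>m. real_polynomial_function (P m)" "\<And>m t. (P m has_real_derivative P' m t) (at t)"
    "\<And>m. P m 0 = 0" "\<And>m t. \<bar>t\<bar> \<le> A \<Longrightarrow> \<bar>P' m t - G' t\<bar> \<le> inverse (real (Suc m))"
    "\<And>m t. \<bar>t\<bar> \<le> A \<Longrightarrow> \<bar>P m t - G t\<bar> \<le> inverse (real (Suc m)) * \<bar>t\<bar>" "\<And>m. continuous_on UNIV (P' m)" by metis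
  have inv1: "inverse (real (Suc m)) \<le> 1" for m by (simp add: field_simps)
  have Gt: "\<bar>G t\<bar> \<le> \<Lambda> * \<bar>t\<bar>" for t
    using field_differentiable_bound[where S = UNIV and f = G and f' = G' and B = \<Lambda> and x = t and y = 0] der Gb G0 by simp
  have P'b: "\<bar>P' m t\<bar> \<le> \<Lambda> + 1" if "\<bar>t\<bar> \<le> A" for m t
    using P(4)[OF that, of m] Gb[of t] inv1[of m] by linarith
  have Pb: "\<bar>P m t\<bar> \<le> (\<Lambda> + 1) * \<bar>t\<bar>" if "\<bar>t\<bar> \<le> A" for m t
  proof -
    have "inverse (real (Suc m)) * \<bar>t\<bar> \<le> 1 * \<bar>t\<bar>" using inv1[of m] by (intro mult_right_mono) auto
    then show ?thesis using P(5)[OF that, of m] Gt[of t] by (simp add: distrib_right)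
  qed
  have P'l: "(\<lambda>m. P' m t) \<longlonglongrightarrow> G' t" if "\<bar>t\<bar> \<le> A" for t
  proof -
    have "(\<lambda>m. P' m t - G' t) \<longlonglongrightarrow> 0"
      by (rule Lim_null_comparison[OF _ LIMSEQ_inverse_real_of_nat]) (use P(4)[OF that] in auto)
    then show ?thesis using Lim_null by blast
  qed
  have Pl: "(\<lambda>m. P m t) \<longlonglongrightarrow> G t" if "\<bar>t\<bar> \<le> A" for t
  proof -
    have "(\<lambda>m. P m t - G t) \<longlonglongrightarrow> 0"
      by (rule Lim_null_comparison[OF _ tendsto_mult_left_zero[OF LIMSEQ_inverse_real_of_nat, of "\<bar>t\<bar>"]])
        (use P(5)[OF that] in auto)
    then show ?thesis using Lim_null by blast
  qed
  have [measurable]: "P m \<in> borel_measurable borel" "P' m \<in> borel_measurable borel" for m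
  proof -
    have "continuous_on UNIV (P m)" using P(2) by (meson DERIV_continuous_on has_field_derivative_at_within)
    then show "P m \<in> borel_measurable borel" by (rule borel_measurable_continuous_onI)
    show "P' m \<in> borel_measurable borel" using P(6) by (rule borel_measurable_continuous_onI)
  qed
  have tf: "test_fun_ball x0 R (\<lambda>x. \<zeta> x * P m (\<phi> x))" for m
  proof -
    have "smooth_fun (\<lambda>x. \<zeta> x * P m (\<phi> x))"
      by (rule smooth_fun_mult[OF \<zeta>(1) smooth_fun_polynomial_compose[OF P(1) s\<phi>]])
    then show ?thesis using \<phi> P(3) by (auto simp: test_fun_ball_def)
  qed
  have gr: "grad (\<lambda>x. \<zeta> x * P m (\<phi> x)) x = P m (\<phi> x) *\<^sub>R grad \<zeta> x + (\<zeta> x * P' m (\<phi> x)) *\<^sub>R grad \<phi> x" for m x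
    by (rule grad_mult_compose[where P = "P m" and P' = "P' m", OF smooth_fun_differentiable[OF \<zeta>(1)] smooth_fun_differentiable[OF s\<phi>] P(2)])
  define C where "C = Z * (\<Lambda> + 1)"
  have C0: "C \<ge> 0" using Z0 \<Lambda>0 by (simp add: C_def)
  have b1: "\<bar>\<zeta> x * P m (\<phi> x)\<bar> \<le> C * \<bar>\<phi> x\<bar>" for m x
    using mult_mono[OF \<zeta>(2)[of x] Pb[of "\<phi> x" m]] A(2)[of x] Z0 by (simp add: C_def abs_mult mult.assoc)
  have b2: "\<bar>?T (P m) (P' m) x\<bar>
      \<le> C * (norm (g x) * \<bar>\<phi> x\<bar>) + C * (norm (g x) * norm (grad \<phi> x))" for m x
  proof -
    have "\<bar>P m (\<phi> x)\<bar> * norm (grad \<zeta> x) \<le> ((\<Lambda> + 1) * \<bar>\<phi> x\<bar>) * Z"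
      using Pb[of "\<phi> x" m] A(2)[of x] \<zeta>(3) \<Lambda>0 by (intro mult_mono) auto
    moreover have "\<bar>\<zeta> x * P' m (\<phi> x)\<bar> * norm (grad \<phi> x) \<le> (Z * (\<Lambda> + 1)) * norm (grad \<phi> x)"
      unfolding abs_mult using P'b[of "\<phi> x" m] A(2)[of x] \<zeta>(2)[of x] Z0 by (intro mult_right_mono mult_mono) auto
    ultimately have "norm (P m (\<phi> x) *\<^sub>R grad \<zeta> x + (\<zeta> x * P' m (\<phi> x)) *\<^sub>R grad \<phi> x) \<le> C * \<bar>\<phi> x\<bar> + C * norm (grad \<phi> x)"
      using norm_triangle_ineq[of "P m (\<phi> x) *\<^sub>R grad \<zeta> x" "(\<zeta> x * P' m (\<phi> x)) *\<^sub>R grad \<phi> x"]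
      by (simp add: C_def mult_ac)
    then have "norm (g x) * norm (P m (\<phi> x) *\<^sub>R grad \<zeta> x + (\<zeta> x * P' m (\<phi> x)) *\<^sub>R grad \<phi> x)
        \<le> norm (g x) * (C * \<bar>\<phi> x\<bar> + C * norm (grad \<phi> x))" by (intro mult_left_mono) auto
    then show ?thesis
      using Cauchy_Schwarz_ineq2[of "g x" "P m (\<phi> x) *\<^sub>R grad \<zeta> x + (\<zeta> x * P' m (\<phi> x)) *\<^sub>R grad \<phi> x"]
      by (simp add: algebra_simps)
  qed
  have i\<phi>: "integrable lborel (\<lambda>x. \<bar>\<phi> x\<bar>)" "integrable lborel (\<lambda>x. \<bar>\<phi> x\<bar>\<^sup>2)"
    by (rule compact_support_integrable[where R = "norm x0 + R"]; auto intro!: continuous_intros c simp: z\<phi>)+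
  have ig\<phi>: "integrable lborel (\<lambda>x. (norm (grad \<phi> x))\<^sup>2)"
    by (rule compact_support_integrable[where R = "norm x0 + R + 1"])
      (auto intro!: continuous_intros c simp: grad_zero_outside[OF z\<phi>])
  have iW\<phi>: "integrable lborel (\<lambda>x. W x * (\<phi> x)\<^sup>2)"
    by (rule integrable_W_mult[where R = "norm x0 + R"]) (auto intro!: continuous_intros c simp: z\<phi>)
  have d1: "integrable lborel (\<lambda>x. norm (g x) * \<bar>\<phi> x\<bar>)" "integrable lborel (\<lambda>x. norm (g x) * norm (grad \<phi> x))"
    using gi i\<phi>(2) ig\<phi> by (auto intro!: integrable_mult_squares)
  have d2: "integrable lborel (\<lambda>x. W x * (\<bar>v x\<bar> * \<bar>\<phi> x\<bar>))"
    using Wi iW\<phi> by (intro integrable_W_mult_mult) auto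
  have "(\<lambda>m. LINT x|lborel. ?T (P m) (P' m) x + W x * v x * (\<zeta> x * P m (\<phi> x)))
      \<longlonglongrightarrow> (LINT x|lborel. ?T G G' x + W x * v x * (\<zeta> x * G (\<phi> x)))"
  proof (rule integral_dominated_convergence[where w = "\<lambda>x. C * (norm (g x) * \<bar>\<phi> x\<bar>) + C * (norm (g x) * norm (grad \<phi> x))
        + C * (W x * (\<bar>v x\<bar> * \<bar>\<phi> x\<bar>))"])
    show "integrable lborel (\<lambda>x. C * (norm (g x) * \<bar>\<phi> x\<bar>) + C * (norm (g x) * norm (grad \<phi> x))
        + C * (W x * (\<bar>v x\<bar> * \<bar>\<phi> x\<bar>)))" using d1 d2 by simp
    show "AE x in lborel. (\<lambda>m. ?T (P m) (P' m) x + W x * v x * (\<zeta> x * P m (\<phi> x)))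
      \<longlonglongrightarrow> ?T G G' x + W x * v x * (\<zeta> x * G (\<phi> x))"
      using A(2) by (intro AE_I2 tendsto_intros Pl P'l) auto
    show "AE x in lborel. norm (?T (P m) (P' m) x + W x * v x * (\<zeta> x * P m (\<phi> x)))
        \<le> C * (norm (g x) * \<bar>\<phi> x\<bar>) + C * (norm (g x) * norm (grad \<phi> x)) + C * (W x * (\<bar>v x\<bar> * \<bar>\<phi> x\<bar>))" for m
    proof (intro AE_I2)
      fix x
      have "\<bar>W x * v x * (\<zeta> x * P m (\<phi> x))\<bar> \<le> (W x * \<bar>v x\<bar>) * (C * \<bar>\<phi> x\<bar>)"
        unfolding abs_mult[of "W x * v x"] using b1[of x m] W_nonneg[of x] by (intro mult_mono) (auto simp: abs_mult)
      then show "norm (?T (P m) (P' m) x + W x * v x * (\<zeta> x * P m (\<phi> x)))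
        \<le> C * (norm (g x) * \<bar>\<phi> x\<bar>) + C * (norm (g x) * norm (grad \<phi> x)) + C * (W x * (\<bar>v x\<bar> * \<bar>\<phi> x\<bar>))"
        using b2[of x m] unfolding real_norm_def by (intro order_trans[OF abs_triangle_ineq] add_mono) (auto simp: mult_ac)
    qed
  qed auto
  moreover have "(\<lambda>m. LINT x|lborel. \<zeta> x * P m (\<phi> x)) \<longlonglongrightarrow> (LINT x|lborel. \<zeta> x * G (\<phi> x))"
  proof (rule integral_dominated_convergence[where w = "\<lambda>x. C * \<bar>\<phi> x\<bar>"])
    show "integrable lborel (\<lambda>x. C * \<bar>\<phi> x\<bar>)" using i\<phi> by simp
    show "AE x in lborel. (\<lambda>m. \<zeta> x * P m (\<phi> x)) \<longlonglongrightarrow> \<zeta> x * G (\<phi> x)"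
      using A(2) by (intro AE_I2 tendsto_intros Pl) auto
    show "AE x in lborel. norm (\<zeta> x * P m (\<phi> x)) \<le> C * \<bar>\<phi> x\<bar>" for m using b1 by simp
  qed auto
  moreover have "(LINT x|lborel. ?T (P m) (P' m) x + W x * v x * (\<zeta> x * P m (\<phi> x)))
     = (LINT x|lborel. \<zeta> x * P m (\<phi> x))" for m
    using weak[OF tf, of m] by (simp only: gr)
  ultimately show ?thesis using LIMSEQ_unique by (simp only:)
qed

end

text \<open>It makes \<open>t |t| - t^2\<close>, which vanishes for \<open>t >= 0\<close>, a C^1
  function: the nonlinearity behind the nonnegativity of Dirichlet solutions.\<close>

lemma DERIV_mult_abs: "((\<lambda>t::real. t * \<bar>t\<bar>) has_real_derivative 2 * \<bar>t\<bar>) (at t)"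
proof -
  consider "t > 0" | "t < 0" | "t = 0" by linarith
  then show ?thesis
  proof cases
    case 1
    have "((\<lambda>t::real. t * t) has_real_derivative 2 * \<bar>t\<bar>) (at t)"
      using 1 by (auto intro!: derivative_eq_intros)
    then show ?thesis
      by (rule has_field_derivative_transform_within_open[of _ _ _ "{0<..}"]) (use 1 in auto)
  next
    case 2
    have "((\<lambda>t::real. t * - t) has_real_derivative 2 * \<bar>t\<bar>) (at t)"
      using 2 by (auto intro!: derivative_eq_intros)
    then show ?thesis
      by (rule has_field_derivative_transform_within_open[of _ _ _ "{..<0}"]) (use 2 in auto)
  next
    case 3
    have "(\<lambda>t::real. (t * \<bar>t\<bar> - 0 * \<bar>0\<bar>) / (t - 0)) = (\<lambda>t. \<bar>t\<bar>)" by auto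
    moreover have "((\<lambda>t::real. \<bar>t\<bar>) \<longlongrightarrow> \<bar>0\<bar>) (at 0)" by (intro tendsto_intros)
    ultimately have "((\<lambda>t::real. (t * \<bar>t\<bar> - 0 * \<bar>0\<bar>) / (t - 0)) \<longlongrightarrow> 2 * \<bar>0\<bar>) (at 0)" by simp
    then show ?thesis using 3 by (simp add: has_field_derivative_iff)
  qed
qed

text \<open>One Dirichlet solution with its weak gradient and approximating test functions is kept
  fixed, so that the equation can be tested with several nonlinear functions of
  \<open>v\<close>.\<close>

locale dirichlet_data = loc_weight W for W :: "real^'n::finite \<Rightarrow> real" +
  fixes x0 :: "real^'n" and R :: real and v :: "real^'n \<Rightarrow> real" and g :: "real^'n \<Rightarrow> real^'n"
    and \<phi> :: "nat \<Rightarrow> real^'n \<Rightarrow> real"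
  assumes v_meas[measurable]: "v \<in> borel_measurable borel" and g_meas[measurable]: "g \<in> borel_measurable borel"
    and test: "\<And>k. test_fun_ball x0 R (\<phi> k)"
    and v2: "integrable lborel (\<lambda>x. (v x)\<^sup>2)" and g2: "integrable lborel (\<lambda>x. (norm (g x))\<^sup>2)"
    and Wv2: "integrable lborel (\<lambda>x. W x * (v x)\<^sup>2)"
    and dv: "\<And>k. integrable lborel (\<lambda>x. (\<phi> k x - v x)\<^sup>2)" "(\<lambda>k. LINT x|lborel. (\<phi> k x - v x)\<^sup>2) \<longlonglongrightarrow> 0"
    and dg: "\<And>k. integrable lborel (\<lambda>x. (norm (grad (\<phi> k) x - g x))\<^sup>2)"
      "(\<lambda>k. LINT x|lborel. (norm (grad (\<phi> k) x - g x))\<^sup>2) \<longlonglongrightarrow> 0"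
    and dW: "\<And>k. integrable lborel (\<lambda>x. W x * (\<phi> k x - v x)\<^sup>2)"
      "(\<lambda>k. LINT x|lborel. W x * (\<phi> k x - v x)\<^sup>2) \<longlonglongrightarrow> 0"
    and ae: "AE x in lborel. (\<lambda>k. \<phi> k x) \<longlonglongrightarrow> v x"
    and weak: "\<And>\<psi>. test_fun_ball x0 R \<psi> \<Longrightarrow>
       (LINT x|lborel. g x \<bullet> grad \<psi> x + W x * v x * \<psi> x) = (LINT x|lborel. \<psi> x)"
begin

lemma v_zero: "AE x in lborel. x \<notin> ball x0 R \<longrightarrow> v x = 0"
  using ae
proof eventually_elim
  case (elim x)
  then show ?case using test_fun_ball_zero(2)[OF test, of x] by (auto simp: LIMSEQ_const_iff)
qed

text \<open>The test functions \<open>\<phi> k\<close> are replaced by their limit \<open>v\<close>.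
  The differences \<open>d1\<close> to \<open>d4\<close> pair an L2-small error with a fixed L2
  function, as \<open>G\<close> is Lipschitz and \<open>G'\<close> bounded. The term
  \<open>e k\<close> carries \<open>G'\<close> at \<open>\<phi> k\<close> without any rate,
  \<open>G'\<close> being only continuous; there almost everywhere convergence and dominated
  convergence are used.\<close>

lemma weak_equation_compose:
  fixes G G' :: "real \<Rightarrow> real"
  assumes \<zeta>: "smooth_fun \<zeta>" "\<And>x. \<bar>\<zeta> x\<bar> \<le> Z" "\<And>x. norm (grad \<zeta> x) \<le> Z"
    and der: "\<And>t. (G has_real_derivative G' t) (at t)" and cont: "continuous_on UNIV G'" and G0: "G 0 = 0"
    and Gb: "\<And>t. \<bar>G' t\<bar> \<le> \<Lambda>"
  shows "integrable lborel (\<lambda>x. G (v x) * (g x \<bullet> grad \<zeta> x))"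
    and "integrable lborel (\<lambda>x. \<zeta> x * G' (v x) * (norm (g x))\<^sup>2)"
    and "integrable lborel (\<lambda>x. W x * (v x * (\<zeta> x * G (v x))))"
    and "integrable lborel (\<lambda>x. \<zeta> x * G (v x))"
    and "(LINT x|lborel. G (v x) * (g x \<bullet> grad \<zeta> x)) + (LINT x|lborel. \<zeta> x * G' (v x) * (norm (g x))\<^sup>2)
      + (LINT x|lborel. W x * (v x * (\<zeta> x * G (v x)))) = (LINT x|lborel. \<zeta> x * G (v x))"
proof -
  let ?A1 = "LINT x|lborel. G (v x) * (g x \<bullet> grad \<zeta> x)"
  let ?A2 = "LINT x|lborel. \<zeta> x * G' (v x) * (norm (g x))\<^sup>2"
  let ?A3 = "LINT x|lborel. W x * (v x * (\<zeta> x * G (v x)))"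
  let ?A4 = "LINT x|lborel. \<zeta> x * G (v x)"
  note s\<phi> = test_fun_ball_zero(3)[OF test]
  have c: "continuous_on UNIV (\<phi> k)" "continuous_on UNIV (grad (\<phi> k))" "continuous_on UNIV \<zeta>" "continuous_on UNIV (grad \<zeta>)" for k
    using s\<phi> \<zeta> by (auto intro: smooth_fun_continuous continuous_grad)
  have Gc: "continuous_on UNIV G"
    using der by (meson DERIV_continuous_on has_field_derivative_at_within)
  have [measurable]: "\<phi> k \<in> borel_measurable borel" "grad (\<phi> k) \<in> borel_measurable borel" "\<zeta> \<in> borel_measurable borel"
    "grad \<zeta> \<in> borel_measurable borel" "G \<in> borel_measurable borel" "G' \<in> borel_measurable borel" for k
    using c Gc cont by (auto intro: borel_measurable_continuous_onI)
  have Z0: "Z \<ge> 0" using \<zeta>(2)[of 0] by linarith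
  have \<Lambda>0: "\<Lambda> \<ge> 0" using Gb[of 0] by linarith
  have [measurable]: "indicat_real (ball x0 R) \<in> borel_measurable borel"
    by (rule borel_measurable_indicator) simp
  define C where "C = Z * \<Lambda>"
  have C0: "C \<ge> 0" using Z0 \<Lambda>0 by (simp add: C_def)
  have Gl: "\<bar>G s - G t\<bar> \<le> \<Lambda> * \<bar>s - t\<bar>" for s t
    using field_differentiable_bound[where S = UNIV and f = G and f' = G' and B = \<Lambda> and x = s and y = t] der Gb by simp
  have \<zeta>G: "\<bar>\<zeta> x * (G s - G t)\<bar> \<le> C * \<bar>s - t\<bar>" for x s t
    using mult_mono[OF \<zeta>(2)[of x] Gl[of s t]] Z0 by (simp add: C_def abs_mult mult.assoc)
  have gG: "\<bar>(G s - G t) * (g x \<bullet> grad \<zeta> x)\<bar> \<le> \<bar>s - t\<bar> * (C * norm (g x))" for x s t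
  proof -
    have "\<bar>g x \<bullet> grad \<zeta> x\<bar> \<le> norm (g x) * Z"
      using Cauchy_Schwarz_ineq2[of "g x" "grad \<zeta> x"] mult_left_mono[OF \<zeta>(3)[of x], of "norm (g x)"] by simp
    from mult_mono[OF Gl[of s t] this] show ?thesis using \<Lambda>0 by (simp add: C_def abs_mult mult_ac)
  qed
  have \<zeta>G': "\<bar>\<zeta> x * G' t\<bar> \<le> C" for x t
    using mult_mono[OF \<zeta>(2)[of x] Gb[of t]] Z0 by (simp add: C_def abs_mult)
  show i4: "integrable lborel (\<lambda>x. \<zeta> x * G (v x))"
  proof (rule Bochner_Integration.integrable_bound)
    \<comment> \<open>\<open>\<zeta>\<close> is bounded but may be constant, so integrability comes
      from \<open>v\<close> being square integrable and zero outside a ball of finite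
      measure.\<close>
    have "integrable lborel (\<lambda>x. indicat_real (ball x0 R) x * \<bar>v x\<bar>)"
    proof (rule integrable_mult_squares)
      have "(indicat_real (ball x0 R) x)\<^sup>2 = indicat_real (ball x0 R) x" for x
        by (simp add: indicator_def)
      then show "integrable lborel (\<lambda>x. (indicat_real (ball x0 R) x)\<^sup>2)"
        using emeasure_lborel_ball_finite[of x0 R] by (simp add: integrable_real_indicator)
    qed (use v2 in auto)
    then show "integrable lborel (\<lambda>x. C * (indicat_real (ball x0 R) x * \<bar>v x\<bar>))" by simp
    show "AE x in lborel. norm (\<zeta> x * G (v x)) \<le> norm (C * (indicat_real (ball x0 R) x * \<bar>v x\<bar>))"
      using v_zero
    proof eventually_elim
      case (elim x)
      then show ?case using \<zeta>G[of x "v x" 0] C0 by (auto simp: G0 indicator_def)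
    qed
  qed simp
  show i1: "integrable lborel (\<lambda>x. G (v x) * (g x \<bullet> grad \<zeta> x))"
  proof (rule Bochner_Integration.integrable_bound)
    show "integrable lborel (\<lambda>x. C * (\<bar>v x\<bar> * norm (g x)))"
      using v2 g2 by (intro integrable_mult_right integrable_mult_squares) auto
    show "AE x in lborel. norm (G (v x) * (g x \<bullet> grad \<zeta> x)) \<le> norm (C * (\<bar>v x\<bar> * norm (g x)))"
    proof (intro AE_I2)
      fix x show "norm (G (v x) * (g x \<bullet> grad \<zeta> x)) \<le> norm (C * (\<bar>v x\<bar> * norm (g x)))"
        using gG[of "v x" 0 x] C0 by (simp add: G0 abs_mult mult_ac)
    qed
  qed simp
  have bnd2: "\<bar>\<zeta> x * G' t * (norm (g x))\<^sup>2\<bar> \<le> C * (norm (g x))\<^sup>2" for x t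
    using mult_right_mono[OF \<zeta>G'[of x t], of "(norm (g x))\<^sup>2"] by (simp add: abs_mult)
  show i2: "integrable lborel (\<lambda>x. \<zeta> x * G' (v x) * (norm (g x))\<^sup>2)"
  proof (rule Bochner_Integration.integrable_bound)
    show "integrable lborel (\<lambda>x. C * (norm (g x))\<^sup>2)" using g2 by simp
    show "AE x in lborel. norm (\<zeta> x * G' (v x) * (norm (g x))\<^sup>2) \<le> norm (C * (norm (g x))\<^sup>2)"
      using bnd2 by (auto intro: order_trans[OF _ abs_ge_self])
  qed simp
  have bnd3: "\<bar>W x * (v x * (\<zeta> x * (G s - G t)))\<bar> \<le> W x * (\<bar>v x\<bar> * (C * \<bar>s - t\<bar>))" for x s t
    using \<zeta>G[of x s t] W_nonneg[of x] unfolding abs_mult[of "W x"] abs_mult[of "v x"]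
    by (intro mult_mono) auto
  show i3: "integrable lborel (\<lambda>x. W x * (v x * (\<zeta> x * G (v x))))"
  proof (rule Bochner_Integration.integrable_bound)
    show "integrable lborel (\<lambda>x. C * (W x * (v x)\<^sup>2))" using Wv2 by simp
    show "AE x in lborel. norm (W x * (v x * (\<zeta> x * G (v x)))) \<le> norm (C * (W x * (v x)\<^sup>2))"
    proof (intro AE_I2)
      fix x show "norm (W x * (v x * (\<zeta> x * G (v x)))) \<le> norm (C * (W x * (v x)\<^sup>2))"
        using bnd3[of x "v x" 0] C0 W_nonneg[of x] by (simp add: G0 abs_mult power2_eq_square mult_ac)
    qed
  qed simp
  define d1 where "d1 k x = (G (\<phi> k x) - G (v x)) * (g x \<bullet> grad \<zeta> x)" for k x
  \<comment> \<open>The gradient term is split into \<open>e k\<close>, where the gradient of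
    \<open>\<phi> k\<close> is already replaced by \<open>g\<close>, and this error.\<close>
  define d2 where "d2 k x = (\<zeta> x * G' (\<phi> k x)) * (g x \<bullet> (grad (\<phi> k) x - g x))" for k x
  define d3 where "d3 k x = W x * (v x * (\<zeta> x * (G (\<phi> k x) - G (v x))))" for k x
  define d4 where "d4 k x = \<zeta> x * (G (\<phi> k x) - G (v x))" for k x
  define e where "e k x = \<zeta> x * G' (\<phi> k x) * (norm (g x))\<^sup>2" for k x
  have [measurable]: "d1 k \<in> borel_measurable borel" "d2 k \<in> borel_measurable borel" "d3 k \<in> borel_measurable borel"
    "d4 k \<in> borel_measurable borel" "e k \<in> borel_measurable borel" for k
    unfolding d1_def[abs_def] d2_def[abs_def] d3_def[abs_def] d4_def[abs_def] e_def[abs_def] by measurable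
  have Cg: "integrable lborel (\<lambda>x. (C * norm (g x))\<^sup>2)" using g2 by (simp add: power_mult_distrib)
  have D1: "integrable lborel (d1 k)" "(\<lambda>k. LINT x|lborel. d1 k x) \<longlonglongrightarrow> 0" for k
    by (rule square_pairing_tendsto_0[where d = "\<lambda>k x. \<phi> k x - v x" and q = "\<lambda>x. C * norm (g x)"];
        use dv Cg gG C0 in \<open>auto simp: d1_def\<close>)+
  have D2: "integrable lborel (d2 k)" "(\<lambda>k. LINT x|lborel. d2 k x) \<longlonglongrightarrow> 0" for k
  proof -
    have "\<bar>d2 k x\<bar> \<le> \<bar>norm (grad (\<phi> k) x - g x)\<bar> * \<bar>C * norm (g x)\<bar>" for k x
      using mult_mono[OF \<zeta>G'[of x "\<phi> k x"] Cauchy_Schwarz_ineq2[of "g x" "grad (\<phi> k) x - g x"]] C0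
      by (simp add: d2_def abs_mult mult_ac)
    then show "integrable lborel (d2 k)" "(\<lambda>k. LINT x|lborel. d2 k x) \<longlonglongrightarrow> 0"
      by (rule_tac square_pairing_tendsto_0[where d = "\<lambda>k x. norm (grad (\<phi> k) x - g x)" and q = "\<lambda>x. C * norm (g x)"];
        use dg Cg in \<open>auto\<close>)+
  qed
  have D3: "integrable lborel (d3 k)" "(\<lambda>k. LINT x|lborel. d3 k x) \<longlonglongrightarrow> 0" for k
  proof -
    have b: "\<bar>d3 k x\<bar> \<le> \<bar>sqrt (W x) * (\<phi> k x - v x)\<bar> * \<bar>C * (sqrt (W x) * v x)\<bar>" for k x
    proof -
      have "W x = sqrt (W x) * sqrt (W x)" using W_nonneg[of x] by simp
      then have "W x * (\<bar>v x\<bar> * (C * \<bar>\<phi> k x - v x\<bar>)) = \<bar>sqrt (W x) * (\<phi> k x - v x)\<bar> * \<bar>C * (sqrt (W x) * v x)\<bar>"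
        using C0 W_nonneg[of x] by (simp add: abs_mult mult_ac)
      then show ?thesis using bnd3[of x "\<phi> k x" "v x"] by (simp add: d3_def)
    qed
    have q: "integrable lborel (\<lambda>x. (C * (sqrt (W x) * v x))\<^sup>2)"
      unfolding power_mult_distrib[of C] sqrt_W_square using Wv2 by simp
    show "integrable lborel (d3 k)" "(\<lambda>k. LINT x|lborel. d3 k x) \<longlonglongrightarrow> 0"
      by (rule square_pairing_tendsto_0[where d = "\<lambda>k x. sqrt (W x) * (\<phi> k x - v x)" and q = "\<lambda>x. C * (sqrt (W x) * v x)"];
        use dW q b in \<open>auto simp: sqrt_W_square\<close>)+
  qed
  have D4: "integrable lborel (d4 k)" "(\<lambda>k. LINT x|lborel. d4 k x) \<longlonglongrightarrow> 0" for k
  proof -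
    have b: "AE x in lborel. \<bar>d4 k x\<bar> \<le> \<bar>\<phi> k x - v x\<bar> * \<bar>C * indicat_real (ball x0 R) x\<bar>" for k
      using v_zero
    proof eventually_elim
      case (elim x)
      then show ?case using \<zeta>G[of x "\<phi> k x" "v x"] C0 test_fun_ball_zero(2)[OF test, of x k]
        by (auto simp: d4_def indicator_def mult_ac)
    qed
    have "(C * indicat_real (ball x0 R) x)\<^sup>2 = C\<^sup>2 * indicat_real (ball x0 R) x" for x
      by (simp add: indicator_def)
    then have q: "integrable lborel (\<lambda>x. (C * indicat_real (ball x0 R) x)\<^sup>2)"
      using emeasure_lborel_ball_finite[of x0 R] by (simp add: integrable_real_indicator)
    show "integrable lborel (d4 k)" "(\<lambda>k. LINT x|lborel. d4 k x) \<longlonglongrightarrow> 0"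
      by (rule square_pairing_tendsto_0[where d = "\<lambda>k x. \<phi> k x - v x" and q = "\<lambda>x. C * indicat_real (ball x0 R) x"];
        use dv q b in \<open>auto\<close>)+
  qed
  have E1: "integrable lborel (e k)" for k
  proof (rule Bochner_Integration.integrable_bound)
    show "integrable lborel (\<lambda>x. C * (norm (g x))\<^sup>2)" using g2 by simp
    show "AE x in lborel. norm (e k x) \<le> norm (C * (norm (g x))\<^sup>2)"
      using bnd2 by (auto simp: e_def intro: order_trans[OF _ abs_ge_self])
  qed simp
  have E2: "(\<lambda>k. LINT x|lborel. e k x) \<longlonglongrightarrow> ?A2"
  proof (rule integral_dominated_convergence[where w = "\<lambda>x. C * (norm (g x))\<^sup>2"])
    show "integrable lborel (\<lambda>x. C * (norm (g x))\<^sup>2)" using g2 by simp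
    show "AE x in lborel. norm (e k x) \<le> C * (norm (g x))\<^sup>2" for k using bnd2 by (simp add: e_def)
    show "AE x in lborel. (\<lambda>k. e k x) \<longlonglongrightarrow> \<zeta> x * G' (v x) * (norm (g x))\<^sup>2"
      using ae
    proof eventually_elim
      case (elim x)
      have "isCont G' (v x)" using cont by (simp add: continuous_on_eq_continuous_at)
      then have "(\<lambda>k. G' (\<phi> k x)) \<longlonglongrightarrow> G' (v x)" using elim by (rule isCont_tendsto_compose)
      then show ?case unfolding e_def by (intro tendsto_intros)
    qed
  qed simp_all
  have eq: "(?A1 + (LINT x|lborel. d1 k x)) + ((LINT x|lborel. e k x) + (LINT x|lborel. d2 k x))
     + (?A3 + (LINT x|lborel. d3 k x))
     = ?A4 + (LINT x|lborel. d4 k x)" for k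
  proof -
    have "(LINT x|lborel. g x \<bullet> (G (\<phi> k x) *\<^sub>R grad \<zeta> x + (\<zeta> x * G' (\<phi> k x)) *\<^sub>R grad (\<phi> k) x) + W x * v x * (\<zeta> x * G (\<phi> k x)))
       = (LINT x|lborel. \<zeta> x * G (\<phi> k x))"
      by (rule weak_equation_compose_test[OF v_meas g_meas g2 Wv2 weak \<zeta> der cont G0 Gb test])
    moreover have "g x \<bullet> (G (\<phi> k x) *\<^sub>R grad \<zeta> x + (\<zeta> x * G' (\<phi> k x)) *\<^sub>R grad (\<phi> k) x) + W x * v x * (\<zeta> x * G (\<phi> k x))
        = (G (v x) * (g x \<bullet> grad \<zeta> x) + d1 k x) + (e k x + d2 k x) + (W x * (v x * (\<zeta> x * G (v x))) + d3 k x)" for x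
      by (simp add: d1_def d2_def d3_def e_def power2_norm_eq_inner inner_add_right inner_diff_right algebra_simps)
    moreover have "\<zeta> x * G (\<phi> k x) = \<zeta> x * G (v x) + d4 k x" for x by (simp add: d4_def algebra_simps)
    ultimately have "(LINT x|lborel. (G (v x) * (g x \<bullet> grad \<zeta> x) + d1 k x) + (e k x + d2 k x) + (W x * (v x * (\<zeta> x * G (v x))) + d3 k x))
       = (LINT x|lborel. \<zeta> x * G (v x) + d4 k x)" by (simp only:)
    then show ?thesis using i1 i3 i4 D1(1) D2(1) D3(1) D4(1) E1 by simp
  qed
  have "(\<lambda>k. (?A1 + (LINT x|lborel. d1 k x)) + ((LINT x|lborel. e k x) + (LINT x|lborel. d2 k x))
     + (?A3 + (LINT x|lborel. d3 k x)))
     \<longlonglongrightarrow> (?A1 + 0) + (?A2 + 0)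
      + (?A3 + 0)"
    by (intro tendsto_add tendsto_const D1 D2 D3 E2)
  moreover have "(\<lambda>k. ?A4 + (LINT x|lborel. d4 k x)) \<longlonglongrightarrow> ?A4 + 0"
    by (intro tendsto_add tendsto_const D4)
  ultimately show "?A1 + ?A2
      + ?A3 = ?A4"
    unfolding eq using LIMSEQ_unique by force
qed

text \<open>The equation is tested with \<open>G v\<close>, where \<open>G\<close> is zero on the
  nonnegative half-line and \<open>- 2 t^2 / (1 + t^2)\<close> for \<open>t < 0\<close>; the
  denominator keeps \<open>G'\<close> bounded. As \<open>G\<close> is nondecreasing and
  \<open>t * G t >= 0\<close>, the left side is nonnegative, while the right side, the integral of
  \<open>G v\<close>, is nonpositive. Hence \<open>G v\<close> vanishes almost everywhere.\<close>

lemma sol_nonneg: "AE x in lborel. v x \<ge> 0"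
proof -
  define G :: "real \<Rightarrow> real" where "G t = (t * \<bar>t\<bar> - t\<^sup>2) / (1 + t\<^sup>2)" for t
  define G' :: "real \<Rightarrow> real" where "G' t = 2 * (\<bar>t\<bar> - t) / (1 + t\<^sup>2)\<^sup>2" for t
  have pos: "1 + t\<^sup>2 > 0" for t :: real by (simp add: add_pos_nonneg)
  have der: "(G has_real_derivative G' t) (at t)" for t
  proof -
    have n: "((\<lambda>t. t * \<bar>t\<bar> - t\<^sup>2) has_real_derivative 2 * \<bar>t\<bar> - 2 * t) (at t)"
      by (rule DERIV_diff[OF DERIV_mult_abs]) (auto intro!: derivative_eq_intros)
    have d: "((\<lambda>t. 1 + t\<^sup>2) has_real_derivative 2 * t) (at t)"
      by (auto intro!: derivative_eq_intros)
    have "(G has_real_derivative ((2 * \<bar>t\<bar> - 2 * t) * (1 + t\<^sup>2) - (t * \<bar>t\<bar> - t\<^sup>2) * (2 * t)) / (1 + t\<^sup>2)\<^sup>2) (at t)"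
      unfolding G_def[abs_def] using DERIV_divide[OF n d] pos[of t] by (simp add: power2_eq_square[of "1 + t\<^sup>2"])
    moreover have "(2 * \<bar>t\<bar> - 2 * t) * (1 + t\<^sup>2) - (t * \<bar>t\<bar> - t\<^sup>2) * (2 * t) = 2 * (\<bar>t\<bar> - t)"
      by (cases "t \<ge> 0") (auto simp: power2_eq_square algebra_simps)
    ultimately show ?thesis by (simp add: G'_def)
  qed
  have cont: "continuous_on UNIV G'" unfolding G'_def using pos
    by (intro continuous_intros) (auto simp: add_nonneg_eq_0_iff)
  have G'0: "G' t \<ge> 0" for t by (simp add: G'_def)
  have Gb: "\<bar>G' t\<bar> \<le> 4" for t
  proof -
    have "\<bar>t\<bar> \<le> 1 + t\<^sup>2" using sum_squares_bound[of 1 "\<bar>t\<bar>"] by simp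
    also have "\<dots> \<le> (1 + t\<^sup>2)\<^sup>2" using self_le_power[of "1 + t\<^sup>2" 2] by simp
    finally have "4 * \<bar>t\<bar> \<le> 4 * (1 + t\<^sup>2)\<^sup>2" by (simp only: mult_le_cancel_left_pos zero_less_numeral)
    moreover have "2 * (\<bar>t\<bar> - t) \<le> 4 * \<bar>t\<bar>" by simp
    ultimately have "2 * (\<bar>t\<bar> - t) \<le> 4 * (1 + t\<^sup>2)\<^sup>2" by (rule order_trans[rotated])
    then show ?thesis using pos[of t] G'0[of t] by (simp add: G'_def divide_le_eq)
  qed
  have Gneg: "G t \<le> 0" "t * G t \<ge> 0" for t
  proof -
    have "t * \<bar>t\<bar> \<le> t\<^sup>2" using abs_ge_self[of "t * \<bar>t\<bar>"] by (simp add: abs_mult power2_eq_square)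
    then show *: "G t \<le> 0" unfolding G_def by (intro divide_nonpos_pos pos) simp
    show "t * G t \<ge> 0"
    proof (cases "t \<ge> 0")
      case True then show ?thesis by (simp add: G_def power2_eq_square)
    next
      case False then show ?thesis using * by (intro mult_nonpos_nonpos) auto
    qed
  qed
  have g0: "grad (\<lambda>x::real^'n. 1::real) x = 0" for x by (simp add: grad_def pd_const vec_eq_iff)
  note W1 = weak_equation_compose[where \<zeta> = "\<lambda>x. 1" and Z = 1, OF smooth_fun_const _ _ der cont _ Gb, unfolded g0, simplified]
  have G00: "G 0 = 0" by (simp add: G_def)
  have "(LINT x|lborel. G' (v x) * (norm (g x))\<^sup>2) \<ge> 0" using G'0 by (intro Bochner_Integration.integral_nonneg) auto
  moreover have "(LINT x|lborel. W x * (v x * G (v x))) \<ge> 0" using W_nonneg Gneg by (intro Bochner_Integration.integral_nonneg) auto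
  ultimately have "(LINT x|lborel. G (v x)) \<ge> 0" using W1(5)[OF G00] by simp
  moreover have "(LINT x|lborel. - G (v x)) \<ge> 0" using Gneg by (intro Bochner_Integration.integral_nonneg) auto
  ultimately have "(LINT x|lborel. - G (v x)) = 0" by simp
  then have "AE x in lborel. - G (v x) = 0"
    using integral_nonneg_eq_0_iff_AE[of lborel "\<lambda>x. - G (v x)"] W1(4)[OF G00] Gneg by auto
  then show ?thesis
  proof eventually_elim
    case (elim x)
    show ?case
    proof (rule ccontr)
      assume "\<not> 0 \<le> v x"
      then have "v x * \<bar>v x\<bar> - (v x)\<^sup>2 < 0" by (simp add: power2_eq_square mult_pos_pos mult_neg_neg)
      then show False using elim pos[of "v x"] by (simp add: G_def)
    qed
  qed
qed

text \<open>Testing the equation with \<open>|f|\<^sup>2/(v + \<epsilon>)\<close> and completing squares gives the bound with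
  constant one; the magnetic gradient enters through \<open>\<nabla>|f|\<^sup>2 = 2 Re (cnj f D f)\<close>.\<close>

lemma landscape_bound_eps:
  assumes "magnetic_test a b f1 f2 R'" and supp: "test_fun_ball x0 R (modsq f1 f2)" and \<epsilon>: "\<epsilon> > 0"
  shows "(\<integral>\<^sup>+x. ennreal (modsq f1 f2 x / (v x + \<epsilon>)) \<partial>lborel)
    \<le> ennreal ((LINT x|lborel. Dsq a f1 f2 x) + (LINT x|lborel. W x * modsq f1 f2 x))"
proof -
  interpret magnetic_test a b f1 f2 R' by (rule assms(1))
  \<comment> \<open>For \<open>t >= 0\<close> this is
    \<open>1 / (t + \<epsilon>) - 1 / \<epsilon>\<close>. The constant is subtracted to achieve
    \<open>G 0 = 0\<close>, and the absolute value extends the function to a C^1 function on the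
    whole line.\<close>
  define G where "G t = - t / (\<epsilon> * (\<bar>t\<bar> + \<epsilon>))" for t
  define G' where "G' t = - 1 / (\<bar>t\<bar> + \<epsilon>)\<^sup>2" for t :: real
  have pos: "\<bar>t\<bar> + \<epsilon> > 0" for t using \<epsilon> by simp
  have der: "(G has_real_derivative G' t) (at t)" for t
  proof -
    consider "t > 0" | "t < 0" | "t = 0" by linarith
    then show ?thesis
    proof cases
      case 1
      have "((\<lambda>t. 1 / (t + \<epsilon>) - 1 / \<epsilon>) has_real_derivative G' t) (at t)"
        using 1 \<epsilon> by (auto intro!: derivative_eq_intros simp: G'_def power2_eq_square)
      then show ?thesis
        by (rule has_field_derivative_transform_within_open[of _ _ _ "{0<..}"]) (use 1 \<epsilon> in \<open>auto simp: G_def field_simps\<close>)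
    next
      case 2
      have "((\<lambda>t. 1 / \<epsilon> - 1 / (- t + \<epsilon>)) has_real_derivative G' t) (at t)"
        using 2 \<epsilon> by (auto intro!: derivative_eq_intros simp: G'_def power2_eq_square)
      then show ?thesis
        by (rule has_field_derivative_transform_within_open[of _ _ _ "{..<0}"]) (use 2 \<epsilon> in \<open>auto simp: G_def field_simps\<close>)
    next
      case 3
      have "((\<lambda>t. - 1 / (\<epsilon> * (\<bar>t\<bar> + \<epsilon>))) \<longlongrightarrow> - 1 / (\<epsilon> * (\<bar>0\<bar> + \<epsilon>))) (at 0)"
        using \<epsilon> by (intro tendsto_intros) auto
      then have "((\<lambda>t. - 1 / (\<epsilon> * (\<bar>t\<bar> + \<epsilon>))) \<longlongrightarrow> G' 0) (at 0)" by (simp add: G'_def power2_eq_square)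
      then have "((\<lambda>t. (G t - G 0) / (t - 0)) \<longlongrightarrow> G' 0) (at 0)"
        by (rule Lim_transform_eventually) (simp add: G_def eventually_at_filter)
      then show ?thesis using 3 by (simp add: has_field_derivative_iff)
    qed
  qed
  have cont: "continuous_on UNIV G'" unfolding G'_def using \<epsilon>
    by (intro continuous_intros) (auto simp: add_nonneg_eq_0_iff)
  have G0: "G 0 = 0" by (simp add: G_def)
  have Gb: "\<bar>G' t\<bar> \<le> 1 / \<epsilon>\<^sup>2" for t
    using pos[of t] \<epsilon> by (auto simp: G'_def abs_divide intro!: divide_left_mono power_mono mult_pos_pos)
  have cF: "continuous_on UNIV F" "continuous_on UNIV (grad F)"
    using smooth_fun_continuous[OF smooth_F] continuous_grad[OF smooth_F] by auto
  have zF: "norm x \<ge> R' \<Longrightarrow> F x = 0" and zgF: "norm x \<ge> R' + 1 \<Longrightarrow> grad F x = 0" for x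
    using F_zero grad_zero_outside[of R' F x] by auto
  obtain Z1 where Z1: "\<And>x. norm (F x) \<le> Z1" using compact_support_bounded[OF cF(1) zF] by blast
  obtain Z2 where Z2: "\<And>x. norm (grad F x) \<le> Z2" using compact_support_bounded[OF cF(2) zgF] by blast
  define Z where "Z = max Z1 Z2"
  have Z: "\<bar>F x\<bar> \<le> Z" "norm (grad F x) \<le> Z" for x using Z1[of x] Z2[of x] by (auto simp: Z_def)
  have sF: "smooth_fun F" using smooth_F by simp
  note wc = weak_equation_compose[OF sF Z der cont G0 Gb]
  \<comment> \<open>The equation tested with \<open>F\<close> itself; times
    \<open>1 / \<epsilon>\<close> it restores the constant subtracted in \<open>G\<close>.\<close>
  have wk: "(LINT x|lborel. g x \<bullet> grad F x + W x * v x * F x) = (LINT x|lborel. F x)"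
    using weak supp by simp
  have [measurable]: "F \<in> borel_measurable borel" "grad F \<in> borel_measurable borel"
    using cF by (auto intro: borel_measurable_continuous_onI)
  have j1: "integrable lborel (\<lambda>x. g x \<bullet> grad F x)"
  proof (rule Bochner_Integration.integrable_bound)
    show "integrable lborel (\<lambda>x. norm (g x) * norm (grad F x))"
    proof (rule integrable_mult_squares)
      show "integrable lborel (\<lambda>x. (norm (grad F x))\<^sup>2)"
        by (rule compact_support_integrable[where R = "R' + 1"]) (auto intro!: continuous_intros cF simp: zgF)
    qed (use g2 in auto)
  qed (auto simp: Cauchy_Schwarz_ineq2)
  have j2: "integrable lborel (\<lambda>x. W x * (v x * F x))"
    by (intro integrable_W_mult_mult Wv2 integrable_W_mult[where R = R']) (auto intro!: continuous_intros cF simp: zF)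
  have iF: "integrable lborel F" using integrable_F by simp
  have iWF: "integrable lborel (\<lambda>x. W x * F x)"
    by (rule integrable_W_mult[where R = R']) (auto intro!: cF simp: zF)
  define \<theta> where "\<theta> x = G (v x) + 1 / \<epsilon>" for x
  have iL: "integrable lborel (\<lambda>x. F x * \<theta> x)"
    using wc(4) iF by (simp add: \<theta>_def distrib_left)
  define H where "H x = \<theta> x * (g x \<bullet> grad F x) + F x * G' (v x) * (norm (g x))\<^sup>2 + W x * (v x * (F x * \<theta> x))" for x
  have Hs: "H x = (G (v x) * (g x \<bullet> grad F x) + F x * G' (v x) * (norm (g x))\<^sup>2 + W x * (v x * (F x * G (v x))))
      + 1 / \<epsilon> * (g x \<bullet> grad F x + W x * (v x * F x))" for x
    by (simp add: H_def \<theta>_def algebra_simps)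
  have iH: "integrable lborel H" unfolding Hs[abs_def] using wc(1-3) j1 j2 by simp
  have "(LINT x|lborel. H x) = (LINT x|lborel. F x * G (v x)) + 1 / \<epsilon> * (LINT x|lborel. F x)"
    unfolding Hs using wc(1-3,5) j1 j2 wk by (simp add: mult.assoc)
  then have LH: "(LINT x|lborel. F x * \<theta> x) = (LINT x|lborel. H x)"
    using wc(4) iF by (simp add: \<theta>_def distrib_left)
  have \<theta>v: "\<theta> x = 1 / (v x + \<epsilon>)" "G' (v x) = - (\<theta> x)\<^sup>2" if "v x \<ge> 0" for x
  proof -
    have "v x + \<epsilon> \<noteq> 0" using that \<epsilon> by simp
    then show 1: "\<theta> x = 1 / (v x + \<epsilon>)" using that \<epsilon> by (simp add: \<theta>_def G_def divide_simps)
    show "G' (v x) = - (\<theta> x)\<^sup>2" using that \<epsilon> by (simp add: 1 G'_def power_divide)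
  qed
  have "AE x in lborel. H x \<le> Dsq a f1 f2 x + W x * F x"
    using sol_nonneg
  proof eventually_elim
    case (elim x)
    let ?t = "\<theta> x"
    have F0: "F x \<ge> 0" using F_nonneg by simp
    have t0: "?t \<ge> 0" "v x * ?t \<le> 1" using elim \<epsilon> by (auto simp: \<theta>v)
    have pdF: "grad F x $ l = 2 * (f1 x * DRe a f1 f2 l x + f2 x * DIm a f1 f2 l x)" for l
    proof -
      have "pd l (\<lambda>x. (f1 x)\<^sup>2 + (f2 x)\<^sup>2) x = 2 * (f1 x * pd l f1 x + f2 x * pd l f2 x)"
        unfolding power2_eq_square using smooth_fun_differentiable[OF s1] smooth_fun_differentiable[OF s2]
        by (simp add: pd_add pd_mult algebra_simps)
      then show ?thesis
        by (simp add: modsq_def[abs_def] grad_def DRe_def DIm_def algebra_simps)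
    qed
    have "?t * (g x \<bullet> grad F x) - F x * ?t\<^sup>2 * (norm (g x))\<^sup>2
        = (\<Sum>l\<in>UNIV. ?t * (g x $ l * grad F x $ l) - F x * ?t\<^sup>2 * (g x $ l)\<^sup>2)"
      unfolding power2_norm_eq_inner
      by (simp add: sum_subtractf sum_distrib_left inner_vec_def power2_eq_square[of "g x $ _"])
    also have "\<dots> \<le> Dsq a f1 f2 x"
      unfolding Dsq_def
    proof (rule sum_mono)
      fix l
      let ?X = "DRe a f1 f2 l x" and ?Y = "DIm a f1 f2 l x"
      \<comment> \<open>The two squares are those of the real and imaginary parts of
        \<open>D_l f - \<theta> g_l f\<close>.\<close>
      have "0 \<le> (?X - ?t * g x $ l * f1 x)\<^sup>2 + (?Y - ?t * g x $ l * f2 x)\<^sup>2" by simp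
      also have "\<dots> = ?X\<^sup>2 + ?Y\<^sup>2 - (?t * (g x $ l * grad F x $ l) - F x * ?t\<^sup>2 * (g x $ l)\<^sup>2)"
        unfolding pdF by (simp add: modsq_def power2_eq_square algebra_simps)
      finally show "?t * (g x $ l * grad F x $ l) - F x * ?t\<^sup>2 * (g x $ l)\<^sup>2 \<le> ?X\<^sup>2 + ?Y\<^sup>2" by simp
    qed
    finally have "?t * (g x \<bullet> grad F x) + F x * G' (v x) * (norm (g x))\<^sup>2 \<le> Dsq a f1 f2 x"
      using \<theta>v(2)[OF elim] by simp
    \<comment> \<open>Since \<open>v * \<theta> = v / (v + \<epsilon>) <= 1\<close>, the potential
      term is bounded uniformly in \<open>\<epsilon>\<close>.\<close>
    moreover have "W x * (v x * (F x * ?t)) \<le> W x * F x"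
    proof -
      have "(v x * ?t) * F x \<le> 1 * F x" using t0 F0 by (intro mult_right_mono)
      then show ?thesis using W_nonneg[of x] by (intro mult_left_mono) (auto simp: mult_ac)
    qed
    ultimately show ?case by (simp add: H_def)
  qed
  then have "(LINT x|lborel. H x) \<le> (LINT x|lborel. Dsq a f1 f2 x + W x * F x)"
    by (intro integral_mono_AE iH) (use integrable_Dsq iWF in auto)
  then have fin: "(LINT x|lborel. F x * \<theta> x) \<le> (LINT x|lborel. Dsq a f1 f2 x) + (LINT x|lborel. W x * F x)"
    using LH integrable_Dsq iWF by simp
  have "(\<integral>\<^sup>+x. ennreal (F x / (v x + \<epsilon>)) \<partial>lborel) = (\<integral>\<^sup>+x. ennreal (F x * \<theta> x) \<partial>lborel)"
    by (rule nn_integral_cong_AE) (use sol_nonneg in \<open>eventually_elim, simp add: \<theta>v\<close>)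
  also have "\<dots> = ennreal (LINT x|lborel. F x * \<theta> x)"
  proof (rule nn_integral_eq_integral[OF iL])
    show "AE x in lborel. 0 \<le> F x * \<theta> x"
      using sol_nonneg by eventually_elim (use F_nonneg \<epsilon> in \<open>auto simp: \<theta>v\<close>)
  qed
  also have "\<dots> \<le> ennreal ((LINT x|lborel. Dsq a f1 f2 x) + (LINT x|lborel. W x * F x))"
    using fin by (rule ennreal_leI)
  finally show ?thesis .
qed

end

section \<open>Passage from Dirichlet solutions to the landscape function\<close>

context loc_weight
begin

lemma dirichlet_sol_data:
  assumes "dirichlet_sol W x0 R v"
  shows "\<exists>g \<phi>. dirichlet_data W x0 R v g \<phi>"
  by (rule dirichlet_sol_sequence[OF assms])
    (intro exI dirichlet_data.intro dirichlet_data_axioms.intro loc_weight_axioms; assumption)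

text \<open>Fatou's lemma along the balls of radius \<open>k + 1\<close>, with
  \<open>\<epsilon> k\<close> tending to zero at the same time; the right side depends on
  neither.\<close>

lemma landscape_bound:
  assumes mt: "magnetic_test a b f1 f2 R'" and u: "is_landscape W u"
  shows "(\<integral>\<^sup>+x. ennreal (modsq f1 f2 x / u x) \<partial>lborel)
    \<le> ennreal ((LINT x|lborel. Dsq a f1 f2 x) + (LINT x|lborel. W x * modsq f1 f2 x))"
proof -
  interpret magnetic_test a b f1 f2 R' by (rule mt)
  obtain x0 us where us: "\<And>k::nat. dirichlet_sol W x0 (real (Suc k)) (us k)"
    "AE x in lborel. (\<lambda>k. us k x) \<longlonglongrightarrow> u x" using u by (auto simp: is_landscape_def)
  \<comment> \<open>From \<open>k0\<close> on, the ball of radius \<open>k + 1\<close> about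
    \<open>x0\<close> contains the support of \<open>F\<close>, which is located relative to the
    origin.\<close>
  obtain k0 :: nat where k0: "\<bar>R'\<bar> + norm x0 < real k0" using reals_Archimedean2 by blast
  let ?C = "ennreal ((LINT x|lborel. Dsq a f1 f2 x) + (LINT x|lborel. W x * F x))"
  define \<epsilon> where "\<epsilon> k = inverse (real (Suc k))" for k
  have \<epsilon>: "\<epsilon> k > 0" for k by (simp add: \<epsilon>_def)
  have bd: "(\<integral>\<^sup>+x. ennreal (F x / (us k x + \<epsilon> k)) \<partial>lborel) \<le> ?C" if "k \<ge> k0" for k
  proof -
    obtain g \<phi> where "dirichlet_data W x0 (real (Suc k)) (us k) g \<phi>"
      using dirichlet_sol_data[OF us(1)[of k]] by blast
    then interpret dirichlet_data W x0 "real (Suc k)" "us k" g \<phi> .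
    have "test_fun_ball x0 (real (Suc k)) F"
      unfolding test_fun_ball_def
    proof (intro conjI exI[of _ "\<bar>R'\<bar> + norm x0"] allI impI)
      show "\<bar>R'\<bar> + norm x0 < real (Suc k)" using k0 that by simp
      fix x assume "\<bar>R'\<bar> + norm x0 \<le> dist x0 x"
      then have "R' \<le> norm x" using norm_triangle_ineq4[of x0 x] by (simp add: dist_norm)
      then show "F x = 0" using F_zero by simp
    qed (use smooth_F in simp)
    then show ?thesis using landscape_bound_eps[OF mt _ \<epsilon>] by simp
  qed
  have [measurable]: "us k \<in> borel_measurable borel" for k using us(1)[of k] by (simp add: dirichlet_sol_def)
  have [measurable]: "F \<in> borel_measurable borel"
    using smooth_fun_continuous[OF smooth_F] by (simp add: borel_measurable_continuous_onI)
  have e0: "\<epsilon> \<longlonglongrightarrow> 0" unfolding \<epsilon>_def by (rule LIMSEQ_inverse_real_of_nat)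
  have "(\<integral>\<^sup>+x. ennreal (F x / u x) \<partial>lborel) \<le> (\<integral>\<^sup>+x. liminf (\<lambda>k. ennreal (F x / (us k x + \<epsilon> k))) \<partial>lborel)"
  proof (rule nn_integral_mono_AE)
    show "AE x in lborel. ennreal (F x / u x) \<le> liminf (\<lambda>k. ennreal (F x / (us k x + \<epsilon> k)))"
      using us(2)
    proof eventually_elim
      case (elim x)
      show ?case
      proof (cases "u x > 0")
        case True
        have "(\<lambda>k. F x / (us k x + \<epsilon> k)) \<longlonglongrightarrow> F x / (u x + 0)"
          using True by (intro tendsto_intros elim e0) auto
        then have "(\<lambda>k. ennreal (F x / (us k x + \<epsilon> k))) \<longlonglongrightarrow> ennreal (F x / u x)"
          by (intro tendsto_ennrealI) simp
        then show ?thesis by (simp add: lim_imp_Liminf)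
      next
        \<comment> \<open>For \<open>u x <= 0\<close> the real quotient is nonpositive, division by
          zero giving 0, so its image in \<open>ennreal\<close> is 0.\<close>
        case False
        then have "F x / u x \<le> 0" using F_nonneg[of x] by (simp add: divide_nonneg_nonpos)
        then show ?thesis by (simp add: ennreal_neg)
      qed
    qed
  qed
  also have "\<dots> \<le> liminf (\<lambda>k. \<integral>\<^sup>+x. ennreal (F x / (us k x + \<epsilon> k)) \<partial>lborel)"
    by (rule nn_integral_liminf) simp
  also have "\<dots> \<le> liminf (\<lambda>k. ?C)"
    by (rule Liminf_mono) (use bd in \<open>auto simp: eventually_sequentially\<close>)
  also have "\<dots> = ?C" by (rule Liminf_const[OF trivial_limit_sequentially])
  finally show ?thesis .
qed

end

subsection \<open>The auxiliary function \<open>m\<close>\<close>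

lemma powr_mult_power:
  assumes "(r::real) > 0" shows "r powr (2 - real n) * r ^ n = r\<^sup>2"
proof -
  have "r powr (2 - real n) * r ^ n = r powr (2 - real n) * r powr real n"
    using assms by (simp add: powr_realpow)
  also have "\<dots> = r powr 2" by (simp flip: powr_add)
  finally show ?thesis using assms by simp
qed

text \<open>If \<open>w <= A\<close> on the ball, the radius \<open>\<rho>\<close> is admissible in
  the definition of \<open>mfun\<close>. It bounds the supremum from below because the admissible
  set is bounded above: \<open>w >= 1\<close> forces \<open>r^2 <= C1 / \<omega>\<close>
  there.\<close>

lemma mfun_le:
  fixes w :: "real^'n::finite \<Rightarrow> real"
  assumes wi: "\<And>x r. set_integrable lborel (ball x r) w" and w1: "\<And>x. w x \<ge> 1" and C1: "C1 > 0"
    and \<rho>: "\<rho> > 0" and wA: "\<And>y. y \<in> ball x \<rho> \<Longrightarrow> w y \<le> A"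
    and A: "unit_ball_vol (real CARD('n)) * A * \<rho>\<^sup>2 \<le> C1"
  shows "0 < mfun C1 w x" "mfun C1 w x * \<rho> \<le> 1"
proof -
  define \<omega> where "\<omega> = unit_ball_vol (real CARD('n))"
  have \<omega>: "\<omega> > 0" by (simp add: \<omega>_def)
  define S where "S = {r. r > 0 \<and> r powr (2 - real CARD('n)) * (LINT y:ball x r|lborel. w y) \<le> C1}"
  have vol: "measure lborel (ball x r) = \<omega> * r ^ CARD('n)" if "r > 0" for r
    using that content_ball[of r x] by (simp add: \<omega>_def)
  have int1: "(LINT y:ball x r|lborel. c) = c * measure lborel (ball x r)" for r and c :: real
    by (simp add: set_lebesgue_integral_def)
  have ci: "set_integrable lborel (ball x r) (\<lambda>y. c::real)" for r c
    unfolding set_integrable_def using emeasure_lborel_ball_finite[of x r]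
    by (simp add: integrable_real_indicator)
  have "bdd_above S"
  proof (rule bdd_aboveI2[where M = "sqrt (C1 / \<omega>)" and f = "\<lambda>r. r", simplified])
    fix r assume r: "r \<in> S"
    then have r0: "r > 0" by (simp add: S_def)
    have "(LINT y:ball x r|lborel. 1) \<le> (LINT y:ball x r|lborel. w y)"
      by (rule set_integral_mono[OF ci wi]) (rule w1)
    then have "\<omega> * r ^ CARD('n) \<le> (LINT y:ball x r|lborel. w y)" using int1[of r 1] vol[OF r0] by simp
    then have "r powr (2 - real CARD('n)) * (\<omega> * r ^ CARD('n)) \<le> C1"
      using r by (intro order_trans[OF mult_left_mono[of "\<omega> * r ^ CARD('n)" _ "r powr (2 - real CARD('n))"]]) (auto simp: S_def)
    then have "\<omega> * r\<^sup>2 \<le> C1" using powr_mult_power[OF r0, of "CARD('n)"] by (simp add: mult_ac)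
    then show "r \<le> sqrt (C1 / \<omega>)" using \<omega> by (intro real_le_rsqrt) (simp add: field_simps)
  qed
  moreover have "\<rho> \<in> S"
  proof -
    have "(LINT y:ball x \<rho>|lborel. w y) \<le> (LINT y:ball x \<rho>|lborel. A)"
      by (rule set_integral_mono[OF wi ci]) (rule wA)
    then have "\<rho> powr (2 - real CARD('n)) * (LINT y:ball x \<rho>|lborel. w y)
        \<le> \<rho> powr (2 - real CARD('n)) * (A * (\<omega> * \<rho> ^ CARD('n)))"
      using int1[of \<rho> A] vol[OF \<rho>] by (intro mult_left_mono) auto
    also have "\<dots> = \<omega> * A * \<rho>\<^sup>2" using powr_mult_power[OF \<rho>, of "CARD('n)"] by (simp add: mult_ac)
    also have "\<dots> \<le> C1" using A by (simp add: \<omega>_def)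
    finally show ?thesis using \<rho> by (simp add: S_def)
  qed
  ultimately have "\<rho> \<le> Sup S" by (intro cSup_upper)
  moreover have "mfun C1 w x = 1 / Sup S" by (simp add: mfun_def S_def)
  ultimately show "0 < mfun C1 w x" "mfun C1 w x * \<rho> \<le> 1" using \<rho> by (auto simp: divide_le_eq)
qed

text \<open>Point picking: if the bound failed at \<open>x\<close>, an almost maximal bad point \<open>y\<close> for
  \<open>m y * (\<rho> - dist x y)\<close> would control \<open>m\<close>, hence the oscillation of \<open>V\<close>, on the ball of radius
  \<open>2 / m y\<close>, which is incompatible with the definition of \<open>m y\<close>.\<close>

lemma point_picking:
  fixes m V :: "real^'n::finite \<Rightarrow> real"
  assumes V1: "\<And>y. y \<in> ball x (1/4) \<Longrightarrow> V y \<ge> 1"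
    and dV: "\<And>y. y \<in> ball x (1/4) \<Longrightarrow> (V has_derivative V' y) (at y)"
    and bV: "\<And>y h. y \<in> ball x (1/4) \<Longrightarrow> \<bar>V' y h\<bar> \<le> K * (m y)\<^sup>2 * norm h"
    and mB: "\<And>y. y \<in> ball x (1/8) \<Longrightarrow> m y \<le> B" and m0: "\<And>y. y \<in> ball x (1/8) \<Longrightarrow> m y \<ge> 0"
    and mdef: "\<And>y A \<rho>. \<rho> > 0 \<Longrightarrow> ball y \<rho> \<subseteq> ball x (1/4) \<Longrightarrow> (\<And>z. z \<in> ball y \<rho> \<Longrightarrow> V z \<le> A) \<Longrightarrow>
        c * A * \<rho>\<^sup>2 \<le> 1 \<Longrightarrow> m y * \<rho> \<le> 1"
    and K: "K > 0" and \<Lambda>: "\<Lambda> > 0" "\<Lambda> \<ge> 216 * c" and N: "N \<ge> 64" "N \<ge> 2 * K * \<Lambda>"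
  shows "(m x)\<^sup>2 \<le> (\<Lambda> + N\<^sup>2) * V x"
proof (rule ccontr)
  assume "\<not> ?thesis"
  then have neg: "(m x)\<^sup>2 > \<Lambda> * V x + N\<^sup>2 * V x" by (simp add: distrib_right)
  have Vx: "V x \<ge> 1" using V1 by simp
  have "N\<^sup>2 * 1 \<le> N\<^sup>2 * V x" using Vx by (intro mult_left_mono) auto
  moreover have "\<Lambda> * V x > 0" "N\<^sup>2 * V x \<ge> 0" using \<Lambda> Vx by auto
  ultimately have bx: "(m x)\<^sup>2 > \<Lambda> * V x" "(m x)\<^sup>2 > N\<^sup>2" using neg by auto
  then have mx: "m x > N" using m0[of x] power_mono[of "m x" N 2] by (intro power_less_imp_less_base[of N 2]) auto
  \<comment> \<open>This radius gives \<open>F x = 8\<close>, so at an almost maximal point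
    \<open>\<mu> * \<delta> > 4\<close> and the ball of radius \<open>2 / \<mu>\<close> uses less
    than half of the distance \<open>\<delta>\<close>. The threshold \<open>N >= 64\<close> makes
    \<open>\<rho>\<close> smaller than \<open>1/8\<close>.\<close>
  define \<rho> where "\<rho> = 8 / m x"
  have \<rho>: "\<rho> > 0" "\<rho> < 1/8" using mx N by (auto simp: \<rho>_def field_simps)
  \<comment> \<open>Points where the bound fails with constant \<open>\<Lambda>\<close> and
    \<open>m\<close> is above the threshold. The weight in \<open>F\<close> keeps the selected point
    away from the boundary of the ball.\<close>
  define S where "S = {y \<in> ball x \<rho>. (m y)\<^sup>2 > \<Lambda> * V y \<and> m y > N}"
  define F where "F y = m y * (\<rho> - dist x y)" for y
  have xS: "x \<in> S" using bx mx \<rho> by (simp add: S_def)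
  have "bdd_above (F ` S)"
  proof (rule bdd_aboveI2)
    fix y assume y: "y \<in> S"
    then have my: "m y > 0" "m y \<le> B" using N \<rho> mB[of y] by (auto simp: S_def)
    have "m y * (\<rho> - dist x y) \<le> B * \<rho>"
      using my y \<rho> by (intro mult_mono) (auto simp: S_def)
    then show "F y \<le> B * \<rho>" by (simp add: F_def)
  qed
  define s where "s = Sup (F ` S)"
  have sle: "F y \<le> s" if "y \<in> S" for y unfolding s_def using that \<open>bdd_above (F ` S)\<close> by (intro cSup_upper) auto
  have "F x = 8" using mx N by (simp add: F_def \<rho>_def)
  then have s8: "s \<ge> 8" using sle[OF xS] by simp
  then have "s / 2 < s" by simp
  then obtain y where y: "y \<in> S" "F y > s / 2"
    unfolding s_def using less_cSup_iff[of "F ` S" "Sup (F ` S) / 2"] \<open>bdd_above (F ` S)\<close> xS by (auto simp: s_def)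
  define \<mu> where "\<mu> = m y"
  define \<delta> where "\<delta> = \<rho> - dist x y"
  have \<mu>: "\<mu> > N" "\<mu> > 0" using y N by (auto simp: S_def \<mu>_def)
  have \<mu>V: "\<Lambda> * V y < \<mu>\<^sup>2" using y by (simp add: S_def \<mu>_def)
  have F4: "\<mu> * \<delta> > 4" "s < 2 * (\<mu> * \<delta>)" using y s8 by (auto simp: F_def \<mu>_def \<delta>_def)
  have \<delta>4: "4 / \<mu> < \<delta>" using F4 \<mu> by (simp add: field_simps)
  have in\<rho>: "dist x z < \<rho> \<and> \<rho> - dist x z > \<delta> / 2" if "z \<in> ball y (2 / \<mu>)" for z
  proof -
    define q where "q = 2 / \<mu>"
    have "dist x z < dist x y + q" using that dist_triangle[of x z y] by (simp add: q_def)
    moreover have "2 * q < \<delta>" "0 < q" using \<mu> \<delta>4 by (auto simp: q_def)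
    ultimately show ?thesis unfolding \<delta>_def by auto
  qed
  have sub: "ball y (2 / \<mu>) \<subseteq> ball x (1/4)" using in\<rho> \<rho> by fastforce
  \<comment> \<open>A bad point \<open>z\<close> keeps at least half of the distance
    \<open>\<delta>\<close>, so almost maximality gives \<open>m z <= 4 * \<mu>\<close>. Elsewhere
    \<open>m z\<close> is at most \<open>N < \<mu>\<close> or its square is at most
    \<open>\<Lambda> * V z\<close>. The 17 dominates both 16 and 1.\<close>
  have mz: "(m z)\<^sup>2 \<le> 17 * \<mu>\<^sup>2 + \<Lambda> * V z" if z1: "z \<in> ball y (2 / \<mu>)" for z
  proof -
    have "m z \<ge> 0" using m0[of z] in\<rho>[OF z1] \<rho> by simp
    note z = z1 this
    have Vz: "\<Lambda> * V z \<ge> 0" using V1[of z] sub z \<Lambda> by force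
    show ?thesis
    proof (cases "z \<in> S")
      case True
      have "m z * (\<delta> / 2) \<le> m z * (\<rho> - dist x z)" using in\<rho>[OF z(1)] z(2) by (intro mult_left_mono) auto
      also have "\<dots> \<le> s" using sle[OF True] by (simp add: F_def)
      also have "\<dots> < 2 * (\<mu> * \<delta>)" by (rule F4)
      finally have "m z * \<delta> < (4 * \<mu>) * \<delta>" by simp
      moreover have "\<delta> > 0" using \<delta>4 \<mu> by (meson divide_pos_pos less_trans zero_less_numeral)
      ultimately have "m z \<le> 4 * \<mu>" by (simp add: less_imp_le)
      then have "(m z)\<^sup>2 \<le> (4 * \<mu>)\<^sup>2" using z by (intro power_mono)
      also have "\<dots> \<le> 17 * \<mu>\<^sup>2" by (simp add: power_mult_distrib)
      finally show ?thesis using Vz by simp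
    next
      case False
      then have "(m z)\<^sup>2 \<le> \<Lambda> * V z \<or> m z \<le> N" using in\<rho>[OF z(1)] by (auto simp: S_def)
      then show ?thesis
      proof
        assume "(m z)\<^sup>2 \<le> \<Lambda> * V z"
        then show ?thesis by (simp add: add_increasing)
      next
        assume "m z \<le> N"
        then have "(m z)\<^sup>2 \<le> \<mu>\<^sup>2" using z \<mu> by (intro power_mono) auto
        moreover have "\<mu>\<^sup>2 \<ge> 0" by simp
        ultimately show ?thesis using Vz by linarith
      qed
    qed
  qed
  \<comment> \<open>The shift turns the derivative bound
    \<open>K * (17 * \<mu>\<^sup>2 + \<Lambda> * V z)\<close> into
    \<open>K * \<Lambda> * H z\<close>. So \<open>ln H\<close> increases by at most
    \<open>2 * K * \<Lambda> / \<mu> <= 1\<close> over the length \<open>2 / \<mu>\<close>, by the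
    choice of \<open>N\<close>.\<close>
  define H where "H z = V z + 17 * \<mu>\<^sup>2 / \<Lambda>" for z
  have Hp: "H z > 0" if "z \<in> ball x (1/4)" for z
    using V1[OF that] \<Lambda> by (simp add: H_def add_pos_nonneg)
  have Vb: "V z \<le> 54 * \<mu>\<^sup>2 / \<Lambda>" if z: "z \<in> ball y (2 / \<mu>)" for z
  proof -
    define \<gamma> where "\<gamma> t = y + t *\<^sub>R (z - y)" for t
    have \<gamma>: "\<gamma> t \<in> ball y (2 / \<mu>)" if "0 \<le> t" "t \<le> 1" for t
    proof -
      have "norm (t *\<^sub>R (z - y)) \<le> norm (z - y)" using that by (simp add: mult_left_le_one_le)
      also have "\<dots> < 2 / \<mu>" using z by (simp add: dist_norm norm_minus_commute)
      finally show ?thesis by (simp add: \<gamma>_def dist_norm)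
    qed
    have der: "((\<lambda>t. ln (H (\<gamma> t))) has_real_derivative V' (\<gamma> t) (z - y) / H (\<gamma> t)) (at t)" if "0 \<le> t" "t \<le> 1" for t
    proof -
      have in4: "\<gamma> t \<in> ball x (1/4)" using \<gamma>[OF that] sub by blast
      have "(\<gamma> has_derivative (\<lambda>h. h *\<^sub>R (z - y))) (at t)"
        unfolding \<gamma>_def[abs_def] by (auto intro!: derivative_eq_intros)
      from has_derivative_compose[OF this dV[OF in4]]
      have "((\<lambda>t. V (\<gamma> t)) has_derivative (\<lambda>h. V' (\<gamma> t) (h *\<^sub>R (z - y)))) (at t)" .
      moreover have "V' (\<gamma> t) (h *\<^sub>R (z - y)) = h * V' (\<gamma> t) (z - y)" for h
        using linear_scale[OF has_derivative_linear[OF dV[OF in4]]] by simp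
      ultimately have "((\<lambda>t. V (\<gamma> t)) has_real_derivative V' (\<gamma> t) (z - y)) (at t)"
        by (intro has_derivative_imp_has_field_derivative[where D = "\<lambda>h. h * V' (\<gamma> t) (z - y)"]) (auto simp: mult.commute)
      then have "((\<lambda>t. H (\<gamma> t)) has_real_derivative V' (\<gamma> t) (z - y)) (at t)"
        unfolding H_def by (auto intro!: derivative_eq_intros)
      from DERIV_chain2[OF DERIV_ln[OF Hp[OF in4]] this] show ?thesis by (simp add: divide_inverse mult.commute)
    qed
    obtain t where t: "0 < t" "t < 1" "ln (H (\<gamma> 1)) - ln (H (\<gamma> 0)) = (1 - 0) * (V' (\<gamma> t) (z - y) / H (\<gamma> t))"
      using MVT2[of 0 1 "\<lambda>t. ln (H (\<gamma> t))" "\<lambda>t. V' (\<gamma> t) (z - y) / H (\<gamma> t)"] der by auto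
    have in4: "\<gamma> t \<in> ball x (1/4)" using \<gamma>[of t] t sub by auto
    have "V' (\<gamma> t) (z - y) \<le> K * (m (\<gamma> t))\<^sup>2 * norm (z - y)" using bV[OF in4, of "z - y"] by linarith
    also have "\<dots> \<le> K * (17 * \<mu>\<^sup>2 + \<Lambda> * V (\<gamma> t)) * (2 / \<mu>)"
    proof (rule mult_mono)
      show "K * (m (\<gamma> t))\<^sup>2 \<le> K * (17 * \<mu>\<^sup>2 + \<Lambda> * V (\<gamma> t))"
        using mz[of "\<gamma> t"] \<gamma>[of t] t K by (intro mult_left_mono) auto
      show "norm (z - y) \<le> 2 / \<mu>" using z by (simp add: dist_norm norm_minus_commute)
      show "0 \<le> K * (17 * \<mu>\<^sup>2 + \<Lambda> * V (\<gamma> t))" using K \<Lambda> V1[OF in4] by (intro mult_nonneg_nonneg add_nonneg_nonneg) auto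
    qed simp
    also have "17 * \<mu>\<^sup>2 + \<Lambda> * V (\<gamma> t) = \<Lambda> * H (\<gamma> t)" using \<Lambda> by (simp add: H_def distrib_left)
    also have "K * (\<Lambda> * H (\<gamma> t)) * (2 / \<mu>) = (2 * K * \<Lambda> / \<mu>) * H (\<gamma> t)" by simp
    also have "\<dots> \<le> 1 * H (\<gamma> t)"
      using N \<mu> Hp[OF in4] by (intro mult_right_mono) (auto simp: field_simps)
    finally have "V' (\<gamma> t) (z - y) / H (\<gamma> t) \<le> 1" using Hp[OF in4] by (simp add: field_simps)
    then have "ln (H z) \<le> ln (H y) + 1" using t(3) by (simp add: \<gamma>_def)
    then have "exp (ln (H z)) \<le> exp (ln (H y) + 1)" by simp
    moreover have "y \<in> ball y (2 / \<mu>)" using \<mu> by simp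
    then have "y \<in> ball x (1/4)" using sub by blast
    moreover have "z \<in> ball x (1/4)" using z sub by blast
    ultimately have "H z \<le> H y * exp 1" using Hp by (simp add: exp_add)
    also have "\<dots> \<le> H y * 3" using Hp[OF \<open>y \<in> ball x (1/4)\<close>] exp_le by (intro mult_left_mono) auto
    finally have Hz: "H z \<le> H y * 3" .
    have "V y \<le> \<mu>\<^sup>2 / \<Lambda>" using \<mu>V \<Lambda> by (simp add: field_simps)
    then have "H y * 3 \<le> (\<mu>\<^sup>2 / \<Lambda> + 17 * \<mu>\<^sup>2 / \<Lambda>) * 3" by (simp add: H_def)
    also have "\<dots> = 54 * \<mu>\<^sup>2 / \<Lambda>" by (simp add: field_simps)
    finally have "H z \<le> 54 * \<mu>\<^sup>2 / \<Lambda>" using Hz by (rule order_trans[rotated])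
    moreover have "V z \<le> H z" using \<Lambda> by (simp add: H_def)
    ultimately show ?thesis by (rule order_trans[rotated])
  qed
  \<comment> \<open>\<open>54 = 3 * (1 + 17)\<close>, the 3 bounding \<open>exp 1\<close>, and
    \<open>216 = 54 * 4\<close> from the squared radius. Admissibility of the radius
    \<open>2 / \<mu>\<close> contradicts \<open>m y * (2 / \<mu>) = 2\<close>.\<close>
  have "c * (54 * \<mu>\<^sup>2 / \<Lambda>) * (2 / \<mu>)\<^sup>2 = 216 * c / \<Lambda>" using \<mu> by (simp add: power_divide)
  also have "\<dots> \<le> 1" using \<Lambda> by simp
  finally have "c * (54 * \<mu>\<^sup>2 / \<Lambda>) * (2 / \<mu>)\<^sup>2 \<le> 1" .
  from mdef[OF _ sub Vb this] \<mu> have "m y * (2 / \<mu>) \<le> 1" by simp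
  then show False using \<mu> by (simp add: \<mu>_def)
qed


subsection \<open>The field in the transition region\<close>

abbreviation (input) pairs :: "('n::{finite,linorder} \<times> 'n) set" where
  "pairs \<equiv> {(j, k). j < k}"

text \<open>A differentiable substitute for \<open>1 + |B|\<close>.\<close>

definition Bsmooth :: "('n::{finite,linorder} \<Rightarrow> 'n \<Rightarrow> (real,'n) vec \<Rightarrow> real) \<Rightarrow> (real,'n) vec \<Rightarrow> real" where
  "Bsmooth b x = sqrt (1 + (\<Sum>(j,k)\<in>pairs. (b j k x)\<^sup>2))"

lemma Bsmooth_ge_1: "Bsmooth b x \<ge> 1"
  unfolding Bsmooth_def by (simp add: sum_nonneg split: prod.splits)

lemma abs_le_Bsmooth:
  fixes j k :: "'n::{finite,linorder}"
  assumes "j < k"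
  shows "\<bar>b j k x\<bar> \<le> Bsmooth b x"
proof -
  have "(\<lambda>(j,k). (b j k x)\<^sup>2) (j, k) \<le> (\<Sum>(j,k)\<in>pairs. (b j k x)\<^sup>2)"
    by (rule member_le_sum) (use assms in auto)
  then have "sqrt ((b j k x)\<^sup>2) \<le> Bsmooth b x"
    unfolding Bsmooth_def by (intro real_sqrt_le_mono) simp
  then show ?thesis by simp
qed

lemma Bnorm_le_Bsmooth:
  fixes b :: "'n::{finite,linorder} \<Rightarrow> 'n \<Rightarrow> (real,'n) vec \<Rightarrow> real"
  shows "Bnorm b x \<le> real (card (pairs :: ('n \<times> 'n) set)) * Bsmooth b x"
proof -
  have "Bnorm b x \<le> (\<Sum>p\<in>(pairs :: ('n \<times> 'n) set). Bsmooth b x)"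
    unfolding Bnorm_def by (rule sum_mono) (auto simp: abs_le_Bsmooth)
  then show ?thesis by simp
qed

lemma Bnorm_nonneg: "Bnorm b x \<ge> 0"
  unfolding Bnorm_def by (intro sum_nonneg) auto

lemma abs_le_Bnorm:
  fixes j k :: "'n::{finite,linorder}"
  assumes "j < k"
  shows "\<bar>b j k x\<bar> \<le> Bnorm b x"
proof -
  have "(\<lambda>(j,k). \<bar>b j k x\<bar>) (j, k) \<le> (\<Sum>(j,k)\<in>pairs. \<bar>b j k x\<bar>)"
    by (rule member_le_sum) (use assms in auto)
  then show ?thesis by (simp add: Bnorm_def)
qed

lemma Bsmooth_le_Bnorm: "Bsmooth b x \<le> 1 + Bnorm b x"
proof -
  have "(\<Sum>(j,k)\<in>pairs. (b j k x)\<^sup>2) \<le> (\<Sum>(j,k)\<in>pairs. \<bar>b j k x\<bar> * Bnorm b x)"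
  proof (rule sum_mono, clarsimp)
    fix j k :: 'a assume "j < k"
    then have "\<bar>b j k x\<bar> * \<bar>b j k x\<bar> \<le> \<bar>b j k x\<bar> * Bnorm b x" by (intro mult_left_mono abs_le_Bnorm) auto
    then show "(b j k x)\<^sup>2 \<le> \<bar>b j k x\<bar> * Bnorm b x" by (simp add: power2_eq_square)
  qed
  also have "\<dots> = (Bnorm b x)\<^sup>2"
    by (simp add: Bnorm_def power2_eq_square sum_distrib_right case_prod_unfold)
  finally have "1 + (\<Sum>(j,k)\<in>pairs. (b j k x)\<^sup>2) \<le> (1 + Bnorm b x)\<^sup>2"
    using Bnorm_nonneg[of b x] by (simp add: power2_sum)
  then show ?thesis unfolding Bsmooth_def using Bnorm_nonneg[of b x] by (intro real_le_lsqrt) auto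
qed

lemma directional_derivative_bound:
  fixes f :: "real^'n::finite \<Rightarrow> real"
  assumes "f differentiable (at x)"
  shows "\<bar>frechet_derivative f (at x) h\<bar> \<le> norm (grad f x) * norm h"
proof -
  have "frechet_derivative f (at x) h = (\<Sum>l\<in>UNIV. h $ l *\<^sub>R pd l f x)"
    using frechet_derivative_at[OF pd_works[OF assms]] by metis
  also have "\<dots> = grad f x \<bullet> h" by (simp add: grad_def inner_vec_def mult.commute)
  finally show ?thesis using Cauchy_Schwarz_ineq2 by simp
qed

definition dBsmooth :: "('n::{finite,linorder} \<Rightarrow> 'n \<Rightarrow> (real,'n) vec \<Rightarrow> real) \<Rightarrow> (real,'n) vec \<Rightarrow> (real,'n) vec \<Rightarrow> real" where
  "dBsmooth b x h = (\<Sum>(j,k)\<in>pairs. b j k x * frechet_derivative (b j k) (at x) h) / Bsmooth b x"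

lemma Bsmooth_has_derivative:
  assumes "\<And>j k. b j k differentiable (at x)"
  shows "(Bsmooth b has_derivative dBsmooth b x) (at x)"
proof -
  have d: "(b j k has_derivative frechet_derivative (b j k) (at x)) (at x)" for j k
    using assms frechet_derivative_works by blast
  let ?q = "\<lambda>x. 1 + (\<Sum>p\<in>pairs. (b (fst p) (snd p) x)\<^sup>2)"
  have p: "?q x > 0" by (simp add: add_pos_nonneg sum_nonneg)
  have "((\<lambda>x. (b j k x)\<^sup>2) has_derivative (\<lambda>h. 2 * (b j k x * frechet_derivative (b j k) (at x) h))) (at x)" for j k
    using has_derivative_power[OF d, of j k 2] by (simp add: mult_ac)
  then have "(?q has_derivative (\<lambda>h. 0 + (\<Sum>p\<in>pairs. 2 * (b (fst p) (snd p) x * frechet_derivative (b (fst p) (snd p)) (at x) h)))) (at x)"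
    by (intro has_derivative_add has_derivative_const has_derivative_sum)
  from has_derivative_real_sqrt[OF p this]
  have "((\<lambda>x. sqrt (?q x)) has_derivative dBsmooth b x) (at x)"
    by (rule has_derivative_eq_rhs)
      (auto simp: dBsmooth_def Bsmooth_def case_prod_unfold sum_distrib_left[symmetric] fun_eq_iff field_simps)
  then show ?thesis by (simp add: Bsmooth_def[abs_def] case_prod_unfold)
qed

lemma frechet_derivative_le_gradBnorm:
  fixes j k :: "'n::{finite,linorder}"
  assumes "\<And>j k. b j k differentiable (at x)" "j < k"
  shows "\<bar>frechet_derivative (b j k) (at x) h\<bar> \<le> gradBnorm b x * norm h"
proof -
  have "(\<lambda>(j,k). norm (grad (b j k) x)) (j, k) \<le> (\<Sum>(j,k)\<in>pairs. norm (grad (b j k) x))"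
    by (rule member_le_sum) (use assms in auto)
  then have "norm (grad (b j k) x) * norm h \<le> gradBnorm b x * norm h"
    by (intro mult_right_mono) (auto simp: gradBnorm_def)
  then show ?thesis using directional_derivative_bound[OF assms(1), of j k h] by linarith
qed

lemma dBsmooth_bound:
  assumes d: "\<And>j k. b j k differentiable (at x)"
  shows "\<bar>dBsmooth b x h\<bar> \<le> gradBnorm b x * norm h"
proof -
  have B0: "Bsmooth b x > 0" using Bsmooth_ge_1[of b x] by linarith
  have "\<bar>\<Sum>(j,k)\<in>pairs. b j k x * frechet_derivative (b j k) (at x) h\<bar>
      \<le> (\<Sum>(j,k)\<in>pairs. \<bar>b j k x * frechet_derivative (b j k) (at x) h\<bar>)"
    using sum_abs[of "\<lambda>p. b (fst p) (snd p) x * frechet_derivative (b (fst p) (snd p)) (at x) h"]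
    by (simp add: case_prod_unfold)
  also have "\<dots> \<le> (\<Sum>(j,k)\<in>pairs. Bsmooth b x * (norm (grad (b j k) x) * norm h))"
  proof (rule sum_mono, clarsimp)
    fix j k :: 'a assume "j < k"
    then show "\<bar>b j k x * frechet_derivative (b j k) (at x) h\<bar> \<le> Bsmooth b x * (norm (grad (b j k) x) * norm h)"
      unfolding abs_mult using B0 by (intro mult_mono abs_le_Bsmooth directional_derivative_bound d) auto
  qed
  also have "\<dots> = Bsmooth b x * (gradBnorm b x * norm h)"
    by (simp add: gradBnorm_def sum_distrib_left sum_distrib_right case_prod_unfold)
  finally show ?thesis using B0 by (simp add: dBsmooth_def abs_divide field_simps)
qed

text \<open>\<open>K1\<close> is chosen before \<open>b\<close> and \<open>x\<close>. Point picking
  with \<open>V = Bsmooth b\<close> bounds the square of \<open>mfun\<close> by a multiple of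
  \<open>Bsmooth\<close>, and the gradient hypothesis at \<open>x\<close> itself turns this into a
  relative gradient bound.\<close>

lemma mfun_le_Bsmooth:
  fixes b :: "'n::{finite,linorder} \<Rightarrow> 'n \<Rightarrow> (real,'n) vec \<Rightarrow> real"
  assumes C1: "C1 > 0" and K: "K \<ge> 1"
  shows "\<exists>K1\<ge>0. \<forall>b :: 'n \<Rightarrow> 'n \<Rightarrow> (real,'n) vec \<Rightarrow> real. \<forall>x.
    (\<forall>x r. set_integrable lborel (ball x r) (Bnorm b)) \<longrightarrow>
    (\<forall>y\<in>ball x (1/4). (\<forall>j k. b j k differentiable (at y)) \<and> gradBnorm b y \<le> K * (mfun C1 (\<lambda>y. Bnorm b y + 1) y)\<^sup>2) \<longrightarrow>
    gradBnorm b x \<le> K1 * Bsmooth b x"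
proof -
  define P where "P = real (card (pairs :: ('n \<times> 'n) set)) + 1"
  define \<omega> where "\<omega> = unit_ball_vol (real CARD('n))"
  \<comment> \<open>Chosen so that \<open>c * A * \<rho>\<^sup>2 <= 1\<close> is the admissibility
    condition of \<open>mfun_le\<close> with the bound \<open>P * A\<close> for
    \<open>Bnorm + 1\<close>, given \<open>Bsmooth <= A\<close>.\<close>
  define c where "c = \<omega> * P / C1"
  have P: "P \<ge> 1" "P > 0" and \<omega>: "\<omega> > 0" by (auto simp: P_def \<omega>_def)
  have c: "c > 0" using P \<omega> C1 by (simp add: c_def)
  define \<Lambda> where "\<Lambda> = 216 * c"
  define N where "N = max 64 (2 * K * \<Lambda>)"
  have \<Lambda>: "\<Lambda> > 0" using c by (simp add: \<Lambda>_def)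
  show ?thesis
  proof (intro exI[of _ "K * (\<Lambda> + N\<^sup>2)"] conjI allI impI)
    show "0 \<le> K * (\<Lambda> + N\<^sup>2)" using K \<Lambda> by simp
    fix b :: "'n \<Rightarrow> 'n \<Rightarrow> (real,'n) vec \<Rightarrow> real" and x
    assume Bi: "\<forall>x r. set_integrable lborel (ball x r) (Bnorm b)"
      and hyp: "\<forall>y\<in>ball x (1/4). (\<forall>j k. b j k differentiable (at y)) \<and> gradBnorm b y \<le> K * (mfun C1 (\<lambda>y. Bnorm b y + 1) y)\<^sup>2"
    define m where "m = mfun C1 (\<lambda>y. Bnorm b y + 1)"
    have d: "b j k differentiable (at y)" if "y \<in> ball x (1/4)" for y j k using hyp that by blast
    have gb: "gradBnorm b y \<le> K * (m y)\<^sup>2" if "y \<in> ball x (1/4)" for y using hyp that by (simp add: m_def)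
    have wi: "set_integrable lborel (ball x r) (\<lambda>y. Bnorm b y + 1)" for x r
      using Bi emeasure_lborel_ball_finite[of x r]
      by (intro set_integral_add) (auto simp: set_integrable_def integrable_real_indicator)
    have mdef: "0 < m y \<and> m y * \<rho> \<le> 1"
      if \<rho>: "\<rho> > 0" and VA: "\<And>z. z \<in> ball y \<rho> \<Longrightarrow> Bsmooth b z \<le> A" and A: "c * A * \<rho>\<^sup>2 \<le> 1" for y A \<rho>
    proof -
      have w: "Bnorm b z + 1 \<le> P * A" if "z \<in> ball y \<rho>" for z
      proof -
        have "Bnorm b z + 1 \<le> P * Bsmooth b z"
          using Bnorm_le_Bsmooth[of b z] Bsmooth_ge_1[of b z] by (simp add: P_def distrib_right)
        also have "\<dots> \<le> P * A" using VA[OF that] P by (intro mult_left_mono) auto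
        finally show ?thesis .
      qed
      have "C1 * (c * A * \<rho>\<^sup>2) \<le> C1 * 1" using A C1 by (intro mult_left_mono) auto
      then have "\<omega> * (P * A) * \<rho>\<^sup>2 \<le> C1" using C1 by (simp add: c_def mult_ac)
      then show ?thesis
        unfolding m_def \<omega>_def using mfun_le[OF wi _ C1 \<rho> w] Bnorm_nonneg[of b] by simp
    qed
    \<comment> \<open>Point picking presupposes some finite bound for \<open>m\<close> near
      \<open>x\<close>. Compactness supplies one that depends on \<open>b\<close> but does not enter
      \<open>K1\<close>; the radii fit because \<open>1/8 + 1/16 = 3/16 < 1/4\<close>.\<close>
    have "continuous_on (cball x (3/16)) (Bsmooth b)"
    proof (rule continuous_at_imp_continuous_on, rule ballI)
      fix y assume "y \<in> cball x (3/16)"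
      then have "y \<in> ball x (1/4)" by auto
      then show "isCont (Bsmooth b) y"
        using Bsmooth_has_derivative[of b y] d has_derivative_continuous by blast
    qed
    then have "bounded (Bsmooth b ` cball x (3/16))"
      by (intro compact_imp_bounded compact_continuous_image) auto
    then obtain A0 where A0: "A0 > 0" "\<And>y. y \<in> cball x (3/16) \<Longrightarrow> Bsmooth b y \<le> A0"
      by (force simp: bounded_pos abs_le_iff)
    define \<rho>0 where "\<rho>0 = min (1/16) (sqrt (1 / (c * A0)))"
    have \<rho>0: "\<rho>0 > 0" "\<rho>0 \<le> 1/16" using c A0 by (auto simp: \<rho>0_def)
    have "\<rho>0\<^sup>2 \<le> (sqrt (1 / (c * A0)))\<^sup>2" using \<rho>0 by (intro power_mono) (auto simp: \<rho>0_def)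
    then have c0: "c * A0 * \<rho>0\<^sup>2 \<le> 1" using c A0 by (simp add: field_simps)
    have loc: "0 < m y \<and> m y * \<rho>0 \<le> 1" if "y \<in> ball x (1/8)" for y
    proof (rule mdef[OF \<rho>0(1) _ c0])
      fix z assume "z \<in> ball y \<rho>0"
      then have "dist x z \<le> 3/16" using that \<rho>0 dist_triangle[of x z y] by simp
      then show "Bsmooth b z \<le> A0" using A0 by simp
    qed
    have "(m x)\<^sup>2 \<le> (\<Lambda> + N\<^sup>2) * Bsmooth b x"
    proof (rule point_picking[where V' = "dBsmooth b" and K = K and c = c and B = "1 / \<rho>0"])
      show "(Bsmooth b has_derivative dBsmooth b y) (at y)" if "y \<in> ball x (1/4)" for y
        using d[OF that] by (rule Bsmooth_has_derivative)
      show "\<bar>dBsmooth b y h\<bar> \<le> K * (m y)\<^sup>2 * norm h" if "y \<in> ball x (1/4)" for y h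
        using dBsmooth_bound[of b y h, OF d[OF that]] mult_right_mono[OF gb[OF that], of "norm h"] by simp
      show "m y \<le> 1 / \<rho>0" "m y \<ge> 0" if "y \<in> ball x (1/8)" for y
        using loc[OF that] \<rho>0 by (auto simp: field_simps)
      show "m y * \<rho> \<le> 1" if "0 < \<rho>" "\<And>z. z \<in> ball y \<rho> \<Longrightarrow> Bsmooth b z \<le> A" "c * A * \<rho>\<^sup>2 \<le> 1" for y A \<rho>
        using mdef that by blast
    qed (use Bsmooth_ge_1 K \<Lambda> in \<open>auto simp: N_def \<Lambda>_def\<close>)
    then have "K * (m x)\<^sup>2 \<le> K * ((\<Lambda> + N\<^sup>2) * Bsmooth b x)" using K by (intro mult_left_mono) auto
    then show "gradBnorm b x \<le> K * (\<Lambda> + N\<^sup>2) * Bsmooth b x" using gb[of x] by simp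
  qed
qed

subsection \<open>Cutoff functions\<close>

lemma infdist_lipschitz: "\<bar>infdist x A - infdist y A\<bar> \<le> norm (x - y)"
  using infdist_triangle[of x A y] infdist_triangle[of y A x] by (simp add: dist_norm norm_minus_commute abs_le_iff)

definition region_cutoff :: "(real^'n::finite) set \<Rightarrow> real \<Rightarrow> real^'n \<Rightarrow> real" where
  "region_cutoff \<Omega> d x = min 1 (infdist x (- \<Omega>) / d)"

lemma region_cutoff_range:
  assumes "d > 0"
  shows "0 \<le> region_cutoff \<Omega> d x" "region_cutoff \<Omega> d x \<le> 1"
  using assms infdist_nonneg[of x "- \<Omega>"] by (auto simp: region_cutoff_def)

lemma region_cutoff_outside:
  assumes "x \<notin> \<Omega>" shows "region_cutoff \<Omega> d x = 0"
  using assms by (simp add: region_cutoff_def)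

lemma region_cutoff_lipschitz:
  assumes d: "d > 0"
  shows "(1 / d)-lipschitz_on UNIV (region_cutoff \<Omega> d)"
proof (rule lipschitz_onI)
  show "0 \<le> 1 / d" using d by simp
  fix x y
  have "\<bar>min 1 s - min 1 t\<bar> \<le> \<bar>s - t\<bar>" for s t :: real by linarith
  from this[of "infdist x (- \<Omega>) / d" "infdist y (- \<Omega>) / d"]
  have "\<bar>region_cutoff \<Omega> d x - region_cutoff \<Omega> d y\<bar> \<le> \<bar>infdist x (- \<Omega>) / d - infdist y (- \<Omega>) / d\<bar>"
    by (simp add: region_cutoff_def)
  also have "\<dots> = \<bar>infdist x (- \<Omega>) - infdist y (- \<Omega>)\<bar> / d" using d by (simp add: abs_divide flip: diff_divide_distrib)
  also have "\<dots> \<le> norm (x - y) / d" using d by (intro divide_right_mono infdist_lipschitz) auto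
  finally show "dist (region_cutoff \<Omega> d x) (region_cutoff \<Omega> d y) \<le> 1 / d * dist x y"
    by (simp add: dist_norm)
qed

text \<open>A segment from \<open>x\<close> to a point outside \<open>\<Omega>\<close> meets the
  frontier, so the distance to the complement is at least the distance to the frontier.\<close>

lemma region_cutoff_inside:
  assumes \<Omega>: "open \<Omega>" and d: "d > 0" "setdist (\<Omega> - T) (frontier \<Omega>) = d" and x: "x \<in> \<Omega> - T"
  shows "region_cutoff \<Omega> d x = 1"
proof -
  \<comment> \<open>The distance to an empty set is 0 by convention, so \<open>d > 0\<close>
    excludes an empty frontier and with it \<open>\<Omega> = UNIV\<close>.\<close>
  have "frontier \<Omega> \<noteq> {}" using d by (auto simp: setdist_empty2)
  then have "\<Omega> \<noteq> UNIV" by auto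
  then have ne: "- \<Omega> \<noteq> {}" by blast
  have "d \<le> dist x z" if "z \<in> - \<Omega>" for z
  proof -
    have "closed_segment x z \<inter> frontier \<Omega> \<noteq> {}"
      by (rule connected_Int_frontier) (use x that in \<open>auto intro: connected_segment\<close>)
    then obtain p where p: "p \<in> closed_segment x z" "p \<in> frontier \<Omega>" by blast
    have "d \<le> dist x p" using setdist_le_dist[OF x p(2)] d by simp
    also have "\<dots> \<le> dist x z" using dist_in_closed_segment[OF p(1)] by (simp add: dist_commute)
    finally show ?thesis .
  qed
  then have "d \<le> infdist x (- \<Omega>)" unfolding infdist_notempty[OF ne] by (intro cINF_greatest ne)
  then show ?thesis using d by (simp add: region_cutoff_def)
qed

text \<open>Vanishing already at distance \<open>M / 2\<close> leaves a margin inside the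
  neighbourhood of width \<open>M\<close>; for \<open>M >= 1\<close> the slope is at most 2.\<close>

definition transition_cutoff :: "(real^'n::finite) set \<Rightarrow> real \<Rightarrow> real^'n \<Rightarrow> real" where
  "transition_cutoff T M x = max 0 (1 - 2 / M * infdist x T)"

lemma transition_cutoff_range:
  assumes "M \<ge> 1"
  shows "0 \<le> transition_cutoff T M x" "transition_cutoff T M x \<le> 1"
  using assms infdist_nonneg[of x T] by (auto simp: transition_cutoff_def)

lemma transition_cutoff_lipschitz:
  assumes M: "M \<ge> 1"
  shows "\<bar>transition_cutoff T M x - transition_cutoff T M y\<bar> \<le> 2 * norm (x - y)"
proof -
  have "\<bar>max 0 (1 - s) - max 0 (1 - t)\<bar> \<le> \<bar>s - t\<bar>" for s t :: real by linarith
  from this[of "2 / M * infdist x T" "2 / M * infdist y T"]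
  have "\<bar>transition_cutoff T M x - transition_cutoff T M y\<bar> \<le> \<bar>2 / M * infdist x T - 2 / M * infdist y T\<bar>"
    by (simp add: transition_cutoff_def)
  also have "\<dots> = 2 / M * \<bar>infdist x T - infdist y T\<bar>"
    unfolding right_diff_distrib[symmetric] abs_mult using M by simp
  also have "\<dots> \<le> 2 * norm (x - y)"
    using M infdist_lipschitz[of x T y] by (intro mult_mono) (auto simp: field_simps)
  finally show ?thesis .
qed

definition direction :: "('n::{finite,linorder} \<Rightarrow> 'n \<Rightarrow> (real,'n) vec \<Rightarrow> real) \<Rightarrow> 'n \<Rightarrow> 'n \<Rightarrow> (real,'n) vec \<Rightarrow> real" where
  "direction b j k x = b j k x / Bsmooth b x"

lemma direction_bound: "j < k \<Longrightarrow> \<bar>direction b j k x\<bar> \<le> 1"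
  using abs_le_Bsmooth[of j k b x] Bsmooth_ge_1[of b x] by (simp add: direction_def abs_divide)

text \<open>The quotient rule gives two terms, each at most \<open>K1\<close>, because the
  derivatives of \<open>b j k\<close> and of \<open>Bsmooth\<close> are both at most
  \<open>K1 * Bsmooth\<close>. A bound relative to the size of the field is what the normalisation
  calls for.\<close>

lemma direction_lipschitz_on_convex:
  fixes b :: "'n::{finite,linorder} \<Rightarrow> 'n \<Rightarrow> (real,'n) vec \<Rightarrow> real"
  assumes "convex S" and d: "\<And>x j k. x \<in> S \<Longrightarrow> b j k differentiable (at x)"
    and g: "\<And>x. x \<in> S \<Longrightarrow> gradBnorm b x \<le> K1 * Bsmooth b x" and K1: "K1 \<ge> 0" and jk: "j < k"
    and xy: "x \<in> S" "y \<in> S"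
  shows "\<bar>direction b j k x - direction b j k y\<bar> \<le> 2 * K1 * norm (x - y)"
proof -
  let ?b' = "\<lambda>x. frechet_derivative (b j k) (at x)"
  define D where "D x h = (?b' x h * Bsmooth b x - b j k x * dBsmooth b x h) / (Bsmooth b x * Bsmooth b x)" for x h
  have pos: "Bsmooth b x > 0" for x using Bsmooth_ge_1[of b x] by linarith
  have "norm (direction b j k x - direction b j k y) \<le> 2 * K1 * norm (x - y)"
  proof (rule differentiable_bound[OF assms(1) _ _ xy])
    fix x assume x: "x \<in> S"
    have db: "(b j k has_derivative ?b' x) (at x)" using d[OF x] frechet_derivative_works by blast
    have "(direction b j k has_derivative D x) (at x)"
      unfolding direction_def[abs_def] D_def[abs_def]
      by (rule has_derivative_divide'[OF db Bsmooth_has_derivative[OF d[OF x]]]) (use pos[of x] in simp)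
    then show "(direction b j k has_derivative D x) (at x within S)" by (rule has_derivative_at_withinI)
    show "onorm (D x) \<le> 2 * K1"
    proof (rule onorm_bound)
      show "0 \<le> 2 * K1" using K1 by simp
      fix h :: "(real,'n) vec"
      have gh: "gradBnorm b x * norm h \<le> (K1 * norm h) * Bsmooth b x"
        using mult_right_mono[OF g[OF x], of "norm h"] by (simp add: mult_ac)
      have "\<bar>?b' x h\<bar> \<le> (K1 * norm h) * Bsmooth b x"
        using frechet_derivative_le_gradBnorm[of b x j k h, OF d[OF x] jk] gh by linarith
      then have 1: "\<bar>?b' x h * Bsmooth b x\<bar> \<le> (K1 * norm h) * Bsmooth b x * Bsmooth b x"
        using pos[of x] by (simp add: abs_mult)
      have "\<bar>dBsmooth b x h\<bar> \<le> (K1 * norm h) * Bsmooth b x"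
        using dBsmooth_bound[of b x h, OF d[OF x]] gh by linarith
      then have "\<bar>b j k x * dBsmooth b x h\<bar> \<le> Bsmooth b x * ((K1 * norm h) * Bsmooth b x)"
        unfolding abs_mult using pos[of x] by (intro mult_mono abs_le_Bsmooth jk) auto
      with 1 have "\<bar>?b' x h * Bsmooth b x - b j k x * dBsmooth b x h\<bar> \<le> 2 * K1 * norm h * (Bsmooth b x * Bsmooth b x)"
        by (simp add: mult_ac)
      then show "norm (D x h) \<le> 2 * K1 * norm h" using pos[of x] by (simp add: D_def abs_divide pos_divide_le_eq)
    qed
  qed
  then show ?thesis by simp
qed

text \<open>Where the cutoff is nonzero, \<open>infdist x T < M / 2\<close>, and
  \<open>M >= 1\<close> keeps the ball of radius \<open>1/4\<close> within distance
  \<open>3 * M / 4\<close> of \<open>T\<close>, where the field is controlled. For points at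
  distance at least \<open>1/4\<close> the bound 1 on the product suffices; hence the 8.\<close>

lemma transition_direction_lipschitz:
  assumes M: "M \<ge> 1" and d: "\<And>x j k. infdist x T < 3 * M / 4 \<Longrightarrow> b j k differentiable (at x)"
    and g: "\<And>x. infdist x T < 3 * M / 4 \<Longrightarrow> gradBnorm b x \<le> K1 * Bsmooth b x" and K1: "K1 \<ge> 0" and jk: "j < k"
  shows "(2 * K1 + 8)-lipschitz_on UNIV (\<lambda>x. transition_cutoff T M x * direction b j k x)"
proof (rule lipschitz_onI)
  show "0 \<le> 2 * K1 + 8" using K1 by simp
  let ?e = "transition_cutoff T M" and ?\<beta> = "direction b j k"
  note er = transition_cutoff_range[OF M, of T] and br = direction_bound[OF jk, of b]
  have main: "\<bar>?e x * ?\<beta> x - ?e y * ?\<beta> y\<bar> \<le> (2 * K1 + 8) * norm (x - y)" if x: "?e x \<noteq> 0" for x y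
  proof (cases "norm (x - y) < 1/4")
    case True
    have "0 < ?e x" using x er(1)[of x] by simp
    then have "2 / M * infdist x T < 1" by (simp add: transition_cutoff_def)
    then have ix: "infdist x T < M / 2" using M by (simp add: field_simps)
    have near: "infdist z T < 3 * M / 4" if "z \<in> ball x (1/4)" for z
      using infdist_triangle[of z T x] ix that M by (simp add: dist_commute)
    have "\<bar>?\<beta> x - ?\<beta> y\<bar> \<le> 2 * K1 * norm (x - y)"
      by (rule direction_lipschitz_on_convex[where S = "ball x (1/4)"])
        (use near d g K1 jk True in \<open>auto simp: dist_norm\<close>)
    moreover have "?e x * ?\<beta> x - ?e y * ?\<beta> y = ?e x * (?\<beta> x - ?\<beta> y) + (?e x - ?e y) * ?\<beta> y"
      by (simp add: algebra_simps)
    moreover have "\<bar>?e x * (?\<beta> x - ?\<beta> y)\<bar> \<le> \<bar>?\<beta> x - ?\<beta> y\<bar>"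
      using er[of x] by (simp add: abs_mult mult_left_le_one_le)
    moreover have "\<bar>(?e x - ?e y) * ?\<beta> y\<bar> \<le> \<bar>?e x - ?e y\<bar>"
      using br[of y] by (simp add: abs_mult mult_right_le_one_le)
    ultimately have "\<bar>?e x * ?\<beta> x - ?e y * ?\<beta> y\<bar> \<le> 2 * K1 * norm (x - y) + 2 * norm (x - y)"
      using transition_cutoff_lipschitz[OF M, of T x y] by linarith
    also have "\<dots> \<le> (2 * K1 + 8) * norm (x - y)" by (simp add: distrib_right)
    finally show ?thesis .
  next
    case False
    have "\<bar>?e z * ?\<beta> z\<bar> \<le> 1" for z using er[of z] br[of z] by (simp add: abs_mult mult_le_one)
    from this[of x] this[of y] have "\<bar>?e x * ?\<beta> x - ?e y * ?\<beta> y\<bar> \<le> 2" by linarith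
    also have "\<dots> \<le> 8 * norm (x - y)" using False by simp
    also have "\<dots> \<le> (2 * K1 + 8) * norm (x - y)" using K1 by (intro mult_right_mono) auto
    finally show ?thesis .
  qed
  fix x y
  have "\<bar>?e x * ?\<beta> x - ?e y * ?\<beta> y\<bar> \<le> (2 * K1 + 8) * norm (x - y)"
  proof (cases "?e x = 0 \<and> ?e y = 0")
    case True then show ?thesis using K1 by simp
  next
    case False
    then show ?thesis using main[of x y] main[of y x] by (auto simp: abs_minus_commute norm_minus_commute)
  qed
  then show "dist (?e x * ?\<beta> x) (?e y * ?\<beta> y) \<le> (2 * K1 + 8) * dist x y" by (simp add: dist_norm)
qed

text \<open>Cauchy-Schwarz bounds the square of \<open>Bnorm\<close> by a multiple of the sum of
  squares, and \<open>Bnorm >= 1\<close> gives \<open>Bsmooth <= 2 * Bnorm\<close>. For a single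
  pair the product with \<open>direction\<close> may be much smaller than the component; only the
  sum recovers \<open>Bnorm\<close>.\<close>

lemma sum_direction_ge:
  fixes b :: "'n::{finite,linorder} \<Rightarrow> 'n \<Rightarrow> (real,'n) vec \<Rightarrow> real"
  assumes B: "Bnorm b x \<ge> 1"
  shows "Bnorm b x \<le> 2 * (real (card (pairs :: ('n \<times> 'n) set)) + 1) * (\<Sum>(j,k)\<in>pairs. b j k x * direction b j k x)"
proof -
  define P where "P = real (card (pairs :: ('n \<times> 'n) set)) + 1"
  define Q where "Q = (\<Sum>(j,k)\<in>pairs. (b j k x)\<^sup>2)"
  have Q0: "Q \<ge> 0" by (auto simp: Q_def intro!: sum_nonneg)
  have pos: "Bsmooth b x > 0" using Bsmooth_ge_1[of b x] by linarith
  have "(Bnorm b x)\<^sup>2 \<le> Q * real (card (pairs :: ('n \<times> 'n) set))"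
    unfolding Bnorm_def Q_def
    using sum_squared_le_sum_of_squares[of "\<lambda>p. \<bar>b (fst p) (snd p) x\<bar>" "pairs :: ('n \<times> 'n) set"]
    by (simp add: case_prod_unfold)
  also have "\<dots> \<le> Q * P" using Q0 by (simp add: P_def mult_left_mono)
  finally have 1: "(Bnorm b x)\<^sup>2 \<le> Q * P" .
  have "Bnorm b x * Bsmooth b x \<le> Bnorm b x * (2 * Bnorm b x)"
    using Bsmooth_le_Bnorm[of b x] B by (intro mult_left_mono) auto
  also have "\<dots> \<le> 2 * (Q * P)" using 1 by (simp add: power2_eq_square)
  finally have "Bnorm b x \<le> 2 * P * (Q / Bsmooth b x)" using pos by (simp add: field_simps)
  also have "Q / Bsmooth b x = (\<Sum>(j,k)\<in>pairs. b j k x * direction b j k x)"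
    by (simp add: Q_def direction_def sum_divide_distrib power2_eq_square case_prod_unfold)
  finally show ?thesis by (simp add: P_def)
qed

subsection \<open>The magnetic lower bound\<close>

text \<open>The gradient hypothesis enters through its consequence \<open>gB\<close>, on the smaller
  width \<open>3 * M / 4\<close>: the margin \<open>M / 4\<close> is spent on the balls of radius
  \<open>1/4\<close> used in point picking.\<close>

locale two_regions = magnetic_test a b f1 f2 R
  for a :: "(real,'n::{finite,linorder}) vec \<Rightarrow> (real,'n) vec" and b f1 f2 R +
  fixes \<Omega>1 \<Omega>2 T :: "((real,'n) vec) set" and M d1 d2 K1 :: real
  assumes B1: "AE x in lborel. Bnorm b x \<ge> 1"
    and op: "open \<Omega>1" "open \<Omega>2" and cover: "\<Omega>1 \<union> T \<union> \<Omega>2 = UNIV"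
    and d: "d1 > 0" "d2 > 0" "setdist (\<Omega>1 - T) (frontier \<Omega>1) = d1" "setdist (\<Omega>2 - T) (frontier \<Omega>2) = d2"
    and sign1: "\<And>j k. (AE x in lborel. x \<in> \<Omega>1 \<longrightarrow> b j k x \<ge> 0) \<or> (AE x in lborel. x \<in> \<Omega>1 \<longrightarrow> b j k x \<le> 0)"
    and sign2: "\<And>j k. (AE x in lborel. x \<in> \<Omega>2 \<longrightarrow> b j k x \<ge> 0) \<or> (AE x in lborel. x \<in> \<Omega>2 \<longrightarrow> b j k x \<le> 0)"
    and M: "M \<ge> 1" and K1: "K1 \<ge> 0"
    and diff: "\<And>x j k. infdist x T < 3 * M / 4 \<Longrightarrow> b j k differentiable (at x)"
    and gB: "\<And>x. infdist x T < 3 * M / 4 \<Longrightarrow> gradBnorm b x \<le> K1 * Bsmooth b x"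
begin

text \<open>Every pair is tested with three multipliers, one for each region and one for the
  transition, which together dominate \<open>Bnorm\<close> up to the factor \<open>2 * P\<close>.
  The zeroth order terms amount to at most half of the left side, which is finite by local
  integrability, and are absorbed.\<close>

lemma field_energy_bound:
  defines "P \<equiv> real (card (pairs :: ('n \<times> 'n) set)) + 1"
    and "L \<equiv> max (2 * K1 + 8) (max (1 / d1) (1 / d2))"
  shows "(LINT x|lborel. Bnorm b x * F x) \<le> 12 * P\<^sup>2 * (2 + (L + 1)\<^sup>2 * (12 * P\<^sup>2)) * (LINT x|lborel. Dsq a f1 f2 x)"
proof -
  let ?E = "LINT x|lborel. Dsq a f1 f2 x"
  have P1: "P \<ge> 1" by (simp add: P_def)
  \<comment> \<open>Three estimates for each of at most \<open>P\<close> pairs and the factor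
    \<open>2 * P\<close> make \<open>6 * P\<^sup>2\<close>; this value turns
    \<open>6 * P\<^sup>2 * \<epsilon>\<close> into \<open>1/2\<close>.\<close>
  define \<epsilon> where "\<epsilon> = 1 / (12 * P\<^sup>2)"
  have \<epsilon>: "\<epsilon> > 0" using P1 by (simp add: \<epsilon>_def)
  define X where "X = (2 + (L + 1)\<^sup>2 / \<epsilon>) * ?E + \<epsilon> * (LINT x|lborel. F x)"
  define I where "I = (LINT x|lborel. Bnorm b x * F x)"
  define \<psi>1 where "\<psi>1 = region_cutoff \<Omega>1 d1"
  define \<psi>2 where "\<psi>2 = region_cutoff \<Omega>2 d2"
  define \<eta> where "\<eta> j k x = transition_cutoff T M x * direction b j k x" for j k x
  have lip: "L-lipschitz_on UNIV \<psi>1" "L-lipschitz_on UNIV \<psi>2"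
    unfolding \<psi>1_def \<psi>2_def L_def
    by (rule lipschitz_on_mono[OF region_cutoff_lipschitz]; use d in auto)+
  have lip3: "L-lipschitz_on UNIV (\<eta> j k)" if "j < k" for j k
    unfolding \<eta>_def[abs_def] L_def
    by (rule lipschitz_on_mono[OF transition_direction_lipschitz[OF M diff gB K1 that]]) auto
  have r: "0 \<le> \<psi>1 x" "\<psi>1 x \<le> 1" "0 \<le> \<psi>2 x" "\<psi>2 x \<le> 1" for x
    using region_cutoff_range d by (auto simp: \<psi>1_def \<psi>2_def)
  have b\<psi>: "\<bar>\<psi>1 x\<bar> \<le> 1" "\<bar>\<psi>2 x\<bar> \<le> 1" for x using r[of x] by auto
  have b\<eta>: "\<bar>\<eta> j k x\<bar> \<le> 1" if "j < k" for j k x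
    using transition_cutoff_range[OF M, of T x] direction_bound[OF that, of b x]
    by (simp add: \<eta>_def abs_mult mult_le_one)
  have bd: "\<bar>LINT x|lborel. b j k x * (\<psi>1 x * F x)\<bar> \<le> X" "\<bar>LINT x|lborel. b j k x * (\<psi>2 x * F x)\<bar> \<le> X" for j k
    unfolding X_def by (rule commutator_bound[OF lip(1) b\<psi>(1) \<epsilon>], rule commutator_bound[OF lip(2) b\<psi>(2) \<epsilon>])
  have bd3: "\<bar>LINT x|lborel. b j k x * (\<eta> j k x * F x)\<bar> \<le> X" if "j < k" for j k
    unfolding X_def by (rule commutator_bound[OF lip3[OF that] b\<eta>[OF that] \<epsilon>])
  have Fm: "F \<in> borel_measurable borel"
    using smooth_fun_continuous[OF smooth_F] by (rule borel_measurable_continuous_onI)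
  have int: "integrable lborel (\<lambda>x. b j k x * (\<phi> x * F x))"
    if "L-lipschitz_on UNIV \<phi>" "\<And>x. \<bar>\<phi> x\<bar> \<le> 1" for \<phi> j k
  proof (rule Bochner_Integration.integrable_bound[OF integrable_bF[of j k]])
    have "\<phi> \<in> borel_measurable borel"
      using lipschitz_on_continuous_on[OF that(1)] by (rule borel_measurable_continuous_onI)
    then show "(\<lambda>x. b j k x * (\<phi> x * F x)) \<in> borel_measurable lborel" using Fm b_meas by simp
    show "AE x in lborel. norm (b j k x * (\<phi> x * F x)) \<le> norm (b j k x * F x)"
      using that(2) by (intro AE_I2) (auto simp: abs_mult intro!: mult_left_mono mult_left_le_one_le)
  qed
  note i1 = int[OF lip(1) b\<psi>(1)] and i2 = int[OF lip(2) b\<psi>(2)]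
  have i3: "integrable lborel (\<lambda>x. b j k x * (\<eta> j k x * F x))" if "j < k" for j k
    by (rule int[OF lip3[OF that] b\<eta>[OF that]])
  \<comment> \<open>The sign is constant almost everywhere on a region, so it leaves the integral as
    a number and the multiplier remains the Lipschitz cutoff.\<close>
  define s1 where "s1 j k = (if AE x in lborel. x \<in> \<Omega>1 \<longrightarrow> b j k x \<ge> 0 then 1 else (-1::real))" for j k
  define s2 where "s2 j k = (if AE x in lborel. x \<in> \<Omega>2 \<longrightarrow> b j k x \<ge> 0 then 1 else (-1::real))" for j k
  have s: "\<bar>s1 j k\<bar> = 1" "\<bar>s2 j k\<bar> = 1" for j k by (auto simp: s1_def s2_def)
  have a1: "AE x in lborel. s1 j k * (b j k x * \<psi>1 x) = \<bar>b j k x\<bar> * \<psi>1 x" for j k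
  proof -
    have "AE x in lborel. x \<in> \<Omega>1 \<longrightarrow> s1 j k * b j k x = \<bar>b j k x\<bar>"
    proof (cases "AE x in lborel. x \<in> \<Omega>1 \<longrightarrow> b j k x \<ge> 0")
      case True
      from True show ?thesis by eventually_elim (use True in \<open>simp add: s1_def\<close>)
    next
      case False
      then have "AE x in lborel. x \<in> \<Omega>1 \<longrightarrow> b j k x \<le> 0" using sign1 by blast
      then show ?thesis by eventually_elim (use False in \<open>simp add: s1_def\<close>)
    qed
    then show ?thesis
      by eventually_elim (auto simp: \<psi>1_def region_cutoff_outside mult.assoc[symmetric])
  qed
  have a2: "AE x in lborel. s2 j k * (b j k x * \<psi>2 x) = \<bar>b j k x\<bar> * \<psi>2 x" for j k
  proof -
    have "AE x in lborel. x \<in> \<Omega>2 \<longrightarrow> s2 j k * b j k x = \<bar>b j k x\<bar>"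
    proof (cases "AE x in lborel. x \<in> \<Omega>2 \<longrightarrow> b j k x \<ge> 0")
      case True
      from True show ?thesis by eventually_elim (use True in \<open>simp add: s2_def\<close>)
    next
      case False
      then have "AE x in lborel. x \<in> \<Omega>2 \<longrightarrow> b j k x \<le> 0" using sign2 by blast
      then show ?thesis by eventually_elim (use False in \<open>simp add: s2_def\<close>)
    qed
    then show ?thesis
      by eventually_elim (auto simp: \<psi>2_def region_cutoff_outside mult.assoc[symmetric])
  qed
  define \<Theta> where "\<Theta> x = (\<Sum>(j,k)\<in>pairs. s1 j k * (b j k x * (\<psi>1 x * F x)) + s2 j k * (b j k x * (\<psi>2 x * F x))
      + b j k x * (\<eta> j k x * F x))" for x
  have \<Theta>i: "integrable lborel \<Theta>"
    unfolding \<Theta>_def[abs_def] case_prod_unfold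
    by (intro Bochner_Integration.integrable_sum Bochner_Integration.integrable_add integrable_mult_right i1 i2 i3) auto
  have pw: "AE x in lborel. Bnorm b x * F x \<le> 2 * P * \<Theta> x"
  proof -
    have "AE x in lborel. \<forall>j k. s1 j k * (b j k x * \<psi>1 x) = \<bar>b j k x\<bar> * \<psi>1 x"
      "AE x in lborel. \<forall>j k. s2 j k * (b j k x * \<psi>2 x) = \<bar>b j k x\<bar> * \<psi>2 x"
      by (intro AE_all_countable[THEN iffD2] allI a1, intro AE_all_countable[THEN iffD2] allI a2)
    with B1 show ?thesis
    proof eventually_elim
      case (elim x)
      define Z where "Z = (\<Sum>(j,k)\<in>pairs. b j k x * direction b j k x)"
      have "\<Theta> x = (\<Sum>(j,k)\<in>pairs. (\<bar>b j k x\<bar> * \<psi>1 x + \<bar>b j k x\<bar> * \<psi>2 x + transition_cutoff T M x * (b j k x * direction b j k x)) * F x)"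
        unfolding \<Theta>_def
      proof (rule sum.cong[OF refl], clarsimp)
        fix j k :: 'n
        have "s1 j k * (b j k x * (\<psi>1 x * F x)) = (s1 j k * (b j k x * \<psi>1 x)) * F x" by simp
        also have "\<dots> = (\<bar>b j k x\<bar> * \<psi>1 x) * F x" by (simp only: elim(2)[rule_format])
        finally have e1: "s1 j k * (b j k x * (\<psi>1 x * F x)) = (\<bar>b j k x\<bar> * \<psi>1 x) * F x" .
        have "s2 j k * (b j k x * (\<psi>2 x * F x)) = (s2 j k * (b j k x * \<psi>2 x)) * F x" by simp
        also have "\<dots> = (\<bar>b j k x\<bar> * \<psi>2 x) * F x" by (simp only: elim(3)[rule_format])
        finally have e2: "s2 j k * (b j k x * (\<psi>2 x * F x)) = (\<bar>b j k x\<bar> * \<psi>2 x) * F x" .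
        show "s1 j k * (b j k x * (\<psi>1 x * F x)) + s2 j k * (b j k x * (\<psi>2 x * F x)) + b j k x * (\<eta> j k x * F x)
          = (\<bar>b j k x\<bar> * \<psi>1 x + \<bar>b j k x\<bar> * \<psi>2 x + transition_cutoff T M x * (b j k x * direction b j k x)) * F x"
          unfolding e1 e2 \<eta>_def by (simp add: algebra_simps)
      qed
      also have "\<dots> = (Bnorm b x * \<psi>1 x + Bnorm b x * \<psi>2 x + transition_cutoff T M x * Z) * F x"
        by (simp add: Bnorm_def Z_def case_prod_unfold sum.distrib sum_distrib_left[symmetric] sum_distrib_right[symmetric])
      finally have \<Theta>: "\<Theta> x = (Bnorm b x * \<psi>1 x + Bnorm b x * \<psi>2 x + transition_cutoff T M x * Z) * F x" .
      have Z: "Bnorm b x \<le> 2 * P * Z" using sum_direction_ge[OF elim(1)] by (simp add: Z_def P_def)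
      have Z0: "Z \<ge> 0" unfolding Z_def
        by (rule sum_nonneg) (auto simp: direction_def intro!: divide_nonneg_nonneg order_trans[OF zero_le_one Bsmooth_ge_1])
      have B0: "Bnorm b x \<ge> 0" by (rule Bnorm_nonneg)
      have t0: "transition_cutoff T M x \<ge> 0" by (rule transition_cutoff_range[OF M])
      define q where "q = Bnorm b x * \<psi>1 x + Bnorm b x * \<psi>2 x + transition_cutoff T M x * Z"
      have n: "0 \<le> Bnorm b x * \<psi>1 x" "0 \<le> Bnorm b x * \<psi>2 x" "0 \<le> transition_cutoff T M x * Z"
        using B0 r t0 Z0 by auto
      \<comment> \<open>On \<open>T\<close> the transition cutoff is 1 and \<open>Z\<close> recovers
        the field; off \<open>T\<close> the point lies in \<open>\<Omega>1 - T\<close> or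
        \<open>\<Omega>2 - T\<close>, where the cutoff of that region is 1. The other summands are
        nonnegative.\<close>
      have "Bnorm b x \<le> 2 * P * q"
      proof (cases "x \<in> T")
        case True
        then have "transition_cutoff T M x = 1" by (simp add: transition_cutoff_def)
        then have "Z \<le> q" using n by (simp add: q_def)
        then have "2 * P * Z \<le> 2 * P * q" using P1 by (intro mult_left_mono) auto
        with Z show ?thesis by linarith
      next
        case False
        then have "\<psi>1 x = 1 \<or> \<psi>2 x = 1"
          using cover region_cutoff_inside[OF op(1) d(1,3)] region_cutoff_inside[OF op(2) d(2,4)]
          by (auto simp: \<psi>1_def \<psi>2_def)
        then have q: "Bnorm b x \<le> q" using n by (auto simp: q_def)
        then have "1 * q \<le> 2 * P * q" using P1 B0 by (intro mult_right_mono) auto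
        with q show ?thesis by linarith
      qed
      then have "Bnorm b x * F x \<le> 2 * P * q * F x" using F_nonneg by (intro mult_right_mono)
      then show ?case by (simp add: \<Theta> q_def mult.assoc)
    qed
  qed
  have Bi: "integrable lborel (\<lambda>x. Bnorm b x * F x)"
  proof -
    have "integrable lborel (\<lambda>x. \<Sum>(j,k)\<in>pairs. \<bar>b j k x * F x\<bar>)"
      unfolding case_prod_unfold by (intro Bochner_Integration.integrable_sum integrable_abs integrable_bF)
    moreover have "(\<Sum>(j,k)\<in>pairs. \<bar>b j k x * F x\<bar>) = Bnorm b x * F x" for x
      using F_nonneg[of x] by (simp add: Bnorm_def abs_mult sum_distrib_right case_prod_unfold)
    ultimately show ?thesis by simp
  qed
  have X0: "X \<ge> 0" using bd(1)[of undefined undefined] by linarith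
  define \<theta> where "\<theta> p x = s1 (fst p) (snd p) * (b (fst p) (snd p) x * (\<psi>1 x * F x))
      + s2 (fst p) (snd p) * (b (fst p) (snd p) x * (\<psi>2 x * F x)) + b (fst p) (snd p) x * (\<eta> (fst p) (snd p) x * F x)" for p x
  have \<theta>: "integrable lborel (\<theta> p)" "(LINT x|lborel. \<theta> p x) \<le> 3 * X" if "p \<in> pairs" for p
  proof -
    obtain j k where p: "p = (j, k)" "j < k" using \<open>p \<in> pairs\<close> by (cases p) auto
    show "integrable lborel (\<theta> p)" unfolding \<theta>_def[abs_def] p using i1 i2 i3[OF p(2)] by simp
    have "s1 j k * (LINT x|lborel. b j k x * (\<psi>1 x * F x)) \<le> X" "s2 j k * (LINT x|lborel. b j k x * (\<psi>2 x * F x)) \<le> X"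
      using bd(1)[of j k] bd(2)[of j k] by (auto simp: s1_def s2_def abs_le_iff)
    moreover have "(LINT x|lborel. b j k x * (\<eta> j k x * F x)) \<le> X" using bd3[OF p(2)] by linarith
    moreover have "(LINT x|lborel. \<theta> p x) = s1 j k * (LINT x|lborel. b j k x * (\<psi>1 x * F x))
      + s2 j k * (LINT x|lborel. b j k x * (\<psi>2 x * F x)) + (LINT x|lborel. b j k x * (\<eta> j k x * F x))"
      unfolding \<theta>_def p using i1 i2 i3[OF p(2)] by simp
    ultimately show "(LINT x|lborel. \<theta> p x) \<le> 3 * X" by linarith
  qed
  have "(LINT x|lborel. \<Theta> x) = (LINT x|lborel. (\<Sum>p\<in>pairs. \<theta> p x))"
    unfolding \<Theta>_def \<theta>_def by (intro Bochner_Integration.integral_cong sum.cong) auto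
  also have "\<dots> = (\<Sum>p\<in>pairs. LINT x|lborel. \<theta> p x)" by (rule Bochner_Integration.integral_sum) (rule \<theta>)
  also have "\<dots> \<le> (\<Sum>p\<in>(pairs :: ('n \<times> 'n) set). 3 * X)" by (rule sum_mono) (rule \<theta>)
  also have "\<dots> \<le> P * (3 * X)" using X0 by (simp add: P_def mult_right_mono)
  finally have \<Theta>X: "(LINT x|lborel. \<Theta> x) \<le> 3 * P * X" by simp
  have "I \<le> (LINT x|lborel. 2 * P * \<Theta> x)"
    unfolding I_def by (rule integral_mono_AE[OF Bi _ pw]) (use \<Theta>i in simp)
  also have "\<dots> = 2 * P * (LINT x|lborel. \<Theta> x)" by simp
  also have "\<dots> \<le> 2 * P * (3 * P * X)" using \<Theta>X P1 by (intro mult_left_mono) auto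
  finally have IX: "I \<le> 6 * P\<^sup>2 * X" by (simp add: power2_eq_square)
  have "(LINT x|lborel. F x) \<le> I"
    unfolding I_def
  proof (rule integral_mono_AE[OF integrable_F Bi])
    show "AE x in lborel. F x \<le> Bnorm b x * F x"
      using B1
    proof eventually_elim
      case (elim x)
      then show ?case using mult_right_mono[of 1 "Bnorm b x" "F x"] F_nonneg[of x] by simp
    qed
  qed
  then have "\<epsilon> * (LINT x|lborel. F x) \<le> \<epsilon> * I" using \<epsilon> by (intro mult_left_mono) auto
  then have "6 * P\<^sup>2 * X \<le> 6 * P\<^sup>2 * ((2 + (L + 1)\<^sup>2 / \<epsilon>) * ?E + \<epsilon> * I)"
    unfolding X_def by (intro mult_left_mono) auto
  also have "\<dots> = 6 * P\<^sup>2 * ((2 + (L + 1)\<^sup>2 / \<epsilon>) * ?E) + (6 * P\<^sup>2 * \<epsilon>) * I"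
    by (simp add: distrib_left)
  also have "6 * P\<^sup>2 * \<epsilon> = 1 / 2" using P1 by (simp add: \<epsilon>_def)
  finally have "I \<le> 2 * (6 * P\<^sup>2 * ((2 + (L + 1)\<^sup>2 / \<epsilon>) * ?E))" using IX by linarith
  also have "(L + 1)\<^sup>2 / \<epsilon> = (L + 1)\<^sup>2 * (12 * P\<^sup>2)" by (simp add: \<epsilon>_def)
  finally show ?thesis by (simp add: I_def)
qed

end

section \<open>Complex test functions and the final constant\<close>

lemma Da_sq_eq_Dsq:
  assumes "f differentiable (at x)"
  shows "Da_sq a f x = Dsq a (\<lambda>x. Re (f x)) (\<lambda>x. Im (f x)) x"
  unfolding Da_sq_def Dsq_def DRe_def DIm_def
  by (simp add: cmod_power2 pd_compose_linear[OF bounded_linear_Re assms] pd_compose_linear[OF bounded_linear_Im assms])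

theorem theorem5p9:
  fixes C1 K d1 d2 Q :: real
  assumes "CARD('n::{finite,linorder}) \<ge> 3" and "C1 > 0" and "K \<ge> 1"
    and "d1 > 0" and "d2 > 0"
  shows "\<exists>\<mu>>0. \<forall>(a :: (real,'n) vec \<Rightarrow> (real,'n) vec) (b :: 'n \<Rightarrow> 'n \<Rightarrow> (real,'n) vec \<Rightarrow> real)
            (\<Omega>1 :: ((real,'n) vec) set) \<Omega>2 T M (u :: (real,'n) vec \<Rightarrow> real).
     magnetic_field a b \<and>
     in_RH (real CARD('n) / 2) (Bnorm b) \<and> RH_char (real CARD('n) / 2) (Bnorm b) = Q \<and>
     (AE x in lborel. Bnorm b x \<ge> 1) \<and>
     open \<Omega>1 \<and> open \<Omega>2 \<and> open T \<and> \<Omega>1 \<union> T \<union> \<Omega>2 = UNIV \<and>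
     frontier \<Omega>1 \<subseteq> T \<and> frontier \<Omega>2 \<subseteq> T \<and>
     setdist (\<Omega>1 - T) (frontier \<Omega>1) = d1 \<and> setdist (\<Omega>2 - T) (frontier \<Omega>2) = d2 \<and>
     (\<forall>j k. (AE x in lborel. x \<in> \<Omega>1 \<longrightarrow> b j k x \<ge> 0) \<or> (AE x in lborel. x \<in> \<Omega>1 \<longrightarrow> b j k x \<le> 0)) \<and>
     (\<forall>j k. (AE x in lborel. x \<in> \<Omega>2 \<longrightarrow> b j k x \<ge> 0) \<or> (AE x in lborel. x \<in> \<Omega>2 \<longrightarrow> b j k x \<le> 0)) \<and>
     M \<ge> max 1 (sqrt \<mu>) \<and>
     (\<forall>x. infdist x T < M \<longrightarrow>
        (\<forall>j k. b j k differentiable (at x)) \<and>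
        gradBnorm b x \<le> K * (mfun C1 (\<lambda>y. Bnorm b y + 1) x)\<^sup>2) \<and>
     is_landscape (Bnorm b) u
     \<longrightarrow> (\<exists>C::real. \<forall>f :: (real,'n) vec \<Rightarrow> complex. test_fun f \<longrightarrow>
           (\<integral>\<^sup>+x. ennreal ((cmod (f x))\<^sup>2 / u x) \<partial>lborel)
             \<le> ennreal C * (\<integral>\<^sup>+x. ennreal (Da_sq a f x) \<partial>lborel))"
proof -
  obtain K1 where K1: "K1 \<ge> 0" and grad_bound: "\<And>(b :: 'n \<Rightarrow> 'n \<Rightarrow> (real,'n) vec \<Rightarrow> real) x.
    (\<forall>x r. set_integrable lborel (ball x r) (Bnorm b)) \<Longrightarrow>
    (\<forall>y\<in>ball x (1/4). (\<forall>j k. b j k differentiable (at y)) \<and> gradBnorm b y \<le> K * (mfun C1 (\<lambda>y. Bnorm b y + 1) y)\<^sup>2) \<Longrightarrow>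
    gradBnorm b x \<le> K1 * Bsmooth b x"
    using mfun_le_Bsmooth[OF assms(2,3), where 'n = 'n] by blast
  define P where "P = real (card (pairs :: ('n \<times> 'n) set)) + 1"
  define L where "L = max (2 * K1 + 8) (max (1 / d1) (1 / d2))"
  \<comment> \<open>Determined by the dimension, \<open>K\<close>, \<open>C1\<close>,
    \<open>d1\<close> and \<open>d2\<close>. The 1 added to it below comes from
    \<open>landscape_bound\<close>.\<close>
  define C where "C = 12 * P\<^sup>2 * (2 + (L + 1)\<^sup>2 * (12 * P\<^sup>2))"
  have C0: "C \<ge> 0" by (simp add: C_def)
  show ?thesis
  \<comment> \<open>With \<open>\<mu> = 1\<close> the condition on \<open>M\<close> reads
    \<open>M >= 1\<close>, which makes the margin between \<open>3 * M / 4\<close> and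
    \<open>M\<close> at least \<open>1/4\<close>.\<close>
  proof (rule exI[of _ "1::real"], rule conjI, simp, intro allI impI, elim conjE, rule exI[of _ "1 + C"], intro allI impI)
    fix a :: "(real,'n) vec \<Rightarrow> (real,'n) vec" and b :: "'n \<Rightarrow> 'n \<Rightarrow> (real,'n) vec \<Rightarrow> real"
      and \<Omega>1 \<Omega>2 T :: "((real,'n) vec) set" and M and u :: "(real,'n) vec \<Rightarrow> real" and f :: "(real,'n) vec \<Rightarrow> complex"
    assume mag: "magnetic_field a b" and RH: "in_RH (real CARD('n) / 2) (Bnorm b)"
      and B1: "AE x in lborel. Bnorm b x \<ge> 1"
      and op: "open \<Omega>1" "open \<Omega>2" "\<Omega>1 \<union> T \<union> \<Omega>2 = UNIV"
      and d: "setdist (\<Omega>1 - T) (frontier \<Omega>1) = d1" "setdist (\<Omega>2 - T) (frontier \<Omega>2) = d2"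
      and sign: "\<forall>j k. (AE x in lborel. x \<in> \<Omega>1 \<longrightarrow> b j k x \<ge> 0) \<or> (AE x in lborel. x \<in> \<Omega>1 \<longrightarrow> b j k x \<le> 0)"
        "\<forall>j k. (AE x in lborel. x \<in> \<Omega>2 \<longrightarrow> b j k x \<ge> 0) \<or> (AE x in lborel. x \<in> \<Omega>2 \<longrightarrow> b j k x \<le> 0)"
      and M: "M \<ge> max 1 (sqrt 1)"
      and gB: "\<forall>x. infdist x T < M \<longrightarrow> (\<forall>j k. b j k differentiable (at x)) \<and>
        gradBnorm b x \<le> K * (mfun C1 (\<lambda>y. Bnorm b y + 1) x)\<^sup>2"
      and u: "is_landscape (Bnorm b) u" and f: "test_fun f"
    have M1: "M \<ge> 1" using M by simp
    have Bi: "\<forall>x r. set_integrable lborel (ball x r) (Bnorm b)" using RH by (simp add: in_RH_def)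
    interpret loc_weight "Bnorm b"
      by unfold_locales (use RH in \<open>auto simp: in_RH_def\<close>)
    define f1 where "f1 x = Re (f x)" for x
    define f2 where "f2 x = Im (f x)" for x
    obtain R where R: "\<And>x. norm x \<ge> R \<Longrightarrow> f x = 0" and sf: "smooth_fun f" using f by (auto simp: test_fun_def)
    have near: "\<forall>y\<in>ball x (1/4). infdist y T < M" if "infdist x T < 3 * M / 4" for x
    proof
      fix y assume "y \<in> ball x (1/4)"
      then show "infdist y T < M" using infdist_triangle[of y T x] that M1 by (simp add: dist_commute)
    qed
    interpret two_regions a b f1 f2 R \<Omega>1 \<Omega>2 T M d1 d2 K1
    proof unfold_locales
      show "smooth_fun f1" "smooth_fun f2"
        unfolding f1_def[abs_def] f2_def[abs_def]
        by (rule smooth_fun_compose_linear[OF bounded_linear_Re sf], rule smooth_fun_compose_linear[OF bounded_linear_Im sf])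
      show "f1 x = 0" "f2 x = 0" if "R \<le> norm x" for x using R[OF that] by (simp_all add: f1_def f2_def)
      show "b j k differentiable (at x)" if "infdist x T < 3 * M / 4" for x j k
        using gB that M1 by simp
      show "gradBnorm b x \<le> K1 * Bsmooth b x" if "infdist x T < 3 * M / 4" for x
        using near[OF that] gB by (intro grad_bound[OF Bi]) blast
    qed (use mag B1 op d sign M1 K1 assms in auto)
    have E: "(\<integral>\<^sup>+x. ennreal (Da_sq a f x) \<partial>lborel) = ennreal (LINT x|lborel. Dsq a f1 f2 x)"
    proof -
      have "Da_sq a f = Dsq a f1 f2"
        using Da_sq_eq_Dsq[OF smooth_fun_differentiable[OF sf]] by (simp add: fun_eq_iff f1_def[abs_def] f2_def[abs_def])
      moreover have "(\<integral>\<^sup>+x. ennreal (Dsq a f1 f2 x) \<partial>lborel) = ennreal (LINT x|lborel. Dsq a f1 f2 x)"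
        by (rule nn_integral_eq_integral[OF integrable_Dsq AE_I2[OF Dsq_nonneg]])
      ultimately show ?thesis by simp
    qed
    have E0: "(LINT x|lborel. Dsq a f1 f2 x) \<ge> 0" using Dsq_nonneg by (intro Bochner_Integration.integral_nonneg)
    have "(\<integral>\<^sup>+x. ennreal ((cmod (f x))\<^sup>2 / u x) \<partial>lborel) = (\<integral>\<^sup>+x. ennreal (F x / u x) \<partial>lborel)"
      by (simp add: modsq_def f1_def f2_def cmod_power2)
    also have "\<dots> \<le> ennreal ((LINT x|lborel. Dsq a f1 f2 x) + (LINT x|lborel. Bnorm b x * F x))"
      by (rule landscape_bound[OF magnetic_test_axioms u])
    also have "\<dots> \<le> ennreal ((1 + C) * (LINT x|lborel. Dsq a f1 f2 x))"
      using field_energy_bound by (intro ennreal_leI) (simp add: C_def P_def L_def distrib_right)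
    also have "\<dots> = ennreal (1 + C) * (\<integral>\<^sup>+x. ennreal (Da_sq a f x) \<partial>lborel)"
      using C0 E0 by (simp add: E ennreal_mult)
    finally show "(\<integral>\<^sup>+x. ennreal ((cmod (f x))\<^sup>2 / u x) \<partial>lborel)
             \<le> ennreal (1 + C) * (\<integral>\<^sup>+x. ennreal (Da_sq a f x) \<partial>lborel)" .
  qed
qed

end
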